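(* Let $\beta>0$ and let $V,W\colon\mathbb T^d\to\mathbb R$ satisfy: (i) $V,W\in\mathcal C^2(\mathbb T^d)$; (ii) $W$ is even; (iii) $W$ is either $H$-stable (i.e. it has nonnegative Fourier modes) or satisfies $\|W\|_{L^\infty(\mathbb T^d)}<\beta^{-1}$. Let $f_t$ be the solution of the McKean–Vlasov PDE on $\mathbb T^d$ with initial probability density $f_0$, and $f_\infty$ the unique invariant density. Then for all $t\ge0$ $$\mathcal H(f_t|f_\infty)\le\mathcal H(f_0|f_\infty)e^{-\eta t},$$ where $$\eta=8\left(\frac{\pi^2}{\beta\Gamma}-\|\Delta W\|_{L^\infty(\mathbb T^d)}-\beta\|\nabla W\|_{L^\infty(\mathbb T^d)}\big(\|\nabla V\|_{L^\infty(\mathbb T^d)}+\|\nabla W\|_{L^\infty(\mathbb T^d)}\big)\right),\qquad\Gamma=e^{2\beta\left(\|V\|_{L^\infty(\mathbb T^d)}+\|W\|_{L^\infty(\mathbb T^d)}\right)}.$$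
   Context: $\mathbb T^d$ is the $d$-dimensional torus of side length $1$. The McKean–Vlasov PDE is $\partial_tf_t=\nabla\cdot(\nabla Vf_t+(\nabla W*f_t)f_t)+\beta^{-1}\Delta f_t$. Under the stated hypotheses it has a unique stationary probability density $f_\infty$, which is the unique probability density on $\mathbb T^d$ solving $f_\infty=\frac1Ze^{-\beta(V+W*f_\infty)}$, $Z=\int_{\mathbb T^d}e^{-\beta(V+W*f_\infty)}$. Relative entropy of densities: $\mathcal H(f|g)=\int_{\mathbb T^d}f\log(f/g)\,dx$. *)

theory Defs
  imports "HOL-Probability.Probability"
begin

text \<open>
  Functions on the torus of side length 1 are functions on \<open>real ^ 'd\<close> that are periodic with
  respect to the integer lattice; the dimension is \<open>CARD('d)\<close>.  Integrals over the torus are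
  integrals over the unit cube, which is a fundamental domain up to a null set.
\<close>

definition torus :: "(real ^ 'd) measure" where
  "torus = restrict_space lborel (cbox 0 1)"

definition lattice_periodic :: "(real ^ 'd \<Rightarrow> 'b) \<Rightarrow> bool" where
  "lattice_periodic g \<longleftrightarrow> (\<forall>x (k :: int ^ 'd). g (x + (\<chi> i. of_int (k $ i))) = g x)"

definition pderiv_dir :: "'d \<Rightarrow> (real ^ 'd \<Rightarrow> real) \<Rightarrow> real ^ 'd \<Rightarrow> real" where
  "pderiv_dir i g x = frechet_derivative g (at x) (axis i 1)"

definition grad :: "(real ^ 'd \<Rightarrow> real) \<Rightarrow> real ^ 'd \<Rightarrow> real ^ 'd" where
  "grad g x = (\<chi> i. pderiv_dir i g x)"

definition laplacian :: "(real ^ 'd \<Rightarrow> real) \<Rightarrow> real ^ 'd \<Rightarrow> real" where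
  "laplacian g x = (\<Sum>i\<in>UNIV. pderiv_dir i (pderiv_dir i g) x)"

definition C2_torus :: "(real ^ 'd \<Rightarrow> real) \<Rightarrow> bool" where
  "C2_torus g \<longleftrightarrow> lattice_periodic g
     \<and> (\<forall>x. g differentiable (at x))
     \<and> (\<forall>i x. pderiv_dir i g differentiable (at x))
     \<and> (\<forall>i j. continuous_on UNIV (pderiv_dir j (pderiv_dir i g)))"

text \<open>
  The \<open>L\<^sup>\<infinity>\<close> norm on the torus, of scalar functions or (with the Euclidean norm) of vector fields.
  It is used for continuous periodic functions only, whose essential supremum is finite; for
  unbounded functions \<open>real_of_ereal\<close> would return \<open>0\<close>.
\<close>

definition Linf_norm :: "(real ^ 'd \<Rightarrow> 'b::real_normed_vector) \<Rightarrow> real" where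
  "Linf_norm g = real_of_ereal (esssup torus (\<lambda>x. ereal (norm (g x))))"

definition fourier_mode :: "(real ^ 'd \<Rightarrow> real) \<Rightarrow> int ^ 'd \<Rightarrow> complex" where
  "fourier_mode g k =
     (LINT x|torus. of_real (g x) * exp (- 2 * pi * \<i> * of_real (\<Sum>i\<in>UNIV. of_int (k $ i) * x $ i)))"

definition H_stable :: "(real ^ 'd \<Rightarrow> real) \<Rightarrow> bool" where
  "H_stable g \<longleftrightarrow> (\<forall>k. fourier_mode g k \<in> \<real>\<^sub>\<ge>\<^sub>0)"

text \<open>The convolution is also used with vector-valued kernels, as in the field \<open>\<nabla>W * f\<close>.\<close>

definition torus_conv ::
    "(real ^ 'd \<Rightarrow> 'b::{banach, second_countable_topology}) \<Rightarrow> (real ^ 'd \<Rightarrow> real) \<Rightarrow> real ^ 'd \<Rightarrow> 'b" where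
  "torus_conv K f x = (LINT y|torus. f y *\<^sub>R K (x - y))"

definition prob_density :: "(real ^ 'd \<Rightarrow> real) \<Rightarrow> bool" where
  "prob_density f \<longleftrightarrow> f \<in> borel_measurable borel \<and> lattice_periodic f \<and> (\<forall>x. 0 \<le> f x)
     \<and> integrable torus f \<and> (LINT x|torus. f x) = 1"

text \<open>
  Relative entropy \<open>\<integral> f log (f / g)\<close> with values in the extended reals and the usual conventions
  \<open>0 log (0 / b) = 0\<close> and \<open>a log (a / 0) = \<infinity>\<close> for \<open>a > 0\<close>.  The integral is the difference of the
  integrals of the positive and the negative part (\<open>e2ennreal\<close> sends negative values to \<open>0\<close>); for
  probability densities the latter is finite, since \<open>a log (b / a) \<le> b - a\<close>.
\<close>

definition entropy_integrand :: "real \<Rightarrow> real \<Rightarrow> ereal" where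
  "entropy_integrand a b = (if a = 0 then 0 else if b = 0 then \<infinity> else ereal (a * ln (a / b)))"

definition rel_entropy :: "(real ^ 'd \<Rightarrow> real) \<Rightarrow> (real ^ 'd \<Rightarrow> real) \<Rightarrow> ereal" where
  "rel_entropy f g =
     enn2ereal (\<integral>\<^sup>+x. e2ennreal (entropy_integrand (f x) (g x)) \<partial>torus)
     - enn2ereal (\<integral>\<^sup>+x. e2ennreal (- entropy_integrand (f x) (g x)) \<partial>torus)"

text \<open>
  Solutions of \<open>\<partial>\<^sub>t f = \<nabla>\<cdot>(\<nabla>V f + (\<nabla>W * f) f) + \<beta>\<^sup>-\<^sup>1 \<Delta>f\<close> with initial density \<open>f0\<close> are weak
  solutions: narrowly continuous curves of probability densities that satisfy the equation after
  multiplication by a test function, integration over space and time, and integration by parts in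
  space.  For \<open>V\<close> and \<open>W\<close> merely of class \<open>C\<^sup>2\<close> the zero-order coefficient \<open>\<Delta>V\<close> is only
  continuous, so that derivatives of \<open>f\<close> need not exist in the classical sense, and \<open>f0\<close> is an
  arbitrary density, possibly of infinite entropy.
\<close>

definition McKean_Vlasov_solution ::
    "real \<Rightarrow> (real ^ 'd \<Rightarrow> real) \<Rightarrow> (real ^ 'd \<Rightarrow> real) \<Rightarrow> (real ^ 'd \<Rightarrow> real)
      \<Rightarrow> (real \<Rightarrow> real ^ 'd \<Rightarrow> real) \<Rightarrow> bool" where
  "McKean_Vlasov_solution \<beta> V W f0 f \<longleftrightarrow>
     f 0 = f0
     \<and> (\<forall>t\<ge>0. prob_density (f t))
     \<and> (\<forall>\<phi>. lattice_periodic \<phi> \<and> continuous_on UNIV \<phi> \<longrightarrow>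
            continuous_on {0..} (\<lambda>t. LINT x|torus. \<phi> x * f t x))
     \<and> (\<forall>\<phi> t. C2_torus \<phi> \<and> 0 \<le> t \<longrightarrow>
            ((\<lambda>s. LINT x|torus. (laplacian \<phi> x / \<beta>
                - grad \<phi> x \<bullet> (grad V x + torus_conv (grad W) (f s) x)) * f s x)
             has_integral ((LINT x|torus. \<phi> x * f t x) - (LINT x|torus. \<phi> x * f0 x))) {0..t})"

text \<open>
  The stationary densities of the equation are the probability densities that solve the
  self-consistency equation \<open>f = exp (-\<beta> (V + W * f)) / Z\<close>, as elements of \<open>L\<^sup>1\<close>.
\<close>

definition invariant_density ::
    "real \<Rightarrow> (real ^ 'd \<Rightarrow> real) \<Rightarrow> (real ^ 'd \<Rightarrow> real) \<Rightarrow> (real ^ 'd \<Rightarrow> real) \<Rightarrow> bool" where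
  "invariant_density \<beta> V W f \<longleftrightarrow> prob_density f
     \<and> (let G = (\<lambda>x. exp (- \<beta> * (V x + torus_conv W f x)))
        in AE x in torus. f x = G x / (LINT y|torus. G y))"

end

theory Submission
  imports Defs
begin

text \<open>
  Let \<open>\<mu>\<close> be the continuous version of the invariant density, \<open>h = f\<^sub>t / \<mu>\<close> and \<open>I\<close> the relative
  Fisher information.  Formally, the time derivative of the relative entropy \<open>H\<close> is \<open>- I / \<beta>\<close> minus
  \<open>\<integral> f \<nabla>ln h \<bullet> \<nabla>W * (f - \<mu>)\<close>.  The logarithmic Sobolev inequality of the torus, perturbed
  from the uniform density to \<open>\<mu>\<close>, gives \<open>I \<ge> 8 \<pi>\<^sup>2 H / \<Gamma>\<close>.  Integrating the second term by parts, and
  subtracting the same expression for \<open>\<mu>\<close>, bounds it by a multiple of the squared \<open>L\<^sup>1\<close> distance of \<open>f\<close>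
  and \<open>\<mu>\<close>, hence of \<open>H\<close> by Pinsker's inequality.

  A weak solution need not be regular enough for this computation.  It is applied to
  \<open>\<rho> * f\<^sub>t\<close>, for a positive trigonometric kernel \<open>\<rho>\<close>; the commutator of the mollification with the drift is
  absorbed into a small part of \<open>I\<close>.  In the limit, Jensen's inequality controls
  the initial entropy and Fatou's lemma the entropy at time \<open>t\<close>.

  The sharp logarithmic Sobolev inequality is proved along the heat flow of a positive trigonometric
  polynomial \<open>u\<close>: each directional Fisher information \<open>\<integral> (\<partial>\<^sub>i u)\<^sup>2 / u\<close> decays at rate \<open>8 \<pi>\<^sup>2\<close>, by Wirtinger's
  inequality for \<open>\<partial>\<^sub>i sqrt u\<close>.
\<close>

subsection \<open>Integration over the torus\<close>

text \<open>Estimating the interaction term by Cauchy-Schwarz against \<open>I\<close> would cost a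
  fixed share of the dissipation. Subtracting its value at \<open>\<mu>\<close> is free: grad
  \<open>\<mu>\<close> = -beta \<open>\<mu>\<close> grad U with U = V + W * \<open>\<mu>\<close>, so
  the expression vanishes there, and what remains is quadratic in f - \<open>\<mu>\<close>. Only the
  mollification commutator takes a share delta of \<open>I\<close>, which tends to 0 last. The
  parameters are fixed in the order delta, commutator tolerance, mollification index; this closes
  because the commutator estimate is uniform over all probability densities, hence in time.

  The weak equation is tested with single cosines only, and the trigonometric kernel recombines
  them. The same separation of variables makes the quadratic interaction continuous in time,
  although continuity is given for linear functionals of the solution.

  Entropies are compared through the nonnegative function f ln(f / \<open>\<mu>\<close>) - f +
  \<open>\<mu>\<close>, which has the same integral when f is a density; infinite values and Fatou's
  lemma then raise no question of sign.\<close>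

lemma space_torus [simp]: "space torus = cbox 0 1"
  by (simp add: torus_def space_restrict_space)

lemma measurable_torus: "f \<in> borel_measurable borel \<Longrightarrow> f \<in> measurable torus borel"
  unfolding torus_def by (intro measurable_restrict_space1) simp

lemma prod_one_minus_zero: "(\<Prod>b\<in>Basis. ((1::real^'d) - 0) \<bullet> b) = 1"
proof -
  have "(1::real^'d) \<bullet> b = 1" if "b \<in> Basis" for b
    using that by (auto simp: Basis_vec_def inner_axis)
  then show ?thesis by simp
qed

lemma emeasure_torus_cbox: "emeasure (torus :: (real^'d) measure) (cbox 0 1) = 1"
proof -
  have b: "0 \<bullet> b \<le> (1::real^'d) \<bullet> b" if "b \<in> Basis" for b
    using that by (auto simp: Basis_vec_def inner_axis)
  have "emeasure lborel (cbox (0::real^'d) 1) = 1"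
    by (subst emeasure_lborel_cbox) (use b prod_one_minus_zero in auto)
  then show ?thesis
    by (simp add: torus_def emeasure_restrict_space)
qed

global_interpretation torus: prob_space "torus :: (real^'d) measure"
  by (rule prob_spaceI) (simp add: emeasure_torus_cbox)

text \<open>Half-open, so that its lattice translates cover the space exactly once; for the closed
  cube behind \<open>torus\<close> this holds only up to a null set.\<close>

definition half_cube :: "(real^'d) set" where
  "half_cube = {x. \<forall>i. 0 \<le> x $ i \<and> x $ i < 1}"

lemma half_cube_borel [measurable]: "half_cube \<in> sets borel"
proof -
  have "half_cube = (\<Inter>i. {x::real^'d. 0 \<le> x $ i} \<inter> {x. x $ i < 1})"
    by (auto simp: half_cube_def)
  also have "\<dots> \<in> sets borel"
    by (intro sets.finite_INT sets.Int borel_closed borel_open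
        closed_Collect_le open_Collect_less continuous_intros) auto
  finally show ?thesis .
qed

lemma nn_integral_torus_half_cube:
  assumes [measurable]: "f \<in> borel_measurable borel"
  shows "(\<integral>\<^sup>+x. f x \<partial>torus) = (\<integral>\<^sup>+x. f x * indicator half_cube x \<partial>lborel)"
proof -
  have "emeasure lborel (cbox (0::real^'d) 1 - box 0 1) = 0"
    using emeasure_Diff[of lborel "box (0::real^'d) 1" "cbox 0 1"]
    by (simp add: emeasure_lborel_box_eq emeasure_lborel_cbox_eq box_subset_cbox)
  then have "cbox (0::real^'d) 1 - box 0 1 \<in> null_sets lborel"
    by (auto simp: null_sets_def)
  then have "AE x in lborel. x \<notin> cbox (0::real^'d) 1 - box 0 1"
    by (rule AE_not_in)
  then have ae: "AE x in lborel. indicator (cbox (0::real^'d) 1) x = (indicator half_cube x :: ennreal)"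
    by eventually_elim
      (auto simp: indicator_def half_cube_def mem_box_cart less_imp_le split: if_splits)
  have "(\<integral>\<^sup>+x. f x \<partial>torus) = (\<integral>\<^sup>+x. f x * indicator (cbox 0 1) x \<partial>lborel)"
    unfolding torus_def by (rule nn_integral_restrict_space) auto
  also have "\<dots> = (\<integral>\<^sup>+x. f x * indicator half_cube x \<partial>lborel)"
    by (rule nn_integral_cong_AE) (use ae in \<open>auto elim: eventually_mono\<close>)
  finally show ?thesis .
qed

abbreviation lattice_vec :: "int^'d \<Rightarrow> real^'d" where
  "lattice_vec k \<equiv> (\<chi> i. of_int (k $ i))"

lemma half_cube_tiles:
  "(\<integral>\<^sup>+k. indicator half_cube (y + lattice_vec (k :: int^'d)) \<partial>count_space UNIV) = 1"
proof -
  let ?k = "(\<chi> i. - \<lfloor>y $ i\<rfloor>) :: int^'d"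
  have "y + lattice_vec k \<in> half_cube \<longleftrightarrow> k = ?k" for k :: "int^'d"
  proof
    assume "y + lattice_vec k \<in> half_cube"
    then have "0 \<le> y $ i + of_int (k $ i) \<and> y $ i + of_int (k $ i) < 1" for i
      by (auto simp: half_cube_def)
    then have "k $ i = - \<lfloor>y $ i\<rfloor>" for i
      by (smt (verit) floor_eq_iff of_int_minus)
    then show "k = ?k" by (simp add: vec_eq_iff)
  next
    assume "k = ?k"
    then show "y + lattice_vec k \<in> half_cube"
      by (simp add: half_cube_def) linarith
  qed
  then have "(\<lambda>k. indicator half_cube (y + lattice_vec k) :: ennreal) = indicator {?k}"
    by (auto simp: indicator_def fun_eq_iff)
  then show ?thesis by simp
qed

lemma nn_integral_lborel_translate:
  fixes f :: "real^'d \<Rightarrow> ennreal"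
  assumes [measurable]: "f \<in> borel_measurable borel"
  shows "(\<integral>\<^sup>+x. f (x + a) \<partial>lborel) = (\<integral>\<^sup>+x. f x \<partial>lborel)"
proof -
  have "(\<integral>\<^sup>+x. f x \<partial>lborel) = (\<integral>\<^sup>+x. f x \<partial>distr lborel borel ((+) a))"
    by (simp add: lborel_distr_plus)
  also have "\<dots> = (\<integral>\<^sup>+x. f (a + x) \<partial>lborel)"
    by (subst nn_integral_distr) auto
  finally show ?thesis by (simp add: add.commute)
qed

text \<open>The sum over all translates of \<open>half_cube\<close>, which is 1, is inserted under
  the integral. Each term is shifted by its lattice vector, which the periodicity of
  \<open>f\<close> permits, and the translates of \<open>P\<close> then sum to 1.\<close>

lemma fundamental_domain:
  fixes f :: "real^'d \<Rightarrow> ennreal" and P :: "(real^'d) set"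
  assumes f [measurable]: "f \<in> borel_measurable borel" and per: "lattice_periodic f"
    and P [measurable]: "P \<in> sets borel"
    and tiles: "\<And>y. (\<integral>\<^sup>+k. indicator P (y + lattice_vec (k :: int^'d)) \<partial>count_space UNIV) = 1"
  shows "(\<integral>\<^sup>+x. f x * indicator P x \<partial>lborel) = (\<integral>\<^sup>+x. f x \<partial>torus)"
proof -
  have perf: "f (x + lattice_vec k) = f x" for x and k :: "int^'d"
    using per by (auto simp: lattice_periodic_def)
  have "(\<integral>\<^sup>+x. f x * indicator P x \<partial>lborel)
      = (\<integral>\<^sup>+x. (\<integral>\<^sup>+k. f x * indicator P x * indicator half_cube (x + lattice_vec (k::int^'d)) \<partial>count_space UNIV) \<partial>lborel)"
    by (subst nn_integral_cmult) (auto simp: half_cube_tiles)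
  also have "\<dots> = (\<integral>\<^sup>+k. (\<integral>\<^sup>+x. f x * indicator P x * indicator half_cube (x + lattice_vec (k::int^'d)) \<partial>lborel) \<partial>count_space UNIV)"
    by (rule nn_integral_count_space_nn_integral) auto
  also have "\<dots> = (\<integral>\<^sup>+k. (\<integral>\<^sup>+x. f x * indicator P (x + lattice_vec (- k::int^'d)) * indicator half_cube x \<partial>lborel) \<partial>count_space UNIV)"
  proof (rule nn_integral_cong)
    fix k :: "int^'d"
    have e: "x + lattice_vec (-k) + lattice_vec k = x" for x :: "real^'d"
      by (simp add: vec_eq_iff)
    have m: "(\<lambda>x. f x * indicator P x * indicator half_cube (x + lattice_vec k)) \<in> borel_measurable borel"
      by measurable
    show "(\<integral>\<^sup>+x. f x * indicator P x * indicator half_cube (x + lattice_vec k) \<partial>lborel)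
      = (\<integral>\<^sup>+x. f x * indicator P (x + lattice_vec (-k)) * indicator half_cube x \<partial>lborel)"
      unfolding nn_integral_lborel_translate[OF m, of "lattice_vec (-k)", symmetric]
      by (simp only: e perf)
  qed
  also have "\<dots> = (\<integral>\<^sup>+k. (\<integral>\<^sup>+x. f x * indicator P (x + lattice_vec (k::int^'d)) * indicator half_cube x \<partial>lborel) \<partial>count_space UNIV)"
    by (rule nn_integral_bij_count_space[where g = uminus])
       (metis bij_uminus)
  also have "\<dots> = (\<integral>\<^sup>+x. (\<integral>\<^sup>+k. (f x * indicator half_cube x) * indicator P (x + lattice_vec (k::int^'d)) \<partial>count_space UNIV) \<partial>lborel)"
    by (subst nn_integral_count_space_nn_integral[symmetric]) (auto simp: ac_simps)
  also have "\<dots> = (\<integral>\<^sup>+x. f x * indicator half_cube x \<partial>lborel)"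
    by (subst nn_integral_cmult) (auto simp: tiles)
  finally show ?thesis by (simp add: nn_integral_torus_half_cube)
qed

text \<open>A translate of the half-open cube is again a fundamental domain.\<close>

lemma nn_integral_torus_translate:
  assumes [measurable]: "f \<in> borel_measurable borel" and "lattice_periodic f"
  shows "(\<integral>\<^sup>+x. f (x + a) \<partial>torus) = (\<integral>\<^sup>+x. f x \<partial>torus)"
proof -
  have "(\<integral>\<^sup>+x. f (x + a) \<partial>torus) = (\<integral>\<^sup>+x. f (x + a) * indicator half_cube x \<partial>lborel)"
    by (rule nn_integral_torus_half_cube) measurable
  also have "\<dots> = (\<integral>\<^sup>+x. f x * indicator half_cube (x - a) \<partial>lborel)"
    by (subst (2) nn_integral_lborel_translate[where a = a, symmetric]) auto
  also have "\<dots> = (\<integral>\<^sup>+x. f x * indicator ((\<lambda>x. x - a) -` half_cube) x \<partial>lborel)"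
    by (simp add: indicator_def)
  also have "\<dots> = (\<integral>\<^sup>+x. f x \<partial>torus)"
  proof (rule fundamental_domain[OF assms])
    show "(\<lambda>x. x - a) -` half_cube \<in> sets borel"
      using measurable_sets_borel[of "\<lambda>x. x - a" borel half_cube] by simp
    fix y :: "real^'a"
    have "indicator ((\<lambda>x. x - a) -` half_cube) (y + lattice_vec k)
      = (indicator half_cube ((y - a) + lattice_vec k) :: ennreal)" for k :: "int^'a"
      by (simp add: indicator_def algebra_simps)
    then show "(\<integral>\<^sup>+k. indicator ((\<lambda>x. x - a) -` half_cube) (y + lattice_vec (k :: int^'a)) \<partial>count_space UNIV) = 1"
      by (simp add: half_cube_tiles)
  qed
  finally show ?thesis .
qed

lemma lborel_distr_uminus_euclidean:
  "distr lborel borel uminus = (lborel :: 'a::euclidean_space measure)"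
  using lborel_affine[of "-1" "0::'a"] by (simp add: density_1 one_ennreal_def[symmetric])

lemma nn_integral_torus_uminus:
  assumes [measurable]: "f \<in> borel_measurable borel" and "lattice_periodic f"
  shows "(\<integral>\<^sup>+x. f (- x) \<partial>torus) = (\<integral>\<^sup>+x. f x \<partial>torus)"
proof -
  have "(\<integral>\<^sup>+x. f (- x) \<partial>torus) = (\<integral>\<^sup>+x. f (- x) * indicator half_cube (- (- x)) \<partial>lborel)"
    by (simp, rule nn_integral_torus_half_cube) measurable
  also have "\<dots> = (\<integral>\<^sup>+x. f x * indicator half_cube (- x) \<partial>distr lborel borel uminus)"
    by (subst nn_integral_distr) auto
  also have "\<dots> = (\<integral>\<^sup>+x. f x * indicator (uminus -` half_cube) x \<partial>lborel)"
    by (simp add: lborel_distr_uminus_euclidean indicator_def)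
  also have "\<dots> = (\<integral>\<^sup>+x. f x \<partial>torus)"
  proof (rule fundamental_domain[OF assms])
    show "uminus -` half_cube \<in> sets (borel :: (real^'a) measure)"
      using measurable_sets_borel[of "uminus" borel half_cube] by simp
    fix y :: "real^'a"
    have "indicator (uminus -` half_cube) (y + lattice_vec k)
      = (indicator half_cube (- y + lattice_vec (- k)) :: ennreal)" for k :: "int^'a"
    proof -
      have "- (y + lattice_vec k) = - y + lattice_vec (- k)" by (simp add: vec_eq_iff)
      then show ?thesis by (simp only: indicator_def vimage_eq)
    qed
    then have "(\<integral>\<^sup>+k. indicator (uminus -` half_cube) (y + lattice_vec (k :: int^'a)) \<partial>count_space UNIV)
       = (\<integral>\<^sup>+k. indicator half_cube (- y + lattice_vec (- (k :: int^'a))) \<partial>count_space UNIV)"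
      by simp
    also have "\<dots> = (\<integral>\<^sup>+k. indicator half_cube (- y + lattice_vec (k :: int^'a)) \<partial>count_space UNIV)"
      by (rule nn_integral_bij_count_space[where g = uminus]) (metis bij_uminus)
    finally show "(\<integral>\<^sup>+k. indicator (uminus -` half_cube) (y + lattice_vec (k :: int^'a)) \<partial>count_space UNIV) = 1"
      by (simp only: half_cube_tiles)
  qed
  finally show ?thesis .
qed

text \<open>The representative in the half-open cube. Periodic functions do not see it, and the
  image measure under \<open>wrap\<close> turns the invariances of the nonnegative integral into
  equalities of measures; from these the invariance of Bochner integrals with values in any Banach
  space is immediate.\<close>

definition wrap :: "real^'d \<Rightarrow> real^'d" where
  "wrap x = x + lattice_vec (\<chi> i. - \<lfloor>x $ i\<rfloor>)"

lemma wrap_measurable [measurable]: "wrap \<in> borel_measurable borel"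
proof -
  have "wrap = (\<lambda>x::real^'d. \<chi> i. x $ i + of_int (- \<lfloor>x $ i\<rfloor>))"
    by (simp add: wrap_def fun_eq_iff vec_eq_iff)
  also have "\<dots> \<in> borel_measurable borel"
  proof -
    have "(\<lambda>x::real^'d. x $ i + of_int (- \<lfloor>x $ i\<rfloor>)) \<in> borel_measurable borel" for i
      by measurable
    then show ?thesis
      by (subst borel_measurable_euclidean_space) (auto simp: Basis_vec_def inner_axis)
  qed
  finally show ?thesis .
qed

lemma lattice_periodic_wrap: "lattice_periodic g \<Longrightarrow> g (wrap x) = g x"
  unfolding lattice_periodic_def wrap_def by blast

lemma wrap_lattice_periodic: "lattice_periodic (\<lambda>x. g (wrap x))"
  by (simp add: lattice_periodic_def wrap_def vec_eq_iff cong: arg_cong[where f=g])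
     (auto intro!: arg_cong[where f=g] simp: vec_eq_iff)

lemma distr_torus_wrap_translate:
  "distr torus borel (\<lambda>x. wrap (x + a)) = distr torus borel wrap"
proof (rule measure_eqI)
  fix S assume "S \<in> sets (distr torus borel (\<lambda>x. wrap (x + a)))"
  then have S [measurable]: "S \<in> sets borel" by simp
  have m [measurable]: "(\<lambda>x. wrap (x + a)) \<in> measurable torus borel" "wrap \<in> measurable torus borel"
    by (auto intro!: measurable_torus)
  have "emeasure (distr torus borel (\<lambda>x. wrap (x + a))) S = (\<integral>\<^sup>+x. indicator S x \<partial>distr torus borel (\<lambda>x. wrap (x + a)))"
    by simp
  also have "\<dots> = (\<integral>\<^sup>+x. indicator S (wrap (x + a)) \<partial>torus)"
    by (subst nn_integral_distr) auto
  also have "\<dots> = (\<integral>\<^sup>+x. indicator S (wrap x) \<partial>torus)"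
    by (rule nn_integral_torus_translate) (auto intro: wrap_lattice_periodic)
  also have "\<dots> = (\<integral>\<^sup>+x. indicator S x \<partial>distr torus borel wrap)"
    by (subst nn_integral_distr) auto
  finally show "emeasure (distr torus borel (\<lambda>x. wrap (x + a))) S = emeasure (distr torus borel wrap) S"
    by simp
qed simp

lemma distr_torus_wrap_uminus:
  "distr torus borel (\<lambda>x. wrap (- x)) = distr torus borel wrap"
proof (rule measure_eqI)
  fix S assume "S \<in> sets (distr torus borel (\<lambda>x::real^'a. wrap (- x)))"
  then have S [measurable]: "S \<in> sets borel" by simp
  have m [measurable]: "(\<lambda>x. wrap (- x)) \<in> measurable torus borel" "wrap \<in> measurable torus borel"
    by (auto intro!: measurable_torus)
  have "emeasure (distr torus borel (\<lambda>x. wrap (- x))) S = (\<integral>\<^sup>+x. indicator S x \<partial>distr torus borel (\<lambda>x. wrap (- x)))"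
    by simp
  also have "\<dots> = (\<integral>\<^sup>+x. indicator S (wrap (- x)) \<partial>torus)"
    by (subst nn_integral_distr) auto
  also have "\<dots> = (\<integral>\<^sup>+x. indicator S (wrap x) \<partial>torus)"
    by (rule nn_integral_torus_uminus) (auto intro: wrap_lattice_periodic)
  also have "\<dots> = (\<integral>\<^sup>+x. indicator S x \<partial>distr torus borel wrap)"
    by (subst nn_integral_distr) auto
  finally show "emeasure (distr torus borel (\<lambda>x. wrap (- x))) S = emeasure (distr torus borel wrap) S"
    by simp
qed simp

lemma integral_torus_change:
  fixes g :: "real^'d \<Rightarrow> 'b::{banach, second_countable_topology}"
  assumes [measurable]: "g \<in> borel_measurable borel" "h \<in> borel_measurable borel"
    and per: "lattice_periodic g"
    and d: "distr torus borel (\<lambda>x. wrap (h x)) = distr torus borel wrap"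
  shows "(LINT x|torus. g (h x)) = (LINT x|torus. g x)"
proof -
  have m [measurable]: "(\<lambda>x. wrap (h x)) \<in> measurable torus borel" "wrap \<in> measurable torus borel"
    by (auto intro!: measurable_torus)
  have w: "g (wrap x) = g x" for x by (rule lattice_periodic_wrap[OF per])
  show ?thesis
    using integral_distr[of "\<lambda>x. wrap (h x)" torus borel g] integral_distr[of wrap torus borel g]
    by (simp add: d w)
qed

lemma
  fixes g :: "real^'d \<Rightarrow> 'b::{banach, second_countable_topology}"
  assumes m: "g \<in> borel_measurable borel" and per: "lattice_periodic g"
  shows integral_torus_translate: "(LINT x|torus. g (x + a)) = (LINT x|torus. g x)"
    and integral_torus_diff: "(LINT x|torus. g (x - a)) = (LINT x|torus. g x)"
    and integral_torus_uminus: "(LINT x|torus. g (- x)) = (LINT x|torus. g x)"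
  using integral_torus_change[OF m _ per distr_torus_wrap_translate[of a]]
    integral_torus_change[OF m _ per distr_torus_wrap_translate[of "- a"]]
    integral_torus_change[OF m _ per distr_torus_wrap_uminus] by auto

lemma integral_torus_reflect:
  fixes g :: "real^'d \<Rightarrow> 'b::{banach, second_countable_topology}"
  assumes m [measurable]: "g \<in> borel_measurable borel" and per: "lattice_periodic g"
  shows "(LINT x|torus. g (a - x)) = (LINT x|torus. g x)"
proof -
  have p: "lattice_periodic (\<lambda>x. g (x + a))"
    using per by (simp add: lattice_periodic_def add.commute add.left_commute)
      (metis add.assoc add.commute)
  have m2: "(\<lambda>x. g (x + a)) \<in> borel_measurable borel" by measurable
  show ?thesis
    using integral_torus_uminus[OF m2 p] integral_torus_translate[OF m per, of a] by simp
qed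

subsection \<open>Continuous functions and partial derivatives on the torus\<close>

definition tcont :: "(real^'d \<Rightarrow> 'b::topological_space) \<Rightarrow> bool" where
  "tcont F \<longleftrightarrow> lattice_periodic F \<and> continuous_on UNIV F"

lemma tcont_periodic: "tcont F \<Longrightarrow> lattice_periodic F"
  and tcont_continuous: "tcont F \<Longrightarrow> continuous_on UNIV F"
  by (auto simp: tcont_def)

lemma tcont_const [intro, simp]: "tcont (\<lambda>x. c)"
  by (simp add: tcont_def lattice_periodic_def)

lemma tcont_add [intro]: "tcont F \<Longrightarrow> tcont G \<Longrightarrow> tcont (\<lambda>x. F x + G x :: 'b::real_normed_vector)"
  and tcont_diff [intro]: "tcont F \<Longrightarrow> tcont G \<Longrightarrow> tcont (\<lambda>x. F x - G x :: 'b::real_normed_vector)"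
  and tcont_minus [intro]: "tcont F \<Longrightarrow> tcont (\<lambda>x. - F x :: 'b::real_normed_vector)"
  and tcont_mult [intro]: "tcont A \<Longrightarrow> tcont B \<Longrightarrow> tcont (\<lambda>x. A x * B x :: real)"
  and tcont_power [intro]: "tcont A \<Longrightarrow> tcont (\<lambda>x. A x ^ n :: real)"
  and tcont_abs [intro]: "tcont A \<Longrightarrow> tcont (\<lambda>x. \<bar>A x\<bar> :: real)"
  and tcont_norm [intro]: "tcont F \<Longrightarrow> tcont (\<lambda>x. norm (F x :: 'b::real_normed_vector))"
  and tcont_exp [intro]: "tcont A \<Longrightarrow> tcont (\<lambda>x. exp (A x) :: real)"
  and tcont_sqrt [intro]: "tcont A \<Longrightarrow> tcont (\<lambda>x. sqrt (A x))"
  and tcont_divide [intro]: "tcont A \<Longrightarrow> tcont B \<Longrightarrow> (\<And>x. B x \<noteq> 0) \<Longrightarrow> tcont (\<lambda>x. A x / B x :: real)"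
  and tcont_ln [intro]: "tcont A \<Longrightarrow> (\<And>x. 0 < A x) \<Longrightarrow> tcont (\<lambda>x. ln (A x) :: real)"
  by (auto simp: tcont_def lattice_periodic_def less_imp_neq[symmetric] intro!: continuous_intros)

lemma tcont_sum [intro]: "(\<And>i. i \<in> I \<Longrightarrow> tcont (F i)) \<Longrightarrow> tcont (\<lambda>x. \<Sum>i\<in>I. F i x :: 'b::real_normed_vector)"
  by (auto simp: tcont_def lattice_periodic_def intro!: continuous_intros sum.cong)

lemma tcont_translate: "tcont F \<Longrightarrow> tcont (\<lambda>x. F (x + a))"
proof -
  assume F: "tcont F"
  have "F (x + lattice_vec k + a) = F (x + a)" for x and k :: "int^'a"
  proof -
    have "F (x + lattice_vec k + a) = F ((x + a) + lattice_vec k)" by (simp add: ac_simps)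
    then show ?thesis using F by (simp add: tcont_def lattice_periodic_def)
  qed
  then show ?thesis using F
    by (auto simp: tcont_def lattice_periodic_def intro!: continuous_intros continuous_on_compose2[of UNIV F])
qed

lemma tcont_uminus: "tcont F \<Longrightarrow> tcont (\<lambda>x. F (- x))"
proof -
  assume F: "tcont F"
  have "F (- (x + lattice_vec k)) = F (- x)" for x and k :: "int^'a"
  proof -
    have "- (x + lattice_vec k) = - x + lattice_vec (- k)" by (simp add: vec_eq_iff)
    then show ?thesis using F by (simp only: tcont_def lattice_periodic_def)
  qed
  then show ?thesis using F
    by (auto simp: tcont_def lattice_periodic_def intro!: continuous_intros continuous_on_compose2[of UNIV F])
qed

lemma tcont_reflect: "tcont F \<Longrightarrow> tcont (\<lambda>x. F (a - x))"
  using tcont_uminus[OF tcont_translate[of F a]] by simp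

lemma wrap_in_cube: "wrap x \<in> cbox 0 1"
  by (auto simp: wrap_def mem_box_cart le_less) linarith+

lemma tcont_bounded:
  assumes "tcont (F :: real^'d \<Rightarrow> 'b::real_normed_vector)"
  obtains B where "0 < B" "\<And>x. norm (F x) \<le> B"
proof -
  have "compact (F ` cbox 0 1)"
    by (intro compact_continuous_image continuous_on_subset[OF tcont_continuous[OF assms]]) auto
  then obtain B where B: "B > 0" "\<And>x. x \<in> cbox 0 1 \<Longrightarrow> norm (F x) \<le> B"
    using compact_imp_bounded bounded_pos by (metis image_eqI)
  have "norm (F x) \<le> B" for x
    using B(2)[OF wrap_in_cube, of x] lattice_periodic_wrap[OF tcont_periodic[OF assms]] by simp
  with B(1) that show thesis by blast
qed

lemma tcont_attains_min:
  assumes "tcont (F :: real^'d \<Rightarrow> real)"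
  obtains x0 where "\<And>x. F x0 \<le> F x"
proof -
  have "\<exists>x0\<in>cbox 0 1. \<forall>y\<in>cbox 0 1. F x0 \<le> F y"
    using wrap_in_cube[of 0]
    by (intro continuous_attains_inf continuous_on_subset[OF tcont_continuous[OF assms]] compact_cbox) auto
  then obtain x0 where x0: "\<And>y. y \<in> cbox 0 1 \<Longrightarrow> F x0 \<le> F y" by blast
  have "F x0 \<le> F x" for x
    using x0[OF wrap_in_cube, of x] lattice_periodic_wrap[OF tcont_periodic[OF assms]] by simp
  with that show thesis by blast
qed

lemma tcont_pos_lower:
  assumes "tcont (F :: real^'d \<Rightarrow> real)" "\<And>x. 0 < F x"
  obtains m where "0 < m" "\<And>x. m \<le> F x"
  using tcont_attains_min[OF assms(1)] assms(2) by metis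

lemma tcont_measurable [measurable_dest]: "tcont (F :: real^'d \<Rightarrow> 'b::real_normed_vector) \<Longrightarrow> F \<in> borel_measurable borel"
  by (auto simp: tcont_def intro: borel_measurable_continuous_onI)

lemma tcont_integrable_mult:
  fixes f :: "real^'d \<Rightarrow> real"
  assumes F: "tcont (F :: real^'d \<Rightarrow> 'b::{banach, second_countable_topology})" and f: "integrable torus f"
  shows "integrable torus (\<lambda>x. f x *\<^sub>R F x)"
proof -
  obtain B where B: "0 < B" "\<And>x. norm (F x) \<le> B" using tcont_bounded[OF F] by blast
  show ?thesis
  proof (rule Bochner_Integration.integrable_bound)
    show "integrable torus (\<lambda>x. B * f x)" using f by simp
    show "(\<lambda>x. f x *\<^sub>R F x) \<in> borel_measurable torus"
      using borel_measurable_integrable[OF f] measurable_torus[OF tcont_measurable[OF F]] by simp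
    show "AE x in torus. norm (f x *\<^sub>R F x) \<le> norm (B * f x)"
      using B mult_left_mono[OF B(2) abs_ge_zero] by (auto simp: abs_mult ac_simps)
  qed
qed

lemma tcont_integrable:
  "tcont (F :: real^'d \<Rightarrow> 'b::{banach, second_countable_topology}) \<Longrightarrow> integrable torus F"
  using tcont_integrable_mult[of F "\<lambda>_. 1"] by simp

lemma tcont_uniformly_continuous:
  assumes F: "tcont (F :: real^'d \<Rightarrow> 'b::real_normed_vector)" and e: "0 < e"
  obtains d where "0 < d" "\<And>x y. norm (x - y) < d \<Longrightarrow> norm (F x - F y) < e"
proof -
  \<comment> \<open>The unit cube with a margin of 1 on each side: one lattice vector moves
    \<open>x\<close> into the unit cube, and the same vector moves a point at distance less than 1
    from \<open>x\<close> into \<open>?S\<close>.\<close>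
  let ?S = "cbox (-1) (2::real^'d)"
  have "uniformly_continuous_on ?S F"
    by (intro compact_uniformly_continuous continuous_on_subset[OF tcont_continuous[OF F]]) auto
  then obtain d where d: "d > 0" "\<And>x y. x \<in> ?S \<Longrightarrow> y \<in> ?S \<Longrightarrow> dist x y < d \<Longrightarrow> dist (F x) (F y) < e"
    using e unfolding uniformly_continuous_on_def by metis
  have "norm (F x - F y) < e" if "norm (x - y) < min d 1" for x y
  proof -
    let ?y = "y + lattice_vec (\<chi> i. - \<lfloor>x $ i\<rfloor>)"
    have sub: "?y - wrap x = y - x" by (simp add: wrap_def)
    have c: "\<bar>(?y - wrap x) $ i\<bar> \<le> 1" for i
      using component_le_norm_cart[of "y - x" i] that unfolding sub by (simp add: norm_minus_commute)
    have w: "wrap x \<in> cbox 0 1" by (rule wrap_in_cube)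
    have "wrap x \<in> ?S"
      using w by (auto simp: mem_box_cart) (smt (verit) )+
    moreover have "?y \<in> ?S"
      using w c by (auto simp: mem_box_cart) (smt (verit))+
    moreover have "dist (wrap x) ?y < d"
      using that sub by (metis dist_commute dist_norm min_less_iff_conj norm_minus_commute)
    ultimately have "dist (F (wrap x)) (F ?y) < e" using d by blast
    moreover have "F ?y = F y" "F (wrap x) = F x"
      using F unfolding tcont_def lattice_periodic_def wrap_def by blast+
    ultimately show ?thesis by (simp add: dist_norm)
  qed
  then show thesis using that[of "min d 1"] d(1) by simp
qed

lemma integral_torus_eq:
  assumes "continuous_on UNIV (F :: real^'d \<Rightarrow> real)"
  shows "(LINT x|torus. F x) = integral (cbox 0 1) F"
proof -
  have "set_integrable lborel (cbox 0 1) F"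
    unfolding set_integrable_def by (rule borel_integrable_compact) (auto intro: continuous_on_subset[OF assms])
  then show ?thesis
    using set_borel_integral_eq_integral(2)[of "cbox 0 1" F]
    by (simp add: torus_def integral_restrict_space set_lebesgue_integral_def)
qed

text \<open>Taking the derivative within \<open>U\<close> covers the half line of nonnegative times,
  where the derivative at time 0 is one-sided.\<close>

lemma torus_leibniz:
  fixes F F' :: "real \<Rightarrow> real^'d \<Rightarrow> real"
  assumes d: "\<And>t x. t \<in> U \<Longrightarrow> ((\<lambda>t. F t x) has_real_derivative F' t x) (at t within U)"
    and c: "\<And>t. t \<in> U \<Longrightarrow> continuous_on UNIV (F t)"
    and c': "continuous_on (U \<times> UNIV) (\<lambda>(t,x). F' t x)"
    and U: "convex U" "t \<in> U"
  shows "((\<lambda>t. LINT x|torus. F t x) has_real_derivative (LINT x|torus. F' t x)) (at t within U)"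
proof -
  have *: "((\<lambda>t. integral (cbox 0 1) (F t)) has_real_derivative (integral (cbox 0 1) (F' t))) (at t within U)"
    by (rule leibniz_rule_field_derivative[OF d _ _ U(2,1)])
       (auto intro!: integrable_continuous continuous_on_subset[OF c] continuous_on_subset[OF c'])
  have "continuous_on UNIV (F' t)"
    using continuous_on_compose2[OF c' continuous_on_Pair[OF continuous_on_const[of UNIV t] continuous_on_id]] U
    by auto
  then have "integral (cbox 0 1) (F' t) = (LINT x|torus. F' t x)"
    by (simp add: integral_torus_eq)
  then show ?thesis
    using has_field_derivative_transform_within[OF * zero_less_one U(2), of "\<lambda>t. LINT x|torus. F t x"]
    by (simp add: integral_torus_eq[OF c])
qed

text \<open>A relation with an explicit derivative along the coordinate line through each point. All
  calculus rules then reduce to those for functions of one real variable.\<close>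

definition has_pd :: "'d \<Rightarrow> (real^'d \<Rightarrow> real) \<Rightarrow> (real^'d \<Rightarrow> real) \<Rightarrow> bool" where
  "has_pd i F F' \<longleftrightarrow> (\<forall>x. ((\<lambda>s. F (x + s *\<^sub>R axis i 1)) has_real_derivative F' x) (at 0))"

lemma has_pdD: "has_pd i F F' \<Longrightarrow> ((\<lambda>s. F (x + s *\<^sub>R axis i 1)) has_real_derivative F' x) (at 0)"
  by (simp add: has_pd_def)

lemma has_pd_line:
  assumes "has_pd i F F'"
  shows "((\<lambda>s. F (x + s *\<^sub>R axis i 1)) has_real_derivative F' (x + s *\<^sub>R axis i 1)) (at s)"
proof -
  have "((\<lambda>r. F ((x + s *\<^sub>R axis i 1) + r *\<^sub>R axis i 1)) has_real_derivative F' (x + s *\<^sub>R axis i 1)) (at 0)"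
    by (rule has_pdD[OF assms])
  then show ?thesis
    using DERIV_shift[of "\<lambda>s. F (x + s *\<^sub>R axis i 1)" _ 0 s]
    by (simp add: algebra_simps)
qed

lemma has_pd_const [intro]: "has_pd i (\<lambda>x. c) (\<lambda>x. 0)"
  by (simp add: has_pd_def)

lemma has_pd_add [intro]: "has_pd i F F' \<Longrightarrow> has_pd i G G' \<Longrightarrow> has_pd i (\<lambda>x. F x + G x) (\<lambda>x. F' x + G' x)"
  and has_pd_diff [intro]: "has_pd i F F' \<Longrightarrow> has_pd i G G' \<Longrightarrow> has_pd i (\<lambda>x. F x - G x) (\<lambda>x. F' x - G' x)"
  and has_pd_cmult [intro]: "has_pd i F F' \<Longrightarrow> has_pd i (\<lambda>x. c * F x) (\<lambda>x. c * F' x)"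
  and has_pd_exp [intro]: "has_pd i F F' \<Longrightarrow> has_pd i (\<lambda>x. exp (F x)) (\<lambda>x. F' x * exp (F x))"
  unfolding has_pd_def by (auto intro!: derivative_eq_intros)

lemma has_pd_mult [intro]: "has_pd i F F' \<Longrightarrow> has_pd i G G' \<Longrightarrow> has_pd i (\<lambda>x. F x * G x) (\<lambda>x. F' x * G x + F x * G' x)"
  unfolding has_pd_def
  by (intro allI) (rule DERIV_cong[OF DERIV_mult], auto)

lemma has_pd_divide [intro]:
  assumes "has_pd i F F'" "has_pd i G G'" "\<And>x. G x \<noteq> 0"
  shows "has_pd i (\<lambda>x. F x / G x) (\<lambda>x. (F' x * G x - F x * G' x) / (G x)\<^sup>2)"
  unfolding has_pd_def
  by (intro allI, rule DERIV_cong[OF DERIV_divide[OF has_pdD[OF assms(1)] has_pdD[OF assms(2)]]])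
     (auto simp: assms(3) power2_eq_square)

lemma has_pd_ln [intro]:
  assumes "has_pd i F F'" "\<And>x. 0 < F x"
  shows "has_pd i (\<lambda>x. ln (F x)) (\<lambda>x. F' x / F x)"
  unfolding has_pd_def
  by (intro allI, rule DERIV_cong[OF DERIV_chain2[where f = ln, OF DERIV_ln has_pdD[OF assms(1)]]])
     (auto simp: assms(2) divide_simps)

lemma has_pd_sqrt [intro]:
  assumes "has_pd i F F'" "\<And>x. 0 < F x"
  shows "has_pd i (\<lambda>x. sqrt (F x)) (\<lambda>x. F' x / (2 * sqrt (F x)))"
  unfolding has_pd_def
  by (intro allI, rule DERIV_cong[OF DERIV_chain2[where f = sqrt, OF DERIV_real_sqrt has_pdD[OF assms(1)]]])
     (auto simp: assms(2) divide_simps)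

lemma has_pd_sum [intro]:
  "(\<And>j. j \<in> J \<Longrightarrow> has_pd i (F j) (F' j)) \<Longrightarrow> has_pd i (\<lambda>x. \<Sum>j\<in>J. F j x) (\<lambda>x. \<Sum>j\<in>J. F' j x)"
  unfolding has_pd_def by (auto intro!: DERIV_sum)

lemma has_pd_cong: "has_pd i F F' \<Longrightarrow> (\<And>x. F' x = G' x) \<Longrightarrow> has_pd i F G'"
  by (simp add: has_pd_def)

lemma lattice_axis: "lattice_periodic F \<Longrightarrow> F (x + axis i 1) = F x"
proof -
  have "axis i (1::real) = lattice_vec (axis i 1)" by (auto simp: vec_eq_iff axis_def)
  then show "lattice_periodic F \<Longrightarrow> F (x + axis i 1) = F x"
    unfolding lattice_periodic_def by metis
qed

text \<open>\<open>s \<mapsto> \<integral> F (x + s e\<^sub>i) dx\<close> is constant.\<close>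

lemma integral_torus_pd:
  assumes F: "tcont F" and F': "tcont F'" and d: "has_pd i F F'"
  shows "(LINT x|torus. F' x) = 0"
proof -
  have "((\<lambda>s. LINT x|torus. F (x + s *\<^sub>R axis i 1)) has_real_derivative (LINT x|torus. F' (x + 0 *\<^sub>R axis i 1))) (at 0 within UNIV)"
  proof (rule torus_leibniz)
    show "continuous_on (UNIV \<times> UNIV) (\<lambda>(s,x). F' (x + s *\<^sub>R axis i 1))"
      unfolding split_beta
      by (rule continuous_on_compose2[OF tcont_continuous[OF F']]) (auto intro!: continuous_intros)
    show "continuous_on UNIV (\<lambda>x. F (x + s *\<^sub>R axis i 1))" for s
      by (rule continuous_on_compose2[OF tcont_continuous[OF F]]) (auto intro!: continuous_intros)
  qed (auto intro: has_pd_line[OF d])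
  then have "((\<lambda>s::real. LINT x|torus. F x) has_real_derivative (LINT x|torus. F' x)) (at 0)"
    by (simp add: integral_torus_translate[OF tcont_measurable[OF F] tcont_periodic[OF F]])
  then show ?thesis using DERIV_unique[OF _ DERIV_const] by blast
qed

lemma integral_torus_by_parts:
  assumes "tcont F" "tcont F'" "has_pd i F F'" "tcont G" "tcont G'" "has_pd i G G'"
  shows "(LINT x|torus. F x * G' x) = - (LINT x|torus. F' x * G x)"
proof -
  have "(LINT x|torus. F' x * G x + F x * G' x) = 0"
    by (rule integral_torus_pd[where i = i and F = "\<lambda>x. F x * G x"]) (use assms in auto)
  moreover have "(LINT x|torus. F' x * G x + F x * G' x) = (LINT x|torus. F' x * G x) + (LINT x|torus. F x * G' x)"
    by (rule Bochner_Integration.integral_add) (use assms in \<open>auto intro!: tcont_integrable\<close>)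
  ultimately show ?thesis by simp
qed

text \<open>By translation invariance the integral of \<open>G\<close> is the average over
  \<open>s\<close> of the integrals of its translates along the axis; exchanging the two
  integrations reduces the claim to single coordinate lines. In this way one-dimensional
  inequalities are lifted to the torus.\<close>

lemma integral_torus_line_nonneg:
  assumes G: "tcont (G :: real^'d \<Rightarrow> real)" and nn: "\<And>x. 0 \<le> integral {0..1} (\<lambda>s. G (x + s *\<^sub>R axis i 1))"
  shows "0 \<le> (LINT x|torus. G x)"
proof -
  note cG = tcont_continuous[OF G]
  have c: "continuous_on X (\<lambda>(s, x). G (x + s *\<^sub>R axis i 1))" for X
    unfolding split_beta
    by (rule continuous_on_compose2[OF cG]) (auto intro!: continuous_intros)
  have sl: "integral (cbox 0 1) (\<lambda>x. G (x + s *\<^sub>R axis i 1)) = (LINT x|torus. G x)" for s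
    using integral_torus_eq[of "\<lambda>x. G (x + s *\<^sub>R axis i 1)"] tcont_translate[OF G, of "s *\<^sub>R axis i 1"]
    by (simp add: integral_torus_translate[OF tcont_measurable[OF G] tcont_periodic[OF G]] tcont_def)
  \<comment> \<open>A gauge integral that does not exist has the value 0, so integrability need not
    be checked.\<close>
  have nonneg: "0 \<le> integral S h" if "\<And>x. 0 \<le> h x" for S and h :: "real^'d \<Rightarrow> real"
    by (cases "h integrable_on S") (auto simp: integral_nonneg not_integrable_integral that)
  have "integral (cbox 0 1) (\<lambda>s. integral (cbox 0 1) (\<lambda>x. G (x + s *\<^sub>R axis i 1)))
     = integral (cbox 0 1) (\<lambda>x. integral (cbox 0 1) (\<lambda>s. G (x + s *\<^sub>R axis i 1)))"
    using integral_swap_continuous[where f = "\<lambda>s x. G (x + s *\<^sub>R axis i 1)", OF c] .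
  moreover have "0 \<le> integral (cbox 0 1) (\<lambda>x. integral (cbox 0 1) (\<lambda>s. G (x + s *\<^sub>R axis i 1)))"
    by (rule nonneg) (use nn in simp)
  ultimately show ?thesis unfolding sl by simp
qed

subsection \<open>Trigonometric functions on the torus\<close>

definition freq :: "real^'d \<Rightarrow> bool" where
  "freq w \<longleftrightarrow> (\<forall>i. \<exists>k::int. w $ i = 2 * pi * of_int k)"

lemma freq_0: "freq 0"
  by (auto simp: freq_def intro: exI[of _ 0])

lemma freq_add: "freq v \<Longrightarrow> freq w \<Longrightarrow> freq (v + w)"
  unfolding freq_def by (metis distrib_left of_int_add vector_add_component)

lemma freq_diff: "freq v \<Longrightarrow> freq w \<Longrightarrow> freq (v - w)"
  unfolding freq_def by (metis right_diff_distrib of_int_diff vector_minus_component)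

lemma freq_axis: "freq (axis i (2 * pi))"
  unfolding freq_def axis_def
  by (auto intro: exI[of _ "1::int"] exI[of _ "0::int"])

text \<open>The phase unites cosines and sines: differentiation multiplies by a component of
  \<open>w\<close> and adds \<open>pi / 2\<close> to \<open>p\<close>, so all derivatives stay in
  the family.\<close>

definition wave :: "real^'d \<Rightarrow> real \<Rightarrow> real^'d \<Rightarrow> real" where
  "wave w p x = cos (w \<bullet> x + p)"

lemma abs_wave_le: "\<bar>wave w p x\<bar> \<le> 1"
  by (simp add: wave_def)

lemma cos_plus_int: "cos (x + of_int n * (2 * pi)) = cos (x::real)"
  using cos.plus_of_int[of x n] by simp

lemma tcont_wave [intro]:
  fixes w :: "real^'d"
  assumes "freq w"
  shows "tcont (wave w p)"
proof -
  from assms obtain m :: "'d \<Rightarrow> int" where m: "\<And>i. w $ i = 2 * pi * of_int (m i)"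
    unfolding freq_def by metis
  have "wave w p (x + lattice_vec k) = wave w p x" for x and k :: "int^'d"
  proof -
    have "w \<bullet> lattice_vec k = of_int (\<Sum>i\<in>UNIV. m i * k $ i) * (2 * pi)"
      by (simp add: inner_vec_def m sum_distrib_left sum_distrib_right ac_simps)
    then have "w \<bullet> (x + lattice_vec k) + p = (w \<bullet> x + p) + of_int (\<Sum>i\<in>UNIV. m i * k $ i) * (2 * pi)"
      by (simp add: inner_add_right)
    then show ?thesis
      unfolding wave_def by (simp only: cos_plus_int)
  qed
  then show ?thesis
    by (auto simp: tcont_def lattice_periodic_def wave_def[abs_def] intro!: continuous_intros)
qed

lemma wave_shift: "wave w (p + pi / 2) x = - sin (w \<bullet> x + p)"
  using cos_add[of "w \<bullet> x + p" "pi/2"] by (simp add: wave_def add.assoc)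

lemma wave_pi: "wave w (p + pi / 2 + pi / 2) x = - wave w p x"
proof -
  have "p + pi / 2 + pi / 2 = p + pi" by simp
  then show ?thesis using cos_add[of "w \<bullet> x + p" "pi"] by (simp add: wave_def add.assoc)
qed

lemma has_pd_wave [intro]: "has_pd i (wave w p) (\<lambda>x. w $ i * wave w (p + pi / 2) x)"
  unfolding has_pd_def wave_shift
  by (auto simp: wave_def inner_add_right inner_axis intro!: derivative_eq_intros)

text \<open>The addition formula of the cosine, read as separation of variables: convolution with a
  wave only involves two integrals of the convolved function.\<close>

lemma wave_diff:
  "wave w p (x - y) = wave w p x * wave w 0 y + wave w (p - pi / 2) x * wave w (- pi / 2) y"
proof -
  have "cos (a - pi / 2) = sin a" for a :: real by (simp add: cos_diff)
  from this[of "w \<bullet> x + p"] this[of "w \<bullet> y"]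
  have *: "cos (w \<bullet> x + (p - pi / 2)) = sin (w \<bullet> x + p)" "cos (w \<bullet> y + - pi / 2) = sin (w \<bullet> y)"
    by (simp_all add: algebra_simps)
  have "cos (w \<bullet> (x - y) + p) = cos ((w \<bullet> x + p) - w \<bullet> y)"
    by (simp add: inner_diff_right algebra_simps)
  then show ?thesis
    unfolding wave_def * cos_diff by simp
qed

lemma wave_has_derivative:
  "((\<lambda>x. c * wave w p x) has_derivative (\<lambda>h. c * wave w (p + pi / 2) x * (w \<bullet> h))) (at x)"
  unfolding wave_shift unfolding wave_def
  by (auto intro!: derivative_eq_intros)

lemma pderiv_dir_wave: "pderiv_dir i (\<lambda>x. c * wave w p x) = (\<lambda>x. (c * w $ i) * wave w (p + pi / 2) x)"
  unfolding pderiv_dir_def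
  by (rule ext, subst frechet_derivative_at[OF wave_has_derivative, symmetric]) (simp add: inner_axis)

lemma pderiv_dir_wave1: "pderiv_dir i (wave w p) = (\<lambda>x. w $ i * wave w (p + pi / 2) x)"
  using pderiv_dir_wave[of i 1 w p] by simp

lemma C2_torus_wave:
  assumes "freq w" shows "C2_torus (wave w p)"
  unfolding C2_torus_def pderiv_dir_wave1 pderiv_dir_wave
proof (intro conjI allI)
  show "lattice_periodic (wave w p)" using tcont_wave[OF assms] by (auto simp: tcont_def)
  have d: "(\<lambda>x. c * wave w p x) differentiable (at x)" for c p x
    using wave_has_derivative unfolding differentiable_def by blast
  from this[of 1] show "wave w p differentiable at x" for x by simp
  show "(\<lambda>x. w $ i * wave w (p + pi / 2) x) differentiable (at x)" for x i by (rule d)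
  show "continuous_on UNIV (\<lambda>x. w $ i * w $ j * wave w (p + pi / 2 + pi / 2) x)" for i j
    using tcont_continuous[OF tcont_wave[OF assms]] by (intro continuous_intros)
qed

lemma grad_wave: "grad (wave w p) x = wave w (p + pi / 2) x *\<^sub>R w"
  by (simp add: grad_def pderiv_dir_wave1 vec_eq_iff)

lemma laplacian_wave: "laplacian (wave w p) x = - (w \<bullet> w) * wave w p x"
  unfolding laplacian_def pderiv_dir_wave1 pderiv_dir_wave wave_pi inner_vec_def
  by (simp add: sum_distrib_right sum_negf)

lemma measure_torus_cube [simp]: "measure torus (cbox (0::real^'d) 1) = 1"
  using torus.prob_space by simp

text \<open>A nonzero component of \<open>w\<close> makes the wave a partial derivative of a
  periodic function, namely of a multiple of the wave with phase lowered by
  \<open>pi / 2\<close>.\<close>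

lemma integral_wave:
  assumes "freq w" "w \<noteq> 0" shows "(LINT x|torus. wave w p x) = 0"
proof -
  obtain i where i: "w $ i \<noteq> 0" using assms(2) by (auto simp: vec_eq_iff)
  have "has_pd i (\<lambda>x. inverse (w $ i) * wave w (p - pi/2) x) (\<lambda>x. inverse (w $ i) * (w $ i * wave w (p - pi/2 + pi/2) x))"
    by (intro has_pd_cmult has_pd_wave)
  then have "has_pd i (\<lambda>x. inverse (w $ i) * wave w (p - pi/2) x) (wave w p)"
    by (rule has_pd_cong) (simp add: i)
  then show ?thesis
    by (rule integral_torus_pd[rotated 2]) (use assms in auto)
qed

subsection \<open>A trigonometric mollifier\<close>

text \<open>A periodic substitute for the squared norm: it vanishes exactly on the lattice, so
  \<open>sep (x - y)\<close> measures the separation of two points of the torus, and it is a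
  trigonometric polynomial.\<close>

definition sep :: "real^'d \<Rightarrow> real" where
  "sep z = (\<Sum>i\<in>UNIV. 1 - cos (2 * pi * z $ i))"

lemma cos_component: "cos (2 * pi * z $ i) = wave (axis i (2*pi)) 0 z"
  by (simp add: wave_def inner_axis')

lemma tcont_sep [intro]: "tcont sep"
  unfolding sep_def[abs_def] cos_component by (intro tcont_sum tcont_diff tcont_const tcont_wave freq_axis)

lemma sep_nonneg: "0 \<le> sep z"
  unfolding sep_def by (intro sum_nonneg) simp

lemma sep_le: "sep (z :: real^'d) \<le> 2 * CARD('d)"
proof -
  have "sep z \<le> (\<Sum>i\<in>(UNIV::'d set). 2)"
    unfolding sep_def by (intro sum_mono) (smt (verit) cos_ge_minus_one)
  then show ?thesis by simp
qed

lemma sep_uminus: "sep (- z) = sep z"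
  by (simp add: sep_def)

lemma sep_commute: "sep (x - y) = sep (y - x)"
  using sep_uminus[of "x - y"] by simp

section \<open>Even trigonometric polynomials\<close>

inductive cospoly :: "(real^'d \<Rightarrow> real) \<Rightarrow> bool" where
  single: "freq w \<Longrightarrow> cospoly (\<lambda>x. c * wave w 0 x)"
| sum: "cospoly F \<Longrightarrow> cospoly G \<Longrightarrow> cospoly (\<lambda>x. F x + G x)"

lemma cospoly_const: "cospoly (\<lambda>x. c)"
  using cospoly.single[OF freq_0, of c] by (simp add: wave_def)

lemma cospoly_mult_single:
  assumes "cospoly F" "freq v"
  shows "cospoly (\<lambda>x. (b * wave v 0 x) * F x)"
  using assms(1)
proof induction
  case (single w c)
  have "(\<lambda>x. (b * wave v 0 x) * (c * wave w 0 x))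
    = (\<lambda>x. (b * c / 2) * wave (v - w) 0 x + (b * c / 2) * wave (v + w) 0 x)"
    by (simp add: fun_eq_iff wave_def inner_add_left inner_diff_left cos_add cos_diff algebra_simps)
  then show ?case
    using cospoly.sum[OF cospoly.single[of "v - w" "b * c / 2"] cospoly.single[of "v + w" "b * c / 2"]]
    by (simp add: single freq_diff freq_add assms)
next
  case (sum F G)
  then show ?case using cospoly.sum[OF sum.IH] by (simp add: algebra_simps)
qed

lemma cospoly_mult:
  assumes "cospoly F" "cospoly G"
  shows "cospoly (\<lambda>x. F x * G x)"
  using assms(1)
proof induction
  case (single w c)
  then show ?case using cospoly_mult_single[OF assms(2)] by blast
next
  case (sum F H)
  then show ?case using cospoly.sum[OF sum.IH] by (simp add: algebra_simps)
qed

lemma cospoly_power: "cospoly F \<Longrightarrow> cospoly (\<lambda>x. F x ^ n)"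
  by (induction n) (simp_all add: cospoly_const cospoly_mult)

lemma cospoly_sum: "finite J \<Longrightarrow> (\<And>j. j \<in> J \<Longrightarrow> cospoly (F j)) \<Longrightarrow> cospoly (\<lambda>x. \<Sum>j\<in>J. F j x)"
proof (induction J rule: finite_induct)
  case empty
  then show ?case by (simp add: cospoly_const)
next
  case (insert j J)
  then have "cospoly (\<lambda>x. F j x + (\<Sum>j\<in>J. F j x))" by (intro cospoly.sum) simp_all
  then show ?case by (simp add: insert.hyps)
qed

lemma cospoly_repr:
  assumes "cospoly F"
  obtains N :: nat and c w where "\<And>j. j < N \<Longrightarrow> freq (w j)" "\<And>x. F x = (\<Sum>j<N. c j * wave (w j) 0 x)"
proof -
  have "\<exists>(N::nat) c w. (\<forall>j<N. freq (w j)) \<and> (\<forall>x. F x = (\<Sum>j<N. c j * wave (w j) 0 x))"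
    using assms
  proof induction
    case (single w c)
    show ?case
      by (rule exI[of _ 1], rule exI[of _ "\<lambda>_. c"], rule exI[of _ "\<lambda>_. w"]) (simp add: single)
  next
    case (sum F G)
    from sum.IH(1) obtain N :: nat and c w where
      1: "\<forall>j<N. freq (w j)" "\<forall>x. F x = (\<Sum>j<N. c j * wave (w j) 0 x)"
      by blast
    from sum.IH(2) obtain M :: nat and b v where
      2: "\<forall>j<M. freq (v j)" "\<forall>x. G x = (\<Sum>j<M. b j * wave (v j) 0 x)"
      by blast
    define c' where "c' j = (if j < N then c j else b (j - N))" for j
    define w' where "w' j = (if j < N then w j else v (j - N))" for j
    have "(\<Sum>j<N+M. c' j * wave (w' j) 0 x) = F x + G x" for x
    proof -
      have "(\<Sum>j<N+M. c' j * wave (w' j) 0 x)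
        = (\<Sum>j<N. c' j * wave (w' j) 0 x) + (\<Sum>j<M. c' (N + j) * wave (w' (N + j)) 0 x)"
        by (induction M) (simp_all add: add.assoc)
      then show ?thesis using 1 2 by (simp add: c'_def w'_def)
    qed
    moreover have "\<forall>j<N+M. freq (w' j)"
      using 1 2 by (auto simp: w'_def)
    ultimately show ?case
      by (intro exI[of _ "N + M"] exI[of _ c'] exI[of _ w']) simp
  qed
  with that show thesis by blast
qed

text \<open>
  The kernel is strictly positive and a trigonometric polynomial, so that mollified densities are
  positive finite trigonometric sums whose coefficients carry the whole time dependence.
\<close>

definition mollifier_weight :: "real^'d \<Rightarrow> real" where
  "mollifier_weight z = 1 + 2 * CARD('d) - sep z"

definition mollifier :: "nat \<Rightarrow> real^'d \<Rightarrow> real" where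
  "mollifier n z = mollifier_weight z ^ n / (LINT y|torus. mollifier_weight (y::real^'d) ^ n)"

lemma mollifier_weight_ge_1: "1 \<le> mollifier_weight z"
  using sep_le[of z] by (simp add: mollifier_weight_def)

lemma tcont_mollifier_weight [intro]: "tcont mollifier_weight"
  unfolding mollifier_weight_def[abs_def] by auto

lemma integral_mollifier_weight_pos: "0 < (LINT y|torus. mollifier_weight (y::real^'d) ^ n)"
proof -
  have "(LINT y|(torus :: (real^'d) measure). (1::real)) \<le> (LINT y|torus. mollifier_weight (y::real^'d) ^ n)"
    by (rule integral_mono) (auto intro!: tcont_integrable one_le_power mollifier_weight_ge_1)
  then show ?thesis using torus.prob_space by simp
qed

lemma integral_mollifier_weight_nonzero [simp]: "(LINT y|torus. mollifier_weight (y::real^'d) ^ n) \<noteq> 0"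
  by (rule less_imp_neq[OF integral_mollifier_weight_pos, symmetric])

lemma mollifier_pos: "0 < mollifier n z"
  unfolding mollifier_def
  by (intro divide_pos_pos integral_mollifier_weight_pos zero_less_power) (use mollifier_weight_ge_1[of z] in linarith)

lemma tcont_mollifier [intro]: "tcont (mollifier n)"
  unfolding mollifier_def[abs_def]
  by (intro tcont_divide tcont_power tcont_mollifier_weight tcont_const integral_mollifier_weight_nonzero)

lemma integral_mollifier: "(LINT z|torus. mollifier n z) = 1"
  unfolding mollifier_def by simp

lemma mollifier_uminus: "mollifier n (- z) = mollifier n z"
  by (simp add: mollifier_def mollifier_weight_def sep_uminus)

lemma cospoly_mollifier: "cospoly (mollifier n :: real^'d \<Rightarrow> real)"
proof -
  have "cospoly (\<lambda>z::real^'d. (\<Sum>i\<in>UNIV. (-1) + 1 * wave (axis i (2 * pi)) 0 z))"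
    by (intro cospoly_sum cospoly.sum cospoly_const cospoly.single freq_axis) auto
  from cospoly.sum[OF cospoly_const this, of "1 + 2 * CARD('d)"]
  have "cospoly (\<lambda>z::real^'d. (1 + 2 * CARD('d)) + (\<Sum>i\<in>UNIV. (-1) + 1 * wave (axis i (2 * pi)) 0 z))" .
  moreover have "mollifier_weight = (\<lambda>z::real^'d. (1 + 2 * CARD('d)) + (\<Sum>i\<in>UNIV. (-1) + 1 * wave (axis i (2 * pi)) 0 z))"
    by (simp add: fun_eq_iff mollifier_weight_def sep_def cos_component sum_subtractf sum.distrib)
  ultimately have "cospoly (mollifier_weight :: real^'d \<Rightarrow> real)" by simp
  from cospoly_mult[OF cospoly_const cospoly_power[OF this], of "inverse (LINT y|torus. mollifier_weight (y::real^'d) ^ n)" n]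
  show ?thesis by (simp add: mollifier_def[abs_def] divide_inverse mult.commute)
qed

text \<open>A point of the closed cube lies in the closure of the open box. Hence \<open>U\<close>
  meets the box in a nonempty open set, which is not negligible.\<close>

lemma open_meets_torus:
  assumes U: "open U" and x: "x \<in> U" "x \<in> cbox 0 1"
  shows "0 < measure torus (U \<inter> cbox (0::real^'d) 1)"
proof (rule ccontr)
  assume "\<not> ?thesis"
  then have "emeasure torus (U \<inter> cbox (0::real^'d) 1) = 0"
    using measure_nonneg[of torus "U \<inter> cbox (0::real^'d) 1"] by (simp add: torus.emeasure_eq_measure)
  then have e0: "emeasure lborel (U \<inter> cbox (0::real^'d) 1) = 0"
    by (simp add: torus_def emeasure_restrict_space)
  have n: "negligible (U \<inter> box (0::real^'d) 1)"
  proof (rule negligible_subset[of "U \<inter> cbox (0::real^'d) 1"])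
    have "U \<inter> cbox (0::real^'d) 1 \<in> null_sets lborel"
      using e0 U by (auto simp: null_sets_def)
    then show "negligible (U \<inter> cbox (0::real^'d) 1)"
      by (simp add: negligible_iff_null_sets null_sets_completionI)
  qed (use box_subset_cbox in blast)
  have "box 0 (1::real^'d) \<noteq> {}"
    by (auto simp: box_ne_empty Basis_vec_def inner_axis)
  then have "x \<in> closure (box 0 1)" using x by (simp add: closure_box)
  then have "U \<inter> box 0 1 \<noteq> {}" using U x open_Int_closure_eq_empty[of U] by blast
  with n show False using open_not_negligible[of "U \<inter> box 0 1"] U by auto
qed

text \<open>Laplace's method: the weight is \<open>M - sep z\<close>. It is at least
  \<open>M - \<delta> / 2\<close> on the set \<open>S\<close> of positive measure and at most
  \<open>M - \<delta>\<close> where \<open>sep\<close> exceeds \<open>\<delta>\<close>, so the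
  normalized mass of the latter region decays geometrically in \<open>n\<close>.\<close>

lemma mollifier_concentration: "(\<lambda>n. LINT z|torus. mollifier n z * sep (z::real^'d)) \<longlonglongrightarrow> 0"
proof (rule LIMSEQ_I)
  fix r :: real assume "0 < r"
  define \<delta> where "\<delta> = min (r / 2) (1 / 2)"
  have \<delta>: "0 < \<delta>" "\<delta> \<le> r / 2" "\<delta> < 1" using \<open>0 < r\<close> by (auto simp: \<delta>_def)
  define M where "M = 1 + 2 * real CARD('d)"
  define D where "D = 2 * real CARD('d)"
  define S where "S = {z::real^'d. sep z < \<delta> / 2} \<inter> cbox 0 1"
  have "open {z::real^'d. sep z < \<delta> / 2}"
    by (intro open_Collect_less continuous_intros tcont_continuous[OF tcont_sep])
  then have v: "0 < measure torus S"
    unfolding S_def by (rule open_meets_torus[of _ 0]) (use \<delta> in \<open>auto simp: sep_def mem_box_cart\<close>)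
  have Ssets: "S \<in> sets torus"
  proof -
    have "{z::real^'d. sep z < \<delta> / 2} \<in> sets borel"
      by (intro borel_open open_Collect_less continuous_intros tcont_continuous[OF tcont_sep])
    then show ?thesis by (auto simp: S_def torus_def sets_restrict_space)
  qed
  have Mpos: "0 < M - \<delta>" "M - \<delta> < M - \<delta> / 2" using \<delta> by (auto simp: M_def)
  have low: "(M - \<delta> / 2) ^ n * measure torus S \<le> (LINT y|torus. mollifier_weight (y::real^'d) ^ n)" for n
  proof -
    have "(LINT y|torus. (M - \<delta> / 2) ^ n * indicator S y) \<le> (LINT y|torus. mollifier_weight (y::real^'d) ^ n)"
    proof (rule integral_mono)
      show "(M - \<delta> / 2) ^ n * indicator S y \<le> mollifier_weight y ^ n" for y :: "real^'d"
      proof (cases "y \<in> S")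
        case True
        then show ?thesis using Mpos
          by (auto simp: S_def mollifier_weight_def M_def intro!: power_mono)
      next
        case False
        then show ?thesis using mollifier_weight_ge_1[of y] by simp
      qed
    qed (use Ssets in \<open>auto intro!: tcont_integrable integrable_mult_right simp: torus.emeasure_eq_measure\<close>)
    moreover have "S \<inter> cbox 0 1 = S" by (auto simp: S_def)
    ultimately show ?thesis using Ssets by simp
  qed
  have up: "(LINT z|torus. mollifier n z * sep (z::real^'d)) \<le> \<delta> + D / measure torus S * ((M - \<delta>) / (M - \<delta> / 2)) ^ n" for n
  proof -
    let ?A = "LINT y|torus. mollifier_weight (y::real^'d) ^ n"
    have A: "0 < ?A" by (rule integral_mollifier_weight_pos)
    have "(LINT z|torus. mollifier n z * sep (z::real^'d)) \<le> (LINT z|torus. \<delta> * mollifier n (z::real^'d) + D * (M - \<delta>) ^ n / ?A)"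
    proof (rule integral_mono)
      fix z :: "real^'d"
      show "mollifier n z * sep z \<le> \<delta> * mollifier n z + D * (M - \<delta>) ^ n / ?A"
      proof (cases "sep z \<le> \<delta>")
        case True
        have "mollifier n z * sep z \<le> \<delta> * mollifier n z"
          using True mollifier_pos[of n z] by (simp add: mult.commute)
        moreover have "0 \<le> D * (M - \<delta>) ^ n / ?A" using Mpos A by (simp add: D_def)
        ultimately show ?thesis by linarith
      next
        case False
        have "mollifier_weight z \<le> M - \<delta>" "0 \<le> mollifier_weight z"
          using False mollifier_weight_ge_1[of z] by (auto simp: mollifier_weight_def M_def)
        then have "mollifier_weight z ^ n \<le> (M - \<delta>) ^ n" by (intro power_mono)
        then have "mollifier_weight z ^ n * sep z \<le> (M - \<delta>) ^ n * D"
          using sep_le[of z] sep_nonneg[of z] Mpos by (intro mult_mono) (auto simp: D_def)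
        then have "mollifier n z * sep z \<le> D * (M - \<delta>) ^ n / ?A"
          using A by (simp add: mollifier_def divide_right_mono mult.commute)
        moreover have "0 \<le> \<delta> * mollifier n z" using \<delta> mollifier_pos[of n z] by simp
        ultimately show ?thesis by linarith
      qed
    qed (intro tcont_integrable tcont_add tcont_mult tcont_const tcont_mollifier tcont_sep)+
    also have "\<dots> = \<delta> + D * (M - \<delta>) ^ n / ?A"
      using torus.prob_space by (simp add: tcont_integrable tcont_mollifier integral_mollifier)
    also have "D * (M - \<delta>) ^ n / ?A \<le> D * (M - \<delta>) ^ n / ((M - \<delta> / 2) ^ n * measure torus S)"
      using low[of n] Mpos v \<delta> by (intro divide_left_mono mult_pos_pos) (auto simp: D_def A)
    finally show ?thesis by (simp add: power_divide ac_simps)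
  qed
  have "(\<lambda>n. D / measure torus S * ((M - \<delta>) / (M - \<delta> / 2)) ^ n) \<longlonglongrightarrow> D / measure torus S * 0"
    using Mpos by (intro tendsto_mult tendsto_const LIMSEQ_realpow_zero) auto
  then have "eventually (\<lambda>n. D / measure torus S * ((M - \<delta>) / (M - \<delta> / 2)) ^ n < r / 2) sequentially"
    using \<open>0 < r\<close> by (intro order_tendstoD(2)[of _ 0]) auto
  then obtain N where N: "\<And>n. n \<ge> N \<Longrightarrow> D / measure torus S * ((M - \<delta>) / (M - \<delta> / 2)) ^ n < r / 2"
    unfolding eventually_sequentially by blast
  have "norm ((LINT z|torus. mollifier n z * sep (z::real^'d)) - 0) < r" if "n \<ge> N" for n
  proof -
    have "0 \<le> (LINT z|torus. mollifier n z * sep (z::real^'d))"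
      by (intro integral_nonneg_AE AE_I2 mult_nonneg_nonneg sep_nonneg less_imp_le[OF mollifier_pos])
    moreover have "(LINT z|torus. mollifier n z * sep (z::real^'d)) < r"
      using up[of n] N[OF that] \<delta>(2) by linarith
    ultimately show ?thesis by simp
  qed
  then show "\<exists>N. \<forall>n\<ge>N. norm ((LINT z|torus. mollifier n z * sep (z::real^'d)) - 0) < r" by blast
qed

text \<open>For points close modulo the lattice the bound is uniform continuity; for the others
  \<open>sep\<close> stays above a positive constant \<open>m\<close>, while the difference is at
  most twice the sup norm \<open>B\<close>. As in Korovkin's theorem, positive kernels then need
  testing only against \<open>sep\<close>.\<close>

lemma korovkin:
  assumes F: "tcont (F :: real^'d \<Rightarrow> real)" and \<eta>: "0 < \<eta>"
  obtains C where "0 \<le> C" "\<And>x y. \<bar>F x - F y\<bar> \<le> \<eta> + C * sep (x - y)"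
proof -
  obtain B where B: "0 < B" "\<And>x. norm (F x) \<le> B" using tcont_bounded[OF F] by blast
  obtain d where d: "0 < d" "\<And>x y. norm (x - y) < d \<Longrightarrow> norm (F x - F y) < \<eta>"
    using tcont_uniformly_continuous[OF F \<eta>] by blast
  \<comment> \<open>A vector with all components below \<open>d'\<close> has norm below
    \<open>d\<close> by the comparison with the l1 norm; the bound 1/4 keeps
    \<open>2 * pi * d'\<close> in the interval where the cosine decreases.\<close>
  define d' where "d' = min (d / (2 * CARD('d))) (1/4)"
  have d': "0 < d'" "d' \<le> 1/4" "CARD('d) * d' < d"
    using d(1) by (auto simp: d'_def min_def field_simps)
  define m where "m = 1 - cos (2 * pi * d')"
  have m: "0 < m"
    using cos_monotone_0_pi[of 0 "2 * pi * d'"] d' by (simp add: m_def)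
  have "\<bar>F x - F y\<bar> \<le> \<eta> + (2 * B / m) * sep (x - y)" for x y
  proof (cases "\<bar>F x - F y\<bar> < \<eta>")
    case True
    then show ?thesis using B(1) m sep_nonneg[of "x - y"] by (smt (verit) divide_nonneg_pos mult_nonneg_nonneg)
  next
    case False
    \<comment> \<open>The nearest lattice vector: the components of \<open>?z\<close> lie between
      -1/2 and 1/2, so that \<open>2 * pi * \<bar>?z $ i\<bar>\<close> is at most
      \<open>pi\<close>.\<close>
    let ?k = "(\<chi> i. round ((x - y) $ i)) :: int^'d"
    let ?z = "x - (y + lattice_vec ?k)"
    have "F (y + lattice_vec ?k) = F y"
      using tcont_periodic[OF F] unfolding lattice_periodic_def by blast
    with False d(2) have "d \<le> norm ?z" by (metis not_le real_norm_def)
    have "\<exists>i. d' \<le> \<bar>?z $ i\<bar>"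
    proof (rule ccontr)
      assume "\<not> ?thesis"
      then have "(\<Sum>i\<in>UNIV. \<bar>?z $ i\<bar>) \<le> (\<Sum>i\<in>(UNIV::'d set). d')"
        by (intro sum_mono) (auto simp: not_le less_imp_le)
      then show False using norm_le_l1_cart[of ?z] \<open>d \<le> norm ?z\<close> d' by simp
    qed
    then obtain i where i: "d' \<le> \<bar>?z $ i\<bar>" by blast
    have zi: "?z $ i = (x - y) $ i - of_int (round ((x - y) $ i))" by simp
    have half: "\<bar>?z $ i\<bar> \<le> 1/2"
      unfolding zi using of_int_round_abs_le[of "(x - y) $ i"] by (simp add: abs_minus_commute)
    have "cos (2 * pi * (x - y) $ i) = cos (2 * pi * ?z $ i + of_int (round ((x - y) $ i)) * (2 * pi))"
      unfolding zi by (simp add: algebra_simps)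
    also have "\<dots> = cos (2 * pi * \<bar>?z $ i\<bar>)"
      unfolding cos_plus_int
  proof -
    have "cos (2 * pi * u) = cos (2 * pi * \<bar>u\<bar>)" for u :: real
      by (cases "0 \<le> u") auto
    then show "cos (2 * pi * ?z $ i) = cos (2 * pi * \<bar>?z $ i\<bar>)" .
  qed
    also have "\<dots> \<le> cos (2 * pi * d')"
      using i half d' by (intro cos_monotone_0_pi_le) auto
    finally have "m \<le> 1 - cos (2 * pi * (x - y) $ i)" by (simp add: m_def)
    also have "\<dots> \<le> sep (x - y)"
      unfolding sep_def by (rule member_le_sum) auto
    finally have "m \<le> sep (x - y)" .
    then have "2 * B \<le> 2 * B / m * sep (x - y)"
      using B(1) m by (simp add: field_simps)
    moreover have "\<bar>F x - F y\<bar> \<le> 2 * B"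
      using B(2)[of x] B(2)[of y] by simp
    ultimately show ?thesis using \<eta> by linarith
  qed
  then show thesis using that[of "2 * B / m"] B(1) m by simp
qed

subsection \<open>Convolution on the torus\<close>

lemma torus_conv_real: "torus_conv K f x = (LINT y|torus. f y * K (x - y))" for K :: "real^'d \<Rightarrow> real"
  by (simp add: torus_conv_def)

lemma conv_integrable:
  fixes K :: "real^'d \<Rightarrow> real"
  assumes "tcont K" "integrable torus f"
  shows "integrable torus (\<lambda>y. f y * K (x - y))"
  using tcont_integrable_mult[OF tcont_reflect[OF assms(1)] assms(2), of x] by simp

lemma conv_bound:
  fixes K :: "real^'d \<Rightarrow> real"
  assumes K: "tcont K" and f: "integrable torus f" and B: "\<And>z. \<bar>K z\<bar> \<le> B"
  shows "\<bar>torus_conv K f x\<bar> \<le> B * (LINT y|torus. \<bar>f y\<bar>)"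
proof -
  have "\<bar>torus_conv K f x\<bar> \<le> (LINT y|torus. \<bar>f y * K (x - y)\<bar>)"
    unfolding torus_conv_real by (rule integral_abs_bound)
  also have "\<dots> \<le> (LINT y|torus. B * \<bar>f y\<bar>)"
  proof (rule integral_mono)
    show "\<bar>f y * K (x - y)\<bar> \<le> B * \<bar>f y\<bar>" for y
      using mult_left_mono[OF B abs_ge_zero, of "f y" "x - y"] by (simp add: abs_mult mult.commute)
  qed (use conv_integrable[OF K f] f in auto)
  finally show ?thesis by simp
qed

lemma conv_linear:
  fixes K L :: "real^'d \<Rightarrow> real"
  assumes K: "tcont K" "tcont L" and f: "integrable torus f" "integrable torus g"
  shows conv_diff_kernel: "torus_conv (\<lambda>z. K z - L z) f x = torus_conv K f x - torus_conv L f x"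
    and conv_diff: "torus_conv K (\<lambda>y. f y - g y) x = torus_conv K f x - torus_conv K g x"
proof -
  note i = conv_integrable[OF K(1) f(1), of x] conv_integrable[OF K(2) f(1), of x] conv_integrable[OF K(1) f(2), of x]
  show "torus_conv (\<lambda>z. K z - L z) f x = torus_conv K f x - torus_conv L f x"
    using i by (simp add: torus_conv_real right_diff_distrib)
  show "torus_conv K (\<lambda>y. f y - g y) x = torus_conv K f x - torus_conv K g x"
    using i by (simp add: torus_conv_real left_diff_distrib)
qed

text \<open>Dividing the tolerance by \<open>A + 1\<close> instead of \<open>A\<close> covers the
  case that the L1 norm \<open>A\<close> is zero.\<close>

lemma mult_divide_succ_less: "0 < (e::real) \<Longrightarrow> 0 \<le> A \<Longrightarrow> e / (A + 1) * A < e"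
  by (simp add: divide_less_eq field_simps)

lemma tcont_conv [intro]:
  fixes K :: "real^'d \<Rightarrow> real"
  assumes K: "tcont K" and f: "integrable torus f"
  shows "tcont (torus_conv K f)"
  unfolding tcont_def
proof
  have "K (x + lattice_vec k - y) = K (x - y)" for x y and k :: "int^'d"
  proof -
    have "x + lattice_vec k - y = (x - y) + lattice_vec k" by simp
    then show ?thesis using tcont_periodic[OF K] by (simp only: lattice_periodic_def)
  qed
  then show "lattice_periodic (torus_conv K f)"
    by (simp add: lattice_periodic_def torus_conv_real)
  let ?A = "LINT y|torus. \<bar>f y\<bar>"
  have A: "0 \<le> ?A" by simp
  show "continuous_on UNIV (torus_conv K f)"
    unfolding continuous_on_iff
  proof (intro ballI allI impI)
    fix x :: "real^'d" and e :: real assume "0 < e"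
    then have "0 < e / (?A + 1)" using A by (intro divide_pos_pos add_nonneg_pos) auto
    then obtain d where d: "0 < d" "\<And>x y. norm (x - y) < d \<Longrightarrow> norm (K x - K y) < e / (?A + 1)"
      using tcont_uniformly_continuous[OF K] by blast
    have "dist (torus_conv K f x') (torus_conv K f x) < e" if "dist x' x < d" for x'
    proof -
      have "torus_conv K f x' - torus_conv K f x = (LINT y|torus. f y * (K (x' - y) - K (x - y)))"
        using conv_integrable[OF K f] by (simp add: torus_conv_real right_diff_distrib)
      also have "\<bar>\<dots>\<bar> \<le> (LINT y|torus. \<bar>f y * (K (x' - y) - K (x - y))\<bar>)"
        by (rule integral_abs_bound)
      also have "\<dots> \<le> (LINT y|torus. e / (?A + 1) * \<bar>f y\<bar>)"
      proof (rule integral_mono)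
        show "\<bar>f y * (K (x' - y) - K (x - y))\<bar> \<le> e / (?A + 1) * \<bar>f y\<bar>" for y
        proof -
          have "norm ((x' - y) - (x - y)) < d" using that by (simp add: dist_norm)
          then have "\<bar>K (x' - y) - K (x - y)\<bar> \<le> e / (?A + 1)" using d(2) by fastforce
          from mult_left_mono[OF this abs_ge_zero, of "f y"] show ?thesis
            by (simp add: abs_mult mult.commute)
        qed
        show "integrable torus (\<lambda>y. \<bar>f y * (K (x' - y) - K (x - y))\<bar>)"
          using conv_integrable[OF K f] by (auto simp: right_diff_distrib)
      qed (use f in auto)
      also have "\<dots> = e / (?A + 1) * ?A" by simp
      also have "\<dots> < e" using A \<open>0 < e\<close> by (rule mult_divide_succ_less[rotated])
      finally show ?thesis by (simp add: dist_real_def)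
    qed
    with d(1) show "\<exists>d>0. \<forall>x'\<in>UNIV. dist x' x < d \<longrightarrow> dist (torus_conv K f x') (torus_conv K f x) < e" by blast
  qed
qed

text \<open>Uniform continuity of the derivative and the mean value inequality make the remainder of
  the difference quotient small uniformly in \<open>z\<close>. It can therefore be integrated
  against a merely integrable function.\<close>

lemma has_pd_uniform:
  assumes K: "has_pd i K K'" and K': "tcont K'" and e: "0 < e"
  obtains d where "0 < d" "\<And>z s. \<bar>s\<bar> < d \<Longrightarrow> \<bar>K (z + s *\<^sub>R axis i 1) - K z - s * K' z\<bar> \<le> e * \<bar>s\<bar>"
proof -
  obtain d where d: "0 < d" "\<And>x y. norm (x - y) < d \<Longrightarrow> norm (K' x - K' y) < e"
    using tcont_uniformly_continuous[OF K' e] by blast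
  have "\<bar>K (z + s *\<^sub>R axis i 1) - K z - s * K' z\<bar> \<le> e * \<bar>s\<bar>" if s: "\<bar>s\<bar> < d" for z s
  proof -
    have "norm ((K (z + s *\<^sub>R axis i 1) - s * K' z) - (K (z + 0 *\<^sub>R axis i 1) - 0 * K' z)) \<le> e * norm (s - 0)"
    proof (rule field_differentiable_bound[of "{-d<..<d}" "\<lambda>s. K (z + s *\<^sub>R axis i 1) - s * K' z" "\<lambda>s. K' (z + s *\<^sub>R axis i 1) - K' z"])
      fix r assume r: "r \<in> {-d<..<d}"
      show "((\<lambda>s. K (z + s *\<^sub>R axis i 1) - s * K' z) has_real_derivative K' (z + r *\<^sub>R axis i 1) - K' z) (at r within {-d<..<d})"
        by (rule has_field_derivative_at_within) (auto intro!: derivative_eq_intros has_pd_line[OF K])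
      have "norm ((z + r *\<^sub>R axis i 1) - z) < d" using r by (auto simp: norm_axis_1 abs_less_iff)
      then show "norm (K' (z + r *\<^sub>R axis i 1) - K' z) \<le> e" using d(2) by (metis less_imp_le)
    qed (use s in auto)
    then show ?thesis by (simp add: algebra_simps)
  qed
  with d(1) that show thesis by blast
qed

lemma has_pd_conv [intro]:
  fixes K :: "real^'d \<Rightarrow> real"
  assumes K: "tcont K" and K': "tcont K'" and d: "has_pd i K K'" and f: "integrable torus f"
  shows "has_pd i (torus_conv K f) (torus_conv K' f)"
  unfolding has_pd_def DERIV_def
proof (intro allI LIM_I)
  fix x :: "real^'d" and r :: real assume "0 < r"
  let ?A = "LINT y|torus. \<bar>f y\<bar>"
  have A: "0 \<le> ?A" by simp
  have "0 < r / (?A + 1)" using A \<open>0 < r\<close> by (intro divide_pos_pos add_nonneg_pos) auto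
  then obtain d where d: "0 < d" "\<And>z s. \<bar>s\<bar> < d \<Longrightarrow> \<bar>K (z + s *\<^sub>R axis i 1) - K z - s * K' z\<bar> \<le> r / (?A + 1) * \<bar>s\<bar>"
    using has_pd_uniform[OF d K'] by blast
  have "norm ((torus_conv K f (x + (0 + s) *\<^sub>R axis i 1) - torus_conv K f (x + 0 *\<^sub>R axis i 1)) / s - torus_conv K' f x) < r"
    if s: "s \<noteq> 0" "norm (s - 0) < d" for s
  proof -
    let ?D = "\<lambda>y. K (x + s *\<^sub>R axis i 1 - y) - K (x - y) - s * K' (x - y)"
    have int: "integrable torus (\<lambda>y. f y * ?D y)"
      using conv_integrable[OF K f, of x] conv_integrable[OF K f, of "x + s *\<^sub>R axis i 1"]
        integrable_mult_right[OF conv_integrable[OF K' f, of x], of s]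
      by (simp add: right_diff_distrib mult.left_commute)
    have "torus_conv K f (x + s *\<^sub>R axis i 1) - torus_conv K f x - s * torus_conv K' f x = (LINT y|torus. f y * ?D y)"
      using conv_integrable[OF K f, of x] conv_integrable[OF K f, of "x + s *\<^sub>R axis i 1"]
        integrable_mult_right[OF conv_integrable[OF K' f, of x], of s]
      by (simp add: torus_conv_real right_diff_distrib mult.left_commute)
    also have "\<bar>\<dots>\<bar> \<le> (LINT y|torus. \<bar>f y * ?D y\<bar>)"
      by (rule integral_abs_bound)
    also have "\<dots> \<le> (LINT y|torus. (r / (?A + 1) * \<bar>s\<bar>) * \<bar>f y\<bar>)"
    proof (rule integral_mono)
      show "\<bar>f y * ?D y\<bar> \<le> (r / (?A + 1) * \<bar>s\<bar>) * \<bar>f y\<bar>" for y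
      proof -
        have "\<bar>?D y\<bar> \<le> r / (?A + 1) * \<bar>s\<bar>"
          using d(2)[of s "x - y"] s by (simp add: algebra_simps)
        from mult_left_mono[OF this abs_ge_zero, of "f y"] show ?thesis
          by (simp only: abs_mult mult.commute)
      qed
    qed (use f int in auto)
    also have "\<dots> = (r / (?A + 1) * \<bar>s\<bar>) * ?A" by simp
    also have "\<dots> < r * \<bar>s\<bar>"
      using mult_divide_succ_less[of "r * \<bar>s\<bar>" ?A] A \<open>0 < r\<close> s by (simp add: ac_simps)
    finally have *: "\<bar>torus_conv K f (x + s *\<^sub>R axis i 1) - torus_conv K f x - s * torus_conv K' f x\<bar> < r * \<bar>s\<bar>" .
    have "(torus_conv K f (x + s *\<^sub>R axis i 1) - torus_conv K f x) / s - torus_conv K' f x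
       = (torus_conv K f (x + s *\<^sub>R axis i 1) - torus_conv K f x - s * torus_conv K' f x) / s"
      using s by (simp add: field_simps)
    then show ?thesis using * s by (simp add: abs_divide divide_less_eq)
  qed
  with d(1) show "\<exists>d>0. \<forall>s. s \<noteq> 0 \<and> norm (s - 0) < d \<longrightarrow>
      norm ((torus_conv K f (x + (0 + s) *\<^sub>R axis i 1) - torus_conv K f (x + 0 *\<^sub>R axis i 1)) / s - torus_conv K' f x) < r"
    by blast
qed

lemma conv_commute:
  fixes K :: "real^'d \<Rightarrow> real"
  assumes "tcont K" "tcont f"
  shows "torus_conv K f x = torus_conv f K x"
proof -
  have t: "tcont (\<lambda>y. f y * K (x - y))" using assms by (intro tcont_mult tcont_reflect)
  show ?thesis
    using integral_torus_reflect[OF tcont_measurable[OF t] tcont_periodic[OF t], of x]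
    by (simp add: torus_conv_real mult.commute)
qed

lemma integral_mollifier_shift: "(LINT y|torus. mollifier n (x - y)) = 1"
  using integral_torus_reflect[OF tcont_measurable[OF tcont_mollifier] tcont_periodic[OF tcont_mollifier], of n x]
  by (simp add: integral_mollifier)

lemma integral_mollifier_sep_shift:
  fixes x :: "real^'d"
  shows "(LINT y|torus. mollifier n (x - y) * sep (x - y)) = (LINT z|torus. mollifier n z * sep (z::real^'d))"
proof -
  have t: "tcont (\<lambda>y::real^'d. mollifier n y * sep y)" by (intro tcont_mult tcont_mollifier tcont_sep)
  show ?thesis
    using integral_torus_reflect[OF tcont_measurable[OF t] tcont_periodic[OF t], of x] by simp
qed

text \<open>The kernel is positive and has mass 1, so the pointwise bound on the oscillation of
  \<open>F\<close> is averaged; the index \<open>n\<close> enters only through the mean of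
  \<open>sep\<close>.\<close>

lemma conv_mollifier_approx:
  assumes F: "tcont (F :: real^'d \<Rightarrow> real)" and C: "\<And>x y. \<bar>F x - F y\<bar> \<le> \<eta> + C * sep (x - y)"
  shows "\<bar>torus_conv (mollifier n) F x - F x\<bar> \<le> \<eta> + C * (LINT z|torus. mollifier n z * sep (z::real^'d))"
proof -
  have m: "tcont (\<lambda>y. mollifier n (x - y))" "tcont (\<lambda>y. sep (x - y))"
    by (auto intro: tcont_reflect)
  have "torus_conv (mollifier n) F x - F x = (LINT y|torus. mollifier n (x - y) * (F y - F x))"
  proof -
    have "(LINT y|torus. mollifier n (x - y) * (F y - F x))
      = (LINT y|torus. F y * mollifier n (x - y)) - (LINT y|torus. F x * mollifier n (x - y))"
      by (subst Bochner_Integration.integral_diff[symmetric])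
         (auto intro!: tcont_integrable tcont_mult F m simp: algebra_simps)
    then show ?thesis by (simp add: torus_conv_real integral_mollifier_shift)
  qed
  also have "\<bar>\<dots>\<bar> \<le> (LINT y|torus. \<bar>mollifier n (x - y) * (F y - F x)\<bar>)"
    by (rule integral_abs_bound)
  also have "\<dots> \<le> (LINT y|torus. \<eta> * mollifier n (x - y) + C * (mollifier n (x - y) * sep (x - y)))"
  proof (rule integral_mono)
    show "\<bar>mollifier n (x - y) * (F y - F x)\<bar> \<le> \<eta> * mollifier n (x - y) + C * (mollifier n (x - y) * sep (x - y))" for y
    proof -
      have "\<bar>mollifier n (x - y) * (F y - F x)\<bar> = mollifier n (x - y) * \<bar>F x - F y\<bar>"
        using mollifier_pos[of n "x - y"] by (simp add: abs_mult abs_minus_commute)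
      also have "\<dots> \<le> mollifier n (x - y) * (\<eta> + C * sep (x - y))"
        by (rule mult_left_mono[OF C less_imp_le[OF mollifier_pos]])
      finally show ?thesis by (simp add: algebra_simps)
    qed
  qed (intro tcont_integrable tcont_abs tcont_add tcont_diff tcont_mult tcont_const F m)+
  also have "\<dots> = (LINT y|torus. \<eta> * mollifier n (x - y)) + (LINT y|torus. C * (mollifier n (x - y) * sep (x - y)))"
    by (rule Bochner_Integration.integral_add) (intro tcont_integrable tcont_mult tcont_const m)+
  finally show ?thesis by (simp add: integral_mollifier_shift integral_mollifier_sep_shift)
qed

lemma conv_mollifier_uniform:
  assumes F: "tcont (F :: real^'d \<Rightarrow> real)" and e: "0 < e"
  shows "\<forall>\<^sub>F n in sequentially. \<forall>x. \<bar>torus_conv (mollifier n) F x - F x\<bar> \<le> e"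
proof -
  obtain C where C: "0 \<le> C" "\<And>x y. \<bar>F x - F y\<bar> \<le> e / 2 + C * sep (x - y)"
    using korovkin[OF F, of "e / 2"] e by auto
  have "(\<lambda>n. C * (LINT z|torus. mollifier n z * sep (z::real^'d))) \<longlonglongrightarrow> C * 0"
    by (intro tendsto_mult tendsto_const mollifier_concentration)
  then have "\<forall>\<^sub>F n in sequentially. C * (LINT z|torus. mollifier n z * sep (z::real^'d)) < e / 2"
    using e by (intro order_tendstoD(2)[of _ 0]) auto
  then show ?thesis
  proof eventually_elim
    case (elim n)
    show ?case
    proof
      fix x show "\<bar>torus_conv (mollifier n) F x - F x\<bar> \<le> e"
        using conv_mollifier_approx[OF F C(2), of n x] elim by linarith
    qed
  qed
qed

lemma conv_mollifier_tendsto: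
  assumes "tcont (F :: real^'d \<Rightarrow> real)"
  shows "(\<lambda>n. torus_conv (mollifier n) F x) \<longlonglongrightarrow> F x"
proof (rule LIMSEQ_I)
  fix r :: real assume "0 < r"
  then have "\<forall>\<^sub>F n in sequentially. \<forall>x. \<bar>torus_conv (mollifier n) F x - F x\<bar> \<le> r / 2"
    by (intro conv_mollifier_uniform[OF assms]) simp
  then have "\<forall>\<^sub>F n in sequentially. norm (torus_conv (mollifier n) F x - F x) < r"
    by eventually_elim (use \<open>0 < r\<close> in \<open>auto dest!: spec[of _ x]\<close>)
  then show "\<exists>N. \<forall>n\<ge>N. norm (torus_conv (mollifier n) F x - F x) < r"
    by (simp add: eventually_sequentially)
qed

section \<open>Fubini's theorem and associativity of convolution\<close>

lemma measurable_torus_id [measurable]: "(\<lambda>x. x) \<in> measurable torus borel"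
  by (rule measurable_torus) simp

interpretation torus2: pair_sigma_finite "torus :: (real^'d) measure" "torus :: (real^'d) measure" ..

text \<open>The bound \<open>B * \<bar>f y\<bar>\<close> is integrable over the product, since the
  torus has measure 1. Bounded kernels against an integrable weight are the only double integrals
  that occur.\<close>

lemma torus_fubini:
  fixes G :: "real^'d \<Rightarrow> real^'d \<Rightarrow> real"
  assumes G: "case_prod G \<in> borel_measurable (borel \<Otimes>\<^sub>M borel)" and B: "\<And>x y. \<bar>G x y\<bar> \<le> B"
    and f: "integrable torus f"
  shows "(LINT x|torus. LINT y|torus. f y * G x y) = (LINT y|torus. f y * (LINT x|torus. G x y))"
    and "integrable torus (\<lambda>x. LINT y|torus. f y * G x y)"
    and "integrable torus (\<lambda>y. f y * (LINT x|torus. G x y))"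
proof -
  have [measurable]: "f \<in> borel_measurable torus" using f by auto
  have mf: "fst \<in> measurable (torus \<Otimes>\<^sub>M torus) (borel :: (real^'d) measure)"
           "snd \<in> measurable (torus \<Otimes>\<^sub>M torus) (borel :: (real^'d) measure)"
    using measurable_compose[OF measurable_fst measurable_torus_id] measurable_compose[OF measurable_snd measurable_torus_id] by auto
  have "(\<lambda>z. case_prod G (fst z, snd z)) \<in> borel_measurable (torus \<Otimes>\<^sub>M torus)"
    by (rule measurable_compose[OF measurable_Pair[OF mf] G])
  then have G' [measurable]: "case_prod G \<in> borel_measurable (torus \<Otimes>\<^sub>M torus)" by simp
  have le: "\<bar>f y * G x y\<bar> \<le> B * \<bar>f y\<bar>" for x y
    using mult_left_mono[OF B abs_ge_zero, of "f y" x y] by (simp only: abs_mult mult.commute)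
  have iy: "integrable torus (\<lambda>y. f y * G x y)" if "x \<in> cbox 0 1" for x
  proof (rule Bochner_Integration.integrable_bound[of _ "\<lambda>y. B * f y"])
    have B0: "0 \<le> B" using B[of 0 0] by linarith
    show "AE y in torus. norm (f y * G x y) \<le> norm (B * f y)"
      using le B0 by (auto simp: abs_mult)
    have "G x \<in> borel_measurable torus"
      using measurable_Pair2[OF G, of x] by (intro measurable_torus) simp
    then show "(\<lambda>y. f y * G x y) \<in> borel_measurable torus" by measurable
  qed (use f in auto)
  have int: "integrable (torus \<Otimes>\<^sub>M torus) (\<lambda>(x, y). f y * G x y)"
  proof (rule torus2.Fubini_integrable)
    show "(\<lambda>(x, y). f y * G x y) \<in> borel_measurable (torus \<Otimes>\<^sub>M torus)" by measurable
    show "AE x in torus. integrable torus (\<lambda>y. case (x, y) of (x, y) \<Rightarrow> f y * G x y)"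
      using iy by (auto intro!: AE_I2)
    show "integrable torus (\<lambda>x. LINT y|torus. norm (case (x, y) of (x, y) \<Rightarrow> f y * G x y))"
    proof (rule torus.integrable_const_bound)
      show "AE x in torus. norm (LINT y|torus. norm (case (x, y) of (x, y) \<Rightarrow> f y * G x y)) \<le> B * (LINT y|torus. \<bar>f y\<bar>)"
      proof (rule AE_I2)
        fix x :: "real^'d" assume "x \<in> space torus"
        have "(LINT y|torus. \<bar>f y * G x y\<bar>) \<le> (LINT y|torus. B * \<bar>f y\<bar>)"
          using iy[of x] \<open>x \<in> space torus\<close> f le by (intro integral_mono) auto
        then show "norm (LINT y|torus. norm (case (x, y) of (x, y) \<Rightarrow> f y * G x y)) \<le> B * (LINT y|torus. \<bar>f y\<bar>)" by simp
      qed
    qed measurable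
  qed
  show "(LINT x|torus. LINT y|torus. f y * G x y) = (LINT y|torus. f y * (LINT x|torus. G x y))"
    using torus2.Fubini_integral[OF int] by simp
  show "integrable torus (\<lambda>x. LINT y|torus. f y * G x y)"
    using torus2.integrable_fst'[OF int] by simp
  show "integrable torus (\<lambda>y. f y * (LINT x|torus. G x y))"
    using torus2.integrable_snd[OF int] by simp
qed

lemma measurable_pair_diff:
  fixes K :: "real^'d \<Rightarrow> real"
  shows "tcont K \<Longrightarrow> (\<lambda>(x, y). K (x - y)) \<in> borel_measurable (borel \<Otimes>\<^sub>M borel)"
  using tcont_measurable[of K] by measurable

text \<open>Fubini and the substitution \<open>v = x - u\<close> in the inner integral. It serves to
  move the mollifier from a density onto the interaction kernel.\<close>

lemma conv_assoc:
  fixes K L :: "real^'d \<Rightarrow> real"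
  assumes K: "tcont K" and L: "tcont L" and f: "integrable torus f"
  shows "torus_conv K (torus_conv L f) x = torus_conv (torus_conv L K) f x"
proof -
  obtain A B where A: "0 < A" "\<And>x. norm (K x) \<le> A" and B: "0 < B" "\<And>x. norm (L x) \<le> B"
    using tcont_bounded[OF K] tcont_bounded[OF L] by metis
  have m: "(\<lambda>(u, z). K (x - u) * L (u - z)) \<in> borel_measurable (borel \<Otimes>\<^sub>M borel)"
    using tcont_measurable[OF K] tcont_measurable[OF L] by measurable
  have inner: "(LINT u|torus. K (x - u) * L (u - z)) = torus_conv L K (x - z)" for z
  proof -
    have "tcont (\<lambda>v. K v * L (x - z - v))" using K L by (intro tcont_mult tcont_reflect)
    from integral_torus_reflect[OF tcont_measurable[OF this] tcont_periodic[OF this], of x]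
    show ?thesis by (simp add: torus_conv_real algebra_simps)
  qed
  have "torus_conv K (torus_conv L f) x = (LINT u|torus. LINT z|torus. f z * (K (x - u) * L (u - z)))"
  proof -
    have "(LINT z|torus. f z * L (u - z)) * K (x - u) = (LINT z|torus. f z * (K (x - u) * L (u - z)))" for u
      using integral_mult_left_zero[of torus "\<lambda>z. f z * L (u - z)" "K (x - u)"]
      by (simp add: mult_ac)
    then show ?thesis by (simp add: torus_conv_real)
  qed
  also have "\<dots> = (LINT z|torus. f z * (LINT u|torus. K (x - u) * L (u - z)))"
    by (rule torus_fubini(1)[OF m _ f, of "A * B"])
       (use A B in \<open>auto simp: abs_mult intro!: mult_mono\<close>)
  finally show ?thesis unfolding inner by (simp add: torus_conv_real)
qed

subsection \<open>Wirtinger's inequality\<close>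

text \<open>The Riccati function \<open>\<lambda> tan (\<lambda> (s - a - L/2))\<close> completes the square.\<close>

lemma dirichlet_poincare:
  fixes z z' :: "real \<Rightarrow> real"
  assumes z: "\<And>s. (z has_real_derivative z' s) (at s)" and z': "continuous_on UNIV z'"
    and bd: "z a = 0" "z (a + L) = 0" and L: "0 < L" and l: "0 < l" "l * L < pi"
  shows "l\<^sup>2 * integral {a..a+L} (\<lambda>s. (z s)\<^sup>2) \<le> integral {a..a+L} (\<lambda>s. (z' s)\<^sup>2)"
proof -
  define \<theta> where "\<theta> s = l * (s - a - L / 2)" for s
  define \<phi> where "\<phi> s = l * tan (\<theta> s)" for s
  have cz: "continuous_on UNIV z"
    using z by (meson DERIV_isCont continuous_at_imp_continuous_on)
  \<comment> \<open>The strict inequality \<open>l * L < pi\<close> keeps \<open>\<theta>\<close>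
    off the poles of the tangent on the closed interval, so \<open>\<phi>\<close> is differentiable
    up to both ends.\<close>
  have cos: "0 < cos (\<theta> s)" if "s \<in> {a..a+L}" for s
  proof (rule cos_gt_zero_pi)
    have "l * (L / 2) < pi / 2" using l by simp
    moreover have "\<bar>\<theta> s\<bar> \<le> l * (L / 2)"
      unfolding \<theta>_def abs_mult using that l by (intro mult_mono) (auto simp: abs_le_iff field_simps)
    ultimately show "- (pi / 2) < \<theta> s" "\<theta> s < pi / 2" by linarith+
  qed
  have d\<phi>: "(\<phi> has_real_derivative l\<^sup>2 + (\<phi> s)\<^sup>2) (at s)" if "s \<in> {a..a+L}" for s
  proof -
    have "((\<lambda>s. tan (\<theta> s)) has_real_derivative inverse ((cos (\<theta> s))\<^sup>2) * l) (at s)"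
    proof (rule DERIV_chain2[where f = tan])
      show "(\<theta> has_real_derivative l) (at s)"
        unfolding \<theta>_def[abs_def] by (auto intro!: derivative_eq_intros)
      show "(tan has_real_derivative inverse ((cos (\<theta> s))\<^sup>2)) (at (\<theta> s))"
        using cos[OF that] by (intro DERIV_tan) auto
    qed
    from DERIV_cmult[OF this, of l]
    have "(\<phi> has_real_derivative l * (inverse ((cos (\<theta> s))\<^sup>2) * l)) (at s)"
      by (simp add: \<phi>_def[abs_def])
    also have "l * (inverse ((cos (\<theta> s))\<^sup>2) * l) = l\<^sup>2 + (\<phi> s)\<^sup>2"
      using tan_sec[of "\<theta> s"] cos[OF that]
      by (simp add: \<phi>_def power_mult_distrib power2_eq_square[of l] algebra_simps)
        (metis distrib_left mult.right_neutral power_inverse)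
    finally show ?thesis .
  qed
  let ?F = "\<lambda>s. (z s)\<^sup>2 * \<phi> s"
  let ?F' = "\<lambda>s. 2 * z s * z' s * \<phi> s + (z s)\<^sup>2 * (l\<^sup>2 + (\<phi> s)\<^sup>2)"
  have "(?F' has_integral ?F (a + L) - ?F a) {a..a+L}"
  proof (rule fundamental_theorem_of_calculus)
    fix s assume s: "s \<in> {a..a+L}"
    have "(?F has_real_derivative ?F' s) (at s)"
      by (rule DERIV_cong[OF DERIV_mult[OF DERIV_power[OF z] d\<phi>[OF s]]]) (auto simp: algebra_simps)
    then show "(?F has_vector_derivative ?F' s) (at s within {a..a+L})"
      by (simp add: has_real_derivative_iff_has_vector_derivative has_vector_derivative_at_within)
  qed (use L in simp)
  then have F: "(?F' has_integral 0) {a..a+L}" using bd by simp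
  have i: "(\<lambda>s. (z s)\<^sup>2) integrable_on {a..a+L}" "(\<lambda>s. (z' s)\<^sup>2) integrable_on {a..a+L}"
    by (intro integrable_continuous_real continuous_intros continuous_on_subset[OF cz] continuous_on_subset[OF z']; simp)+
  have "((\<lambda>s. (z' s)\<^sup>2 - l\<^sup>2 * (z s)\<^sup>2) has_integral integral {a..a+L} (\<lambda>s. (z' s)\<^sup>2) - l\<^sup>2 * integral {a..a+L} (\<lambda>s. (z s)\<^sup>2)) {a..a+L}"
    using i by (intro has_integral_diff has_integral_mult_right integrable_integral)
  from has_integral_add[OF this F]
  have hi: "((\<lambda>s. (z' s)\<^sup>2 - l\<^sup>2 * (z s)\<^sup>2 + ?F' s) has_integral integral {a..a+L} (\<lambda>s. (z' s)\<^sup>2) - l\<^sup>2 * integral {a..a+L} (\<lambda>s. (z s)\<^sup>2)) {a..a+L}"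
    by simp
  have nn: "0 \<le> (z' s)\<^sup>2 - l\<^sup>2 * (z s)\<^sup>2 + ?F' s" for s
  proof -
    have "(z' s)\<^sup>2 - l\<^sup>2 * (z s)\<^sup>2 + ?F' s = (z' s + z s * \<phi> s)\<^sup>2"
      by (simp add: power2_eq_square algebra_simps)
    then show ?thesis by simp
  qed
  have "0 \<le> integral {a..a+L} (\<lambda>s. (z' s)\<^sup>2) - l\<^sup>2 * integral {a..a+L} (\<lambda>s. (z s)\<^sup>2)"
    by (rule has_integral_nonneg[OF hi nn])
  then show ?thesis by simp
qed

lemma integral_period_shift:
  fixes G :: "real \<Rightarrow> real"
  assumes c: "continuous_on UNIV G" and per: "\<And>s. G (s + 1) = G s" and a: "0 \<le> a" "a \<le> 1"
  shows "integral {a..a+1} G = integral {0..1} G"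
proof -
  have i: "G integrable_on {u..v}" for u v
    by (intro integrable_continuous_real continuous_on_subset[OF c]) simp
  have "integral {0..a} G + integral {a..1} G = integral {0..1} G"
    using a i by (intro Henstock_Kurzweil_Integration.integral_combine) auto
  moreover have "integral {a..1} G + integral {1..a+1} G = integral {a..a+1} G"
    using a i by (intro Henstock_Kurzweil_Integration.integral_combine) auto
  moreover have "integral {0..a} (G \<circ> (\<lambda>x. x + 1)) = integral {0+1..a+1} G"
    by (rule integral_shift) (rule continuous_on_subset[OF c], simp)
  ultimately show ?thesis by (simp add: o_def per)
qed

text \<open>Some \<open>a\<close> satisfies \<open>w (a + 1/2) = w a\<close>. Then
  \<open>z = w - w a\<close> vanishes at the ends of two half periods, and the Dirichlet inequality
  on each of them has the constant \<open>(2 pi)^2\<close>, the same as the periodic one. Since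
  \<open>w\<close> has mean zero, subtracting a constant only increases the integral of the
  square.\<close>

lemma wirtinger:
  fixes w w' :: "real \<Rightarrow> real"
  assumes w: "\<And>s. (w has_real_derivative w' s) (at s)" and w': "continuous_on UNIV w'"
    and per: "\<And>s. w (s + 1) = w s" "\<And>s. w' (s + 1) = w' s" and mean: "integral {0..1} w = 0"
  shows "4 * pi\<^sup>2 * integral {0..1} (\<lambda>s. (w s)\<^sup>2) \<le> integral {0..1} (\<lambda>s. (w' s)\<^sup>2)"
proof -
  have cw: "continuous_on UNIV w"
    using w by (meson DERIV_isCont continuous_at_imp_continuous_on)
  have per2: "w (s + 1/2 + 1/2) = w s" for s using per(1)[of s] by (simp add: add.assoc)
  \<comment> \<open>The difference of the values at \<open>s + 1/2\<close> and \<open>s\<close>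
    changes its sign when \<open>s\<close> moves by half a period.\<close>
  have "\<exists>a. 0 \<le> a \<and> a \<le> 1/2 \<and> w (a + 1/2) - w a = 0"
  proof (cases "w (0 + 1/2) - w 0 \<le> 0")
    case True
    then show ?thesis using per2[of 0]
      by (intro IVT') (auto intro!: continuous_intros continuous_on_compose2[OF cw])
  next
    case False
    then show ?thesis using per2[of 0]
      by (intro IVT2') (auto intro!: continuous_intros continuous_on_compose2[OF cw])
  qed
  then obtain a where a: "0 \<le> a" "a \<le> 1/2" "w (a + 1/2) = w a" by auto
  define z where "z s = w s - w a" for s
  have dz: "(z has_real_derivative w' s) (at s)" for s
    unfolding z_def[abs_def] by (rule DERIV_cong[OF DERIV_diff[OF w DERIV_const]]) simp
  have cz: "continuous_on UNIV z" unfolding z_def[abs_def] by (intro continuous_intros cw)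
  have z0: "z a = 0" "z (a + 1/2) = 0" "z (a + 1/2 + 1/2) = 0"
    using a per2[of a] by (auto simp: z_def)
  have iz: "(\<lambda>s. (z s)\<^sup>2) integrable_on {u..v}" "(\<lambda>s. (w' s)\<^sup>2) integrable_on {u..v}" for u v
    by (intro integrable_continuous_real continuous_intros continuous_on_subset[OF cz] continuous_on_subset[OF w']; simp)+
  have split: "integral {a..a+1} G = integral {a..a+1/2} G + integral {a+1/2..a+1/2+1/2} G"
    if "\<And>u v. G integrable_on {u..v}" for G :: "real \<Rightarrow> real"
    using Henstock_Kurzweil_Integration.integral_combine[of a "a+1/2" "a+1" G] that by (simp add: add.commute)
  have main: "l\<^sup>2 * integral {0..1} (\<lambda>s. (z s)\<^sup>2) \<le> integral {0..1} (\<lambda>s. (w' s)\<^sup>2)" if l: "0 < l" "l < 2 * pi" for l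
  proof -
    have 1: "l\<^sup>2 * integral {a..a+1/2} (\<lambda>s. (z s)\<^sup>2) \<le> integral {a..a+1/2} (\<lambda>s. (w' s)\<^sup>2)"
      by (rule dirichlet_poincare[OF dz w']) (use z0 l in auto)
    have 2: "l\<^sup>2 * integral {a+1/2..a+1/2+1/2} (\<lambda>s. (z s)\<^sup>2) \<le> integral {a+1/2..a+1/2+1/2} (\<lambda>s. (w' s)\<^sup>2)"
      by (rule dirichlet_poincare[OF dz w']) (use z0 l in auto)
    have 3: "integral {a..a+1} (\<lambda>s. (z s)\<^sup>2) = integral {0..1} (\<lambda>s. (z s)\<^sup>2)"
      by (rule integral_period_shift) (use a per in \<open>auto simp: z_def intro!: continuous_intros cw\<close>)
    have 4: "integral {a..a+1} (\<lambda>s. (w' s)\<^sup>2) = integral {0..1} (\<lambda>s. (w' s)\<^sup>2)"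
      by (rule integral_period_shift) (use a per in \<open>auto intro!: continuous_intros w'\<close>)
    show ?thesis
      unfolding 3[symmetric] 4[symmetric] split[OF iz(1)] split[OF iz(2)] distrib_left using 1 2 by linarith
  qed
  have "integral {0..1} (\<lambda>s. (w s)\<^sup>2) \<le> integral {0..1} (\<lambda>s. (z s)\<^sup>2)"
  proof -
    have iw: "w integrable_on {0..1}" "(\<lambda>s. (w s)\<^sup>2) integrable_on {0..1}"
      by (intro integrable_continuous_real continuous_intros continuous_on_subset[OF cw]; simp)+
    have "((\<lambda>s. ((w s)\<^sup>2 - (2 * w a) * w s) + (w a)\<^sup>2) has_integral
       (integral {0..1} (\<lambda>s. (w s)\<^sup>2) - (2 * w a) * integral {0..1} w) + (w a)\<^sup>2 * (1 - 0)) {0..1}"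
      using iw has_integral_const_real[of "(w a)\<^sup>2" 0 1]
      by (intro has_integral_add has_integral_diff has_integral_mult_right integrable_integral) auto
    moreover have "(\<lambda>s. ((w s)\<^sup>2 - (2 * w a) * w s) + (w a)\<^sup>2) = (\<lambda>s. (z s)\<^sup>2)"
      by (auto simp: z_def power2_eq_square algebra_simps)
    ultimately have "integral {0..1} (\<lambda>s. (z s)\<^sup>2) = integral {0..1} (\<lambda>s. (w s)\<^sup>2) + (w a)\<^sup>2"
      using mean by (auto dest: integral_unique)
    then show ?thesis by simp
  qed
  moreover have "(4 * pi\<^sup>2) * integral {0..1} (\<lambda>s. (z s)\<^sup>2) \<le> integral {0..1} (\<lambda>s. (w' s)\<^sup>2)"
  proof (rule field_le_mult_one_interval)
    fix r :: real assume r: "0 < r" "r < 1"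
    \<comment> \<open>The Dirichlet inequality on a half period requires \<open>l\<close> strictly
      below \<open>2 * pi\<close>; \<open>l = 2 * pi * sqrt r\<close> recovers the constant
      \<open>4 pi^2\<close> as \<open>r\<close> tends to 1.\<close>
    have "(2 * pi * sqrt r)\<^sup>2 * integral {0..1} (\<lambda>s. (z s)\<^sup>2) \<le> integral {0..1} (\<lambda>s. (w' s)\<^sup>2)"
      by (rule main) (use r in auto)
    then show "r * (4 * pi\<^sup>2 * integral {0..1} (\<lambda>s. (z s)\<^sup>2)) \<le> integral {0..1} (\<lambda>s. (w' s)\<^sup>2)"
      using r by (simp add: power_mult_distrib ac_simps)
  qed
  ultimately show ?thesis
    by (meson mult_left_mono order_trans zero_le_mult_iff zero_le_numeral zero_le_power2)
qed

text \<open>On each coordinate line \<open>v1\<close> is the derivative of the periodic function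
  \<open>v\<close> and thus has mean zero, so the one-dimensional inequality applies.\<close>

lemma torus_wirtinger:
  assumes v: "tcont v" "tcont v1" "tcont v2" and d: "has_pd i v v1" "has_pd i v1 v2"
  shows "4 * pi\<^sup>2 * (LINT x|torus. (v1 x)\<^sup>2) \<le> (LINT x|torus. (v2 x)\<^sup>2)"
proof -
  let ?G = "\<lambda>x. (v2 x)\<^sup>2 - 4 * pi\<^sup>2 * (v1 x)\<^sup>2"
  have G: "tcont ?G" using v by (intro tcont_diff tcont_mult tcont_power tcont_const)
  have "0 \<le> (LINT x|torus. ?G x)"
  proof (rule integral_torus_line_nonneg[OF G])
    fix x
    have c: "continuous_on UNIV (\<lambda>s. F (x + s *\<^sub>R axis i 1))" if "tcont F" for F :: "real^'a \<Rightarrow> real"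
      by (rule continuous_on_compose2[OF tcont_continuous[OF that]]) (auto intro!: continuous_intros)
    have per: "F (x + (s + 1) *\<^sub>R axis i 1) = F (x + s *\<^sub>R axis i 1)" if "tcont F" for F :: "real^'a \<Rightarrow> real" and s
      using lattice_axis[OF tcont_periodic[OF that], of "x + s *\<^sub>R axis i 1"] by (simp add: algebra_simps)
    have "((\<lambda>s. v1 (x + s *\<^sub>R axis i 1)) has_integral v (x + 1 *\<^sub>R axis i 1) - v (x + 0 *\<^sub>R axis i 1)) {0..1}"
      by (rule fundamental_theorem_of_calculus)
        (use has_pd_line[OF d(1)] in \<open>auto simp: has_real_derivative_iff_has_vector_derivative has_vector_derivative_at_within\<close>)
    then have "integral {0..1} (\<lambda>s. v1 (x + s *\<^sub>R axis i 1)) = 0"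
      using lattice_axis[OF tcont_periodic[OF v(1)], of x] by (auto dest: integral_unique)
    then have "4 * pi\<^sup>2 * integral {0..1} (\<lambda>s. (v1 (x + s *\<^sub>R axis i 1))\<^sup>2) \<le> integral {0..1} (\<lambda>s. (v2 (x + s *\<^sub>R axis i 1))\<^sup>2)"
      by (intro wirtinger has_pd_line[OF d(2)] c v per)
    moreover have "((\<lambda>s. ?G (x + s *\<^sub>R axis i 1)) has_integral
        integral {0..1} (\<lambda>s. (v2 (x + s *\<^sub>R axis i 1))\<^sup>2) - 4 * pi\<^sup>2 * integral {0..1} (\<lambda>s. (v1 (x + s *\<^sub>R axis i 1))\<^sup>2)) {0..1}"
      by (intro has_integral_diff has_integral_mult_right integrable_integral integrable_continuous_real
          continuous_on_power continuous_on_subset[OF c[OF v(2)]] continuous_on_subset[OF c[OF v(3)]]) auto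
    ultimately show "0 \<le> integral {0..1} (\<lambda>s. ?G (x + s *\<^sub>R axis i 1))"
      by (auto dest: integral_unique)
  qed
  also have "(LINT x|torus. ?G x) = (LINT x|torus. (v2 x)\<^sup>2) - (LINT x|torus. 4 * pi\<^sup>2 * (v1 x)\<^sup>2)"
    by (rule Bochner_Integration.integral_diff) (intro tcont_integrable tcont_mult tcont_power tcont_const v)+
  finally show ?thesis by simp
qed

text \<open>With \<open>v = sqrt h\<close>, four times \<open>\<integral> (\<partial>\<^sub>i\<partial>\<^sub>i v)\<^sup>2\<close> is the right-hand side minus \<open>\<integral> (\<partial>\<^sub>i h)\<^sup>4 / (12 h\<^sup>3)\<close>.\<close>

lemma log_hessian_bound:
  assumes h: "tcont h" "tcont h1" "tcont h2" and d: "has_pd i h h1" "has_pd i h1 h2"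
    and pos: "\<And>x. 0 < h x"
  shows "4 * pi\<^sup>2 * (LINT x|torus. (h1 x)\<^sup>2 / h x) \<le> (LINT x|torus. h x * (h2 x / h x - (h1 x)\<^sup>2 / (h x)\<^sup>2)\<^sup>2)"
proof -
  have nz: "h x \<noteq> 0" for x using pos[of x] by simp
  have snz: "sqrt (h x) \<noteq> 0" for x using pos[of x] by simp
  define v1 where "v1 x = h1 x / (2 * sqrt (h x))" for x
  define v2 where "v2 x = (h2 x - (h1 x)\<^sup>2 / (2 * h x)) / (2 * sqrt (h x))" for x
  \<comment> \<open>The derivative of \<open>h1^3 / h^2\<close>, with integral zero; adding a third
    of it matches the mixed terms in \<open>h1^2 * h2\<close> of the two sides.\<close>
  define F' where "F' x = 3 * (h1 x)\<^sup>2 * h2 x / (h x)\<^sup>2 - 2 * (h1 x)^4 / (h x)^3" for x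
  have t: "tcont v1" "tcont v2" "tcont F'"
    unfolding v1_def[abs_def] v2_def[abs_def] F'_def[abs_def]
    by (intro tcont_divide tcont_mult tcont_diff tcont_const tcont_power tcont_sqrt h; simp add: nz)+
  have dv: "has_pd i (\<lambda>x. sqrt (h x)) v1"
    unfolding v1_def[abs_def] by (rule has_pd_sqrt[OF d(1) pos])
  have dv1: "has_pd i v1 v2"
    unfolding v1_def[abs_def]
  proof (rule has_pd_cong)
    show "has_pd i (\<lambda>x. h1 x / (2 * sqrt (h x))) (\<lambda>x. (h2 x * (2 * sqrt (h x)) - h1 x * (2 * v1 x)) / (2 * sqrt (h x))\<^sup>2)"
      by (rule has_pd_divide[OF d(2) has_pd_cmult[OF dv]]) (simp add: nz)
    fix x
    have "(sqrt (h x))\<^sup>2 = h x" using pos[of x] by simp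
    then show "(h2 x * (2 * sqrt (h x)) - h1 x * (2 * v1 x)) / (2 * sqrt (h x))\<^sup>2 = v2 x"
      unfolding v1_def v2_def using nz[of x] snz[of x]
      by (simp add: divide_simps power2_eq_square)
  qed
  have tF: "tcont (\<lambda>x. (h1 x)^3 / (h x)\<^sup>2)"
    by (intro tcont_divide tcont_power h) (simp add: nz)
  have "has_pd i (\<lambda>x. (h1 x)^3 / (h x)\<^sup>2) F'"
    unfolding power3_eq_cube power2_eq_square
  proof (rule has_pd_cong[OF has_pd_divide[OF has_pd_mult[OF has_pd_mult[OF d(2) d(2)] d(2)] has_pd_mult[OF d(1) d(1)]]])
    show "h x * h x \<noteq> 0" for x by (simp add: nz)
    show "(((h2 x * h1 x + h1 x * h2 x) * h1 x + h1 x * h1 x * h2 x) * (h x * h x)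
       - h1 x * h1 x * h1 x * (h1 x * h x + h x * h1 x)) / (h x * h x)\<^sup>2 = F' x" for x
      unfolding F'_def using nz[of x]
      by (simp add: divide_simps) (simp add: algebra_simps eval_nat_numeral)
  qed
  then have F0: "(LINT x|torus. F' x) = 0" by (rule integral_torus_pd[OF tF t(3)])
  let ?R = "\<lambda>x. h x * (h2 x / h x - (h1 x)\<^sup>2 / (h x)\<^sup>2)\<^sup>2"
  have tR: "tcont ?R" by (intro tcont_divide tcont_mult tcont_diff tcont_power h; simp add: nz)
  have sq: "(v1 x)\<^sup>2 = (1/4) * ((h1 x)\<^sup>2 / h x)" for x
    using pos[of x] by (simp add: v1_def power_divide power_mult_distrib)
  have "16 * pi\<^sup>2 * (LINT x|torus. (v1 x)\<^sup>2) \<le> 4 * (LINT x|torus. (v2 x)\<^sup>2)"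
    using torus_wirtinger[OF tcont_sqrt[OF h(1)] t(1,2) dv dv1] by simp
  also have "16 * pi\<^sup>2 * (LINT x|torus. (v1 x)\<^sup>2) = 4 * pi\<^sup>2 * (LINT x|torus. (h1 x)\<^sup>2 / h x)"
    unfolding sq integral_mult_right_zero by simp
  also have "4 * (LINT x|torus. (v2 x)\<^sup>2) = (LINT x|torus. 4 * (v2 x)\<^sup>2)" by simp
  also have "\<dots> \<le> (LINT x|torus. ?R x + (1/3) * F' x)"
  proof (rule integral_mono)
    fix x
    have "?R x + (1/3) * F' x - 4 * (v2 x)\<^sup>2 = (h1 x)^4 / (12 * (h x)^3)"
    proof -
      have v2: "(v2 x)\<^sup>2 = (h2 x - (h1 x)\<^sup>2 / (2 * h x))\<^sup>2 / (4 * h x)"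
        using pos[of x] by (simp add: v2_def power_divide power_mult_distrib)
      show ?thesis unfolding v2 F'_def using nz[of x]
        by (simp add: divide_simps) (simp add: algebra_simps eval_nat_numeral)
    qed
    moreover have "0 \<le> (h1 x)^4 / (12 * (h x)^3)" using pos[of x] by simp
    ultimately show "4 * (v2 x)\<^sup>2 \<le> ?R x + (1/3) * F' x" by linarith
  qed (intro tcont_integrable tcont_add tcont_mult tcont_const tcont_power t tR)+
  also have "\<dots> = (LINT x|torus. ?R x) + (LINT x|torus. (1/3) * F' x)"
    by (rule Bochner_Integration.integral_add) (intro tcont_integrable tcont_mult tcont_const t tR)+
  finally show ?thesis by (simp add: F0)
qed

subsection \<open>Logarithmic Sobolev inequality on the torus\<close>

lemma second_derivative_at_min:
  fixes f f' :: "real \<Rightarrow> real"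
  assumes f: "\<And>s. (f has_real_derivative f' s) (at s)" and f': "(f' has_real_derivative l) (at 0)"
    and min: "\<And>s. f 0 \<le> f s"
  shows "0 \<le> l"
proof (rule ccontr)
  assume "\<not> 0 \<le> l"
  then have "l < 0" by simp
  have "f' 0 = 0"
    by (rule DERIV_local_min[OF f zero_less_one]) (use min in auto)
  with DERIV_neg_dec_right[OF f' \<open>l < 0\<close>] obtain d where
    d: "0 < d" "\<And>h. 0 < h \<Longrightarrow> h < d \<Longrightarrow> f' h < 0" by auto
  have "f (d / 2) < f 0"
  proof (rule DERIV_neg_imp_decreasing_open[of 0 "d / 2" f])
    show "continuous_on {0..d/2} f"
      using f by (meson DERIV_isCont continuous_at_imp_continuous_on)
    fix s assume "0 < s" "s < d / 2"
    then show "\<exists>y. (f has_real_derivative y) (at s) \<and> y < 0" using f d by (intro exI[of _ "f' s"]) auto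
  qed (use d in simp)
  with min[of "d/2"] show False by simp
qed

text \<open>This family of solutions of the heat equation is closed under all derivatives.\<close>

definition heat_sum ::
    "'q set \<Rightarrow> ('q \<Rightarrow> real) \<Rightarrow> ('q \<Rightarrow> real^'d) \<Rightarrow> ('q \<Rightarrow> real) \<Rightarrow> ('q \<Rightarrow> real) \<Rightarrow> real \<Rightarrow> real \<Rightarrow> real^'d \<Rightarrow> real" where
  "heat_sum J c w p a q t x = (\<Sum>j\<in>J. (c j * a j * exp (- (w j \<bullet> w j) * t)) * wave (w j) (p j + q) x)"

context
  fixes J :: "'q set" and c :: "'q \<Rightarrow> real" and w :: "'q \<Rightarrow> real^'d" and p :: "'q \<Rightarrow> real"
  assumes fr: "\<And>j. j \<in> J \<Longrightarrow> freq (w j)"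
begin

abbreviation "hs \<equiv> heat_sum J c w p"

lemma tcont_heat_sum: "tcont (hs a q t)"
  unfolding heat_sum_def[abs_def] by (intro tcont_sum tcont_mult tcont_const tcont_wave fr)

lemma has_pd_heat_sum: "has_pd k (hs a q t) (hs (\<lambda>j. a j * w j $ k) (q + pi / 2) t)"
proof (rule has_pd_cong)
  show "has_pd k (hs a q t) (\<lambda>x. \<Sum>j\<in>J. (c j * a j * exp (- (w j \<bullet> w j) * t)) * (w j $ k * wave (w j) (p j + q + pi / 2) x))"
    unfolding heat_sum_def[abs_def] by (intro has_pd_sum has_pd_cmult has_pd_wave)
qed (simp add: heat_sum_def add.assoc mult_ac)

lemma heat_sum_time_derivative:
  "((\<lambda>t. hs a q t x) has_real_derivative hs (\<lambda>j. - a j * (w j \<bullet> w j)) q t x) (at t within S)"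
  unfolding heat_sum_def by (auto intro!: derivative_eq_intros sum.cong)

lemma heat_sum_laplacian:
  "(\<Sum>k\<in>UNIV. hs (\<lambda>j. a j * w j $ k * w j $ k) (q + pi / 2 + pi / 2) t x) = hs (\<lambda>j. - a j * (w j \<bullet> w j)) q t x"
proof -
  have pi: "wave v (r + (q + pi / 2 + pi / 2)) x = - wave v (r + q) x" for v r
    using wave_pi[of v "r + q" x] by (simp add: add.assoc)
  show ?thesis
    unfolding heat_sum_def pi
    by (subst sum.swap) (simp add: inner_vec_def sum_distrib_left sum_distrib_right sum_negf mult_ac)
qed

lemma continuous_heat_sum: "continuous_on S (\<lambda>(t, x). hs a q t x)"
  unfolding heat_sum_def split_beta wave_def by (intro continuous_intros)

text \<open>The weak minimum principle: after adding \<open>e * s\<close>, a minimum below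
  \<open>m\<close> over the time interval and the cube lies at a positive time. There the Laplacian
  is nonnegative, so the time derivative is at least \<open>e > 0\<close>, and slightly earlier the
  value would be smaller.\<close>

lemma heat_sum_ge:
  assumes m: "\<And>x. m \<le> hs (\<lambda>_. 1) 0 0 x" and t: "0 \<le> t"
  shows "m \<le> hs (\<lambda>_. 1) 0 t x"
proof (rule ccontr)
  assume "\<not> ?thesis"
  then have lt: "hs (\<lambda>_. 1) 0 t x < m" by simp
  then have t0: "0 < t" using m[of x] t by (cases "t = 0") auto
  \<comment> \<open>Half of the gap, per unit of time: the perturbed function is still below
    \<open>m\<close> at \<open>(t, x)\<close>, whereas at time 0 it is nowhere below
    \<open>m\<close>.\<close>
  define e where "e = (m - hs (\<lambda>_. 1) 0 t x) / (2 * t)"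
  have e: "0 < e" "hs (\<lambda>_. 1) 0 t x + e * t < m" using lt t0 by (auto simp: e_def field_simps)
  define v where "v s y = hs (\<lambda>_. 1) 0 s y + e * s" for s y
  have per: "v s (wrap y) = v s y" for s y
    using lattice_periodic_wrap[OF tcont_periodic[OF tcont_heat_sum], of "\<lambda>_. 1" 0 s y] by (simp add: v_def)
  have "compact ({0..t} \<times> cbox (0::real^'d) 1)" by (intro compact_Times) auto
  moreover have "({0..t} \<times> cbox (0::real^'d) 1) \<noteq> {}"
    using wrap_in_cube[of "0::real^'d"] t by auto
  moreover have "continuous_on ({0..t} \<times> cbox (0::real^'d) 1) (\<lambda>(s, y). v s y)"
    using continuous_heat_sum unfolding v_def split_beta by (intro continuous_intros)
  ultimately obtain z0 where z0: "z0 \<in> {0..t} \<times> cbox (0::real^'d) 1"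
      "\<And>z. z \<in> {0..t} \<times> cbox (0::real^'d) 1 \<Longrightarrow> (\<lambda>(s, y). v s y) z0 \<le> (\<lambda>(s, y). v s y) z"
    using continuous_attains_inf[of "{0..t} \<times> cbox (0::real^'d) 1" "\<lambda>(s, y). v s y"] by blast
  obtain s y where "z0 = (s, y)" by (cases z0)
  then have sy: "s \<in> {0..t}" "\<And>r z. r \<in> {0..t} \<Longrightarrow> z \<in> cbox 0 1 \<Longrightarrow> v s y \<le> v r z"
    using z0(1) z0(2)[of "(_, _)"] by auto
  have min: "v s y \<le> v r z" if "r \<in> {0..t}" for r z
    using sy(2)[OF that wrap_in_cube, of z] by (simp add: per)
  have "v s y < m" using min[of t x] e t by (simp add: v_def)
  then have "s \<noteq> 0" using m[of y] by (auto simp: v_def)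
  with sy(1) have s0: "0 < s" "s \<le> t" by auto
  have "0 \<le> hs (\<lambda>j. 1 * w j $ k * w j $ k) (0 + pi / 2 + pi / 2) s y" for k
  proof (rule second_derivative_at_min)
    show "((\<lambda>r. hs (\<lambda>_. 1) 0 s (y + r *\<^sub>R axis k 1)) has_real_derivative hs (\<lambda>j. 1 * w j $ k) (0 + pi / 2) s (y + r *\<^sub>R axis k 1)) (at r)" for r
      by (rule has_pd_line[OF has_pd_heat_sum])
    show "((\<lambda>r. hs (\<lambda>j. 1 * w j $ k) (0 + pi / 2) s (y + r *\<^sub>R axis k 1)) has_real_derivative
        hs (\<lambda>j. 1 * w j $ k * w j $ k) (0 + pi / 2 + pi / 2) s y) (at 0)"
      by (rule has_pdD[OF has_pd_heat_sum])
    show "hs (\<lambda>_. 1) 0 s (y + 0 *\<^sub>R axis k 1) \<le> hs (\<lambda>_. 1) 0 s (y + r *\<^sub>R axis k 1)" for r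
      using min[of s "y + r *\<^sub>R axis k 1"] s0 by (simp add: v_def)
  qed
  then have "0 \<le> hs (\<lambda>j. - 1 * (w j \<bullet> w j)) 0 s y"
    using heat_sum_laplacian[of "\<lambda>_. 1" 0 s y] sum_nonneg[of UNIV "\<lambda>k. hs (\<lambda>j. 1 * w j $ k * w j $ k) (0 + pi / 2 + pi / 2) s y"]
    by simp
  then have pos: "0 < hs (\<lambda>j. - 1 * (w j \<bullet> w j)) 0 s y + e" using e by simp
  have "((\<lambda>s. v s y) has_real_derivative hs (\<lambda>j. - 1 * (w j \<bullet> w j)) 0 s y + e) (at s)"
    unfolding v_def by (rule derivative_eq_intros heat_sum_time_derivative refl | simp)+
  from DERIV_pos_inc_left[OF this pos] obtain d where
    d: "0 < d" "\<And>h. 0 < h \<Longrightarrow> h < d \<Longrightarrow> v (s - h) y < v s y" by blast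
  define h where "h = min (d / 2) s"
  have "0 < h" "h < d" "s - h \<in> {0..t}" using d s0 by (auto simp: h_def)
  with d(2)[of h] min[of "s - h" y] show False by simp
qed

end

text \<open>The left-hand integrand is the change of \<open>ui^2 / u\<close> along
  \<open>u_t = ukk\<close>, the part of the heat equation in direction \<open>k\<close>. The
  function \<open>?F\<close> is the derivative of \<open>ui^2 / u\<close> in direction
  \<open>k\<close>, and its own derivative is \<open>?L + 2 * ?R\<close>; the bracket in
  \<open>?R\<close> is the mixed second derivative of \<open>ln u\<close>.\<close>

lemma fisher_pair_identity:
  assumes t: "tcont u" "tcont ui" "tcont uk" "tcont uik" "tcont ukk" "tcont uikk"
    and d: "has_pd k u uk" "has_pd k ui uik" "has_pd k uk ukk" "has_pd k uik uikk"
    and pos: "\<And>x. 0 < u x"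
  shows "(LINT x|torus. 2 * ui x * uikk x / u x - (ui x)\<^sup>2 * ukk x / (u x)\<^sup>2)
    = - 2 * (LINT x|torus. u x * (uik x / u x - ui x * uk x / (u x)\<^sup>2)\<^sup>2)"
proof -
  have nz: "u x \<noteq> 0" for x using pos[of x] by simp
  let ?L = "\<lambda>x. 2 * ui x * uikk x / u x - (ui x)\<^sup>2 * ukk x / (u x)\<^sup>2"
  let ?R = "\<lambda>x. u x * (uik x / u x - ui x * uk x / (u x)\<^sup>2)\<^sup>2"
  have tL: "tcont ?L" "tcont ?R"
    by (intro tcont_divide tcont_mult tcont_diff tcont_power tcont_const t; simp add: nz)+
  let ?F = "\<lambda>x. 2 * (ui x * uik x) / u x - ui x * ui x * uk x / (u x * u x)"
  have tF: "tcont ?F"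
    by (intro tcont_divide tcont_mult tcont_diff tcont_power tcont_const t; simp add: nz)
  have "has_pd k ?F (\<lambda>x. ?L x + 2 * ?R x)"
  proof (rule has_pd_cong)
    show "has_pd k ?F (\<lambda>x. (2 * (uik x * uik x + ui x * uikk x) * u x - 2 * (ui x * uik x) * uk x) / (u x)\<^sup>2
       - (((uik x * ui x + ui x * uik x) * uk x + ui x * ui x * ukk x) * (u x * u x) - ui x * ui x * uk x * (uk x * u x + u x * uk x)) / (u x * u x)\<^sup>2)"
      by (intro has_pd_diff has_pd_divide has_pd_cmult has_pd_mult d; simp add: nz)
    show "(2 * (uik x * uik x + ui x * uikk x) * u x - 2 * (ui x * uik x) * uk x) / (u x)\<^sup>2
       - (((uik x * ui x + ui x * uik x) * uk x + ui x * ui x * ukk x) * (u x * u x) - ui x * ui x * uk x * (uk x * u x + u x * uk x)) / (u x * u x)\<^sup>2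
       = ?L x + 2 * ?R x" for x
      using nz[of x] by (simp add: divide_simps) (simp add: algebra_simps eval_nat_numeral)
  qed
  moreover have "tcont (\<lambda>x. ?L x + 2 * ?R x)" by (intro tcont_add[OF tL(1)] tcont_mult[OF tcont_const tL(2)])
  ultimately have "(LINT x|torus. ?L x + 2 * ?R x) = 0"
    using integral_torus_pd[OF tF] by blast
  moreover have "(LINT x|torus. ?L x + 2 * ?R x) = (LINT x|torus. ?L x) + (LINT x|torus. 2 * ?R x)"
    by (rule Bochner_Integration.integral_add) (intro tcont_integrable tcont_mult tcont_const tL)+
  ultimately show ?thesis by simp
qed

lemma has_pd_unique: "has_pd i F F' \<Longrightarrow> has_pd i F G' \<Longrightarrow> F' = G'"
  unfolding has_pd_def using DERIV_unique by blast

lemma tcont_xlnx: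
  fixes h :: "real^'d \<Rightarrow> real"
  shows "tcont h \<Longrightarrow> (\<And>x. 0 < h x) \<Longrightarrow> tcont (\<lambda>x. h x * ln (h x))"
  by (intro tcont_mult tcont_ln) 

text \<open>Along the flow the entropy decreases at a speed equal to the total Fisher information,
  and the latter decays at rate \<open>8 pi^2\<close>. So the entropy minus
  \<open>1 / (8 pi^2)\<close> times the Fisher information, called \<open>\<Phi>\<close>, is
  nondecreasing. As time tends to infinity only the mean remains, whose entropy is the subtracted
  term.\<close>

lemma log_sobolev_heat_sum:
  fixes J :: "'q set" and c :: "'q \<Rightarrow> real" and w :: "'q \<Rightarrow> real^'d" and p :: "'q \<Rightarrow> real"
  assumes fr: "\<And>j. j \<in> J \<Longrightarrow> freq (w j)"
    and pos: "\<And>x. 0 < heat_sum J c w p (\<lambda>_. 1) 0 0 x"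
  defines "h \<equiv> heat_sum J c w p (\<lambda>_. 1) 0 0"
  shows "(LINT x|torus. h x * ln (h x)) - (LINT x|torus. h x) * ln (LINT x|torus. h x)
    \<le> 1 / (8 * pi\<^sup>2) * (\<Sum>i\<in>UNIV. LINT x|torus. (heat_sum J c w p (\<lambda>j. w j $ i) (pi / 2) 0 x)\<^sup>2 / h x)"
proof -
  define u where "u = heat_sum J c w p (\<lambda>_. 1) 0"
  define u1 where "u1 i = heat_sum J c w p (\<lambda>j. w j $ i) (pi / 2)" for i
  define u2 where "u2 i k = heat_sum J c w p (\<lambda>j. w j $ i * w j $ k) (pi / 2 + pi / 2)" for i k
  define u3 where "u3 i k = heat_sum J c w p (\<lambda>j. w j $ i * w j $ k * w j $ k) (pi / 2 + pi / 2 + pi / 2)" for i k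
  define v where "v t x = (\<Sum>k\<in>UNIV. u2 k k t x)" for t x
  define v1 where "v1 i t x = (\<Sum>k\<in>UNIV. u3 i k t x)" for i t x
  have tcs: "tcont (u t)" "tcont (u1 i t)" "tcont (u2 i k t)" "tcont (u3 i k t)" for t i k
    unfolding u_def u1_def u2_def u3_def by (rule tcont_heat_sum[OF fr]; simp)+
  have pd: "has_pd k (u t) (u1 k t)" "has_pd k (u1 i t) (u2 i k t)" "has_pd k (u2 i k t) (u3 i k t)" for t i k
    using has_pd_heat_sum[where J = J and w = w and c = c and p = p and k = k and a = "\<lambda>_. 1" and q = 0 and t = t, OF fr]
      has_pd_heat_sum[where J = J and w = w and c = c and p = p and k = k and a = "\<lambda>j. w j $ i" and q = "pi/2" and t = t, OF fr]
      has_pd_heat_sum[where J = J and w = w and c = c and p = p and k = k and a = "\<lambda>j. w j $ i * w j $ k" and q = "pi/2 + pi/2" and t = t, OF fr]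
    by (simp_all add: u_def u1_def u2_def u3_def)
  have vt: "((\<lambda>t. u t x) has_real_derivative v t x) (at t within S)" for x t S
    using heat_sum_time_derivative[where J = J and w = w and c = c and p = p and a = "\<lambda>_. 1" and q = 0 and t = t and x = x and S = S, OF fr]
      heat_sum_laplacian[where J = J and w = w and c = c and p = p and a = "\<lambda>_. 1" and q = 0 and t = t and x = x, OF fr]
    by (simp add: u_def v_def u2_def)
  have v1t: "((\<lambda>t. u1 i t x) has_real_derivative v1 i t x) (at t within S)" for x t S i
    using heat_sum_time_derivative[where J = J and w = w and c = c and p = p and a = "\<lambda>j. w j $ i" and q = "pi/2" and t = t and x = x and S = S, OF fr]
      heat_sum_laplacian[where J = J and w = w and c = c and p = p and a = "\<lambda>j. w j $ i" and q = "pi/2" and t = t and x = x, OF fr]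
    by (simp add: u1_def v1_def u3_def)
  have cc: "continuous_on S (\<lambda>(t, x). u t x)" "continuous_on S (\<lambda>(t, x). u1 i t x)"
      "continuous_on S (\<lambda>(t, x). u2 i k t x)" "continuous_on S (\<lambda>(t, x). u3 i k t x)" for S i k
    unfolding u_def u1_def u2_def u3_def by (rule continuous_heat_sum[OF fr]; simp)+
  have ccv: "continuous_on S (\<lambda>(t, x). v t x)" "continuous_on S (\<lambda>(t, x). v1 i t x)" for S i
    using cc unfolding v_def v1_def split_beta by (auto intro!: continuous_intros)
  obtain m where m: "0 < m" "\<And>x. m \<le> u 0 x"
    using tcont_pos_lower[OF tcs(1)[of 0]] pos unfolding u_def by metis
  have um: "m \<le> u t x" if "0 \<le> t" for t x
    unfolding u_def by (rule heat_sum_ge[OF fr]) (use m that u_def in auto)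
  have up: "0 < u t x" if "0 \<le> t" for t x using um[OF that, of x] m by linarith
  define \<Phi> where "\<Phi> t = (LINT x|torus. u t x * ln (u t x)) - 1 / (8 * pi\<^sup>2) * (\<Sum>i\<in>UNIV. LINT x|torus. (u1 i t x)\<^sup>2 / u t x)" for t
  define H' where "H' t = (LINT x|torus. v t x * (ln (u t x) + 1))" for t
  define I' where "I' i t = (LINT x|torus. 2 * u1 i t x * v1 i t x / u t x - (u1 i t x)\<^sup>2 * v t x / (u t x)\<^sup>2)" for i t
  have d1: "((\<lambda>t. LINT x|torus. u t x * ln (u t x)) has_real_derivative H' t) (at t within {0..})" if "0 \<le> t" for t
    unfolding H'_def
  proof (rule torus_leibniz)
    fix s :: real and x assume s: "s \<in> {0..}"
    show "((\<lambda>t. u t x * ln (u t x)) has_real_derivative v s x * (ln (u s x) + 1)) (at s within {0..})"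
      by (rule DERIV_cong[OF DERIV_mult[OF vt DERIV_chain2[where f = ln, OF DERIV_ln vt]]])
         (use up[of s x] s in \<open>auto simp: field_simps\<close>)
  next
    show "continuous_on UNIV (\<lambda>x. u s x * ln (u s x))" if "s \<in> {0..}" for s
      using tcont_continuous[OF tcont_xlnx[OF tcs(1) up]] that by auto
    show "continuous_on ({0..} \<times> UNIV) (\<lambda>(t, x). v t x * (ln (u t x) + 1))"
      using cc(1)[of "{0..} \<times> UNIV"] ccv(1)[of "{0..} \<times> UNIV"] up unfolding split_beta
      by (intro continuous_intros) (auto simp: less_imp_neq[symmetric])
  qed (use that in auto)
  have d2: "((\<lambda>t. LINT x|torus. (u1 i t x)\<^sup>2 / u t x) has_real_derivative I' i t) (at t within {0..})" if "0 \<le> t" for t i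
    unfolding I'_def
  proof (rule torus_leibniz)
    fix s :: real and x assume s: "s \<in> {0..}"
    show "((\<lambda>t. (u1 i t x)\<^sup>2 / u t x) has_real_derivative
        2 * u1 i s x * v1 i s x / u s x - (u1 i s x)\<^sup>2 * v s x / (u s x)\<^sup>2) (at s within {0..})"
      by (rule DERIV_cong[OF DERIV_divide[OF DERIV_power[OF v1t] vt]])
         (use up[of s x] s in \<open>auto simp: field_simps power2_eq_square\<close>)
  next
    show "continuous_on UNIV (\<lambda>x. (u1 i s x)\<^sup>2 / u s x)" if "s \<in> {0..}" for s
      using that up[of s] by (intro tcont_continuous tcont_divide tcont_power tcs) (auto simp: less_imp_neq[symmetric])
    show "continuous_on ({0..} \<times> UNIV) (\<lambda>(t, x). 2 * u1 i t x * v1 i t x / u t x - (u1 i t x)\<^sup>2 * v t x / (u t x)\<^sup>2)"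
      using cc(1,2)[of "{0..} \<times> UNIV"] ccv[of "{0..} \<times> UNIV"] up unfolding split_beta
      by (intro continuous_intros) (auto simp: less_imp_neq[symmetric])
  qed (use that in auto)
  have d\<Phi>: "(\<Phi> has_real_derivative (H' t - 1 / (8 * pi\<^sup>2) * (\<Sum>i\<in>UNIV. I' i t))) (at t within {0..})" if "0 \<le> t" for t
    unfolding \<Phi>_def[abs_def] by (intro DERIV_diff DERIV_cmult DERIV_sum d1 d2 that)
  have nonneg: "0 \<le> H' t - 1 / (8 * pi\<^sup>2) * (\<Sum>i\<in>UNIV. I' i t)" if t: "0 \<le> t" for t
  proof -
    have nz: "u t x \<noteq> 0" for x using up[OF t, of x] by simp
    have tln: "tcont (\<lambda>x. ln (u t x) + 1)" by (intro tcont_add tcont_ln tcont_const tcs up t)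
    have t1: "tcont (\<lambda>x. (u1 k t x)\<^sup>2 / u t x)" for k by (intro tcont_divide tcont_power tcs nz)
    have "H' t = (LINT x|torus. (\<Sum>k\<in>UNIV. (ln (u t x) + 1) * u2 k k t x))"
      unfolding H'_def v_def by (simp add: sum_distrib_left mult.commute)
    also have "\<dots> = (\<Sum>k\<in>UNIV. LINT x|torus. (ln (u t x) + 1) * u2 k k t x)"
      by (rule Bochner_Integration.integral_sum) (intro tcont_integrable tcont_mult tln tcs)
    also have "\<dots> = (\<Sum>k\<in>UNIV. - (LINT x|torus. (u1 k t x)\<^sup>2 / u t x))"
    proof (rule sum.cong[OF refl])
      fix k
      have "has_pd k (\<lambda>x. ln (u t x) + 1) (\<lambda>x. u1 k t x / u t x + 0)"
        by (intro has_pd_add has_pd_ln pd up t has_pd_const)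
      from integral_torus_by_parts[OF tln _ this tcs(2) tcs(3) pd(2)[of k k t]]
      have "(LINT x|torus. (ln (u t x) + 1) * u2 k k t x) = - (LINT x|torus. (u1 k t x / u t x + 0) * u1 k t x)"
        using tcont_divide[OF tcs(2) tcs(1) nz] by simp
      then show "(LINT x|torus. (ln (u t x) + 1) * u2 k k t x) = - (LINT x|torus. (u1 k t x)\<^sup>2 / u t x)"
        by (simp add: power2_eq_square)
    qed
    finally have H: "H' t = - (\<Sum>k\<in>UNIV. LINT x|torus. (u1 k t x)\<^sup>2 / u t x)" by (simp add: sum_negf)
    have I: "I' i t \<le> - (8 * pi\<^sup>2) * (LINT x|torus. (u1 i t x)\<^sup>2 / u t x)" for i
    proof -
      let ?Q = "\<lambda>k. LINT x|torus. u t x * (u2 i k t x / u t x - u1 i t x * u1 k t x / (u t x)\<^sup>2)\<^sup>2"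
      have "I' i t = (LINT x|torus. (\<Sum>k\<in>UNIV. 2 * u1 i t x * u3 i k t x / u t x - (u1 i t x)\<^sup>2 * u2 k k t x / (u t x)\<^sup>2))"
        unfolding I'_def v_def v1_def
        by (simp add: sum_subtractf sum_distrib_left sum_divide_distrib)
      also have "\<dots> = (\<Sum>k\<in>UNIV. LINT x|torus. 2 * u1 i t x * u3 i k t x / u t x - (u1 i t x)\<^sup>2 * u2 k k t x / (u t x)\<^sup>2)"
        by (rule Bochner_Integration.integral_sum)
           (intro tcont_integrable tcont_diff tcont_divide tcont_mult tcont_power tcont_const tcs; simp add: nz)
      also have "\<dots> = (\<Sum>k\<in>UNIV. - 2 * ?Q k)"
      proof (rule sum.cong[OF refl])
        fix k
        show "(LINT x|torus. 2 * u1 i t x * u3 i k t x / u t x - (u1 i t x)\<^sup>2 * u2 k k t x / (u t x)\<^sup>2) = - 2 * ?Q k"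
          by (rule fisher_pair_identity[where k = k]) (intro tcs pd up t)+
      qed
      \<comment> \<open>Only the pure second derivative, \<open>k = i\<close>, is kept; to it the
        one-dimensional estimate \<open>log_hessian_bound\<close> applies.\<close>
      also have "\<dots> \<le> (\<Sum>k\<in>{i}. - 2 * ?Q k)"
      proof -
        have "0 \<le> ?Q k" for k
          by (intro integral_nonneg_AE AE_I2 mult_nonneg_nonneg less_imp_le[OF up] t) simp
        then have "(\<Sum>k\<in>{i}. 2 * ?Q k) \<le> (\<Sum>k\<in>UNIV. 2 * ?Q k)"
          by (intro sum_mono2) auto
        then show ?thesis by (simp add: sum_negf)
      qed
      also have "\<dots> \<le> - (8 * pi\<^sup>2) * (LINT x|torus. (u1 i t x)\<^sup>2 / u t x)"
        using log_hessian_bound[OF tcs(1)[of t] tcs(2)[of i t] tcs(3)[of i i t] pd(1) pd(2) up[OF t]]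
        by (simp add: power2_eq_square[of "u1 i t _"])
      finally show ?thesis .
    qed
    have "1 / (8 * pi\<^sup>2) * (\<Sum>i\<in>UNIV. I' i t) \<le> 1 / (8 * pi\<^sup>2) * (\<Sum>i\<in>UNIV. - (8 * pi\<^sup>2) * (LINT x|torus. (u1 i t x)\<^sup>2 / u t x))"
      by (intro mult_left_mono sum_mono I) simp
    also have "\<dots> = - (\<Sum>i\<in>UNIV. LINT x|torus. (u1 i t x)\<^sup>2 / u t x)"
      by (simp add: sum_negf flip: sum_distrib_left)
    finally show ?thesis unfolding H by linarith
  qed
  have mono: "\<Phi> 0 \<le> \<Phi> t" if "0 \<le> t" for t
  proof (rule DERIV_nonneg_imp_increasing_open[of 0 t \<Phi>])
    show "continuous_on {0..t} \<Phi>"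
      using d\<Phi> by (intro continuous_on_subset[of "{0..}" \<Phi> "{0..t}"])
        (auto simp: continuous_on_eq_continuous_within intro: DERIV_continuous)
    fix s assume "0 < s" "s < t"
    then show "\<exists>y. (\<Phi> has_real_derivative y) (at s) \<and> 0 \<le> y"
      using d\<Phi>[of s] nonneg[of s] at_within_interior[of s "{0..}"] by (auto simp: interior_real_atLeast)
  qed (use that in auto)
  \<comment> \<open>The part of frequency zero, which is both the mean of \<open>u 0\<close> and the
    pointwise limit of \<open>u t\<close> at infinite time.\<close>
  define c0 where "c0 = (\<Sum>j\<in>J. if w j = 0 then c j * cos (p j) else 0)"
  have mean: "(LINT x|torus. u 0 x) = c0"
  proof -
    have "(LINT x|torus. u 0 x) = (\<Sum>j\<in>J. LINT x|torus. c j * wave (w j) (p j) x)"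
      unfolding u_def heat_sum_def
      by (subst Bochner_Integration.integral_sum) (auto intro!: tcont_integrable tcont_mult fr)
    also have "\<dots> = c0"
      unfolding c0_def
    proof (rule sum.cong[OF refl])
      fix j assume "j \<in> J"
      show "(LINT x|torus. c j * wave (w j) (p j) x) = (if w j = 0 then c j * cos (p j) else 0)"
        using integral_wave[OF fr[OF \<open>j \<in> J\<close>]] by (auto simp: wave_def)
    qed
    finally show ?thesis .
  qed
  have c0: "m \<le> c0"
  proof -
    have "(LINT x|(torus::(real^'d) measure). m) \<le> (LINT x|torus. u 0 x)"
      by (rule integral_mono) (auto intro!: tcont_integrable tcs m)
    then show ?thesis using mean by simp
  qed
  have lim: "(\<lambda>n. u (real n) x) \<longlonglongrightarrow> c0" for x
    unfolding u_def heat_sum_def c0_def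
  proof (rule tendsto_sum)
    fix j assume "j \<in> J"
    show "(\<lambda>n. c j * 1 * exp (- (w j \<bullet> w j) * real n) * wave (w j) (p j + 0) x) \<longlonglongrightarrow> (if w j = 0 then c j * cos (p j) else 0)"
    proof (cases "w j = 0")
      case False
      then have "exp (- (w j \<bullet> w j)) < 1" by simp
      then have "(\<lambda>n. exp (- (w j \<bullet> w j)) ^ n) \<longlonglongrightarrow> 0" by (intro LIMSEQ_realpow_zero) auto
      then have "(\<lambda>n. exp (- (w j \<bullet> w j) * real n)) \<longlonglongrightarrow> 0"
        by (simp add: exp_of_nat_mult[symmetric] mult.commute)
      from tendsto_mult[OF tendsto_mult[OF tendsto_const[of "c j * 1"] this] tendsto_const[of "wave (w j) (p j + 0) x"]] False
      show ?thesis by simp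
    qed (simp add: wave_def)
  qed
  define B where "B = (\<Sum>j\<in>J. \<bar>c j\<bar>)"
  have uB: "u (real n) x \<le> B" for n x
    unfolding u_def heat_sum_def B_def
  proof (rule sum_mono)
    fix j
    have "\<bar>c j * 1 * exp (- (w j \<bullet> w j) * real n) * wave (w j) (p j + 0) x\<bar> \<le> \<bar>c j\<bar> * 1 * 1"
      unfolding abs_mult by (intro mult_mono abs_wave_le) auto
    then show "c j * 1 * exp (- (w j \<bullet> w j) * real n) * wave (w j) (p j + 0) x \<le> \<bar>c j\<bar>" by simp
  qed
  have "(\<lambda>n. LINT x|torus. u (real n) x * ln (u (real n) x)) \<longlonglongrightarrow> (LINT x|(torus::(real^'d) measure). c0 * ln c0)"
  proof (rule integral_dominated_convergence[where w = "\<lambda>_. B * (\<bar>ln m\<bar> + \<bar>ln B\<bar>)"])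
    show "AE x in torus. (\<lambda>n. u (real n) x * ln (u (real n) x)) \<longlonglongrightarrow> c0 * ln c0"
      using c0 m by (intro AE_I2 tendsto_intros lim) auto
    show "AE x in torus. norm (u (real n) x * ln (u (real n) x)) \<le> B * (\<bar>ln m\<bar> + \<bar>ln B\<bar>)" for n
    proof (rule AE_I2)
      fix x
      have 1: "m \<le> u (real n) x" "u (real n) x \<le> B" using um[of "real n" x] uB by auto
      then have "ln m \<le> ln (u (real n) x)" "ln (u (real n) x) \<le> ln B" using m by auto
      then have "\<bar>ln (u (real n) x)\<bar> \<le> \<bar>ln m\<bar> + \<bar>ln B\<bar>" by linarith
      then show "norm (u (real n) x * ln (u (real n) x)) \<le> B * (\<bar>ln m\<bar> + \<bar>ln B\<bar>)"
        unfolding real_norm_def abs_mult using 1 m by (intro mult_mono) auto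
    qed
    show "(\<lambda>x. u (real n) x * ln (u (real n) x)) \<in> borel_measurable torus" for n
      by (intro measurable_torus tcont_measurable tcont_xlnx tcs up) simp
  qed auto
  then have limH: "(\<lambda>n. LINT x|torus. u (real n) x * ln (u (real n) x)) \<longlonglongrightarrow> c0 * ln c0" by simp
  \<comment> \<open>The Fisher information in \<open>\<Phi>\<close> enters with a negative sign and
    is dropped, so only the entropy has to be followed to the limit.\<close>
  have "\<Phi> 0 \<le> c0 * ln c0"
  proof (rule LIMSEQ_le_const[OF limH], intro exI allI impI)
    fix n :: nat
    have "0 \<le> (LINT x|torus. (u1 i (real n) x)\<^sup>2 / u (real n) x)" for i
      by (intro integral_nonneg_AE AE_I2 divide_nonneg_pos up) auto
    then have "0 \<le> 1 / (8 * pi\<^sup>2) * (\<Sum>i\<in>UNIV. LINT x|torus. (u1 i (real n) x)\<^sup>2 / u (real n) x)"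
      by (intro mult_nonneg_nonneg sum_nonneg) auto
    then show "\<Phi> 0 \<le> (LINT x|torus. u (real n) x * ln (u (real n) x))"
      using mono[of "real n"] unfolding \<Phi>_def by linarith
  qed
  then show ?thesis
    using mean unfolding \<Phi>_def h_def u_def u1_def by simp
qed

text \<open>With the variables separated, the mollification of any integrable function becomes a
  finite trigonometric sum whose coefficients are integrals of that function.\<close>

lemma mollifier_repr:
  obtains Q :: "(nat \<times> real) set" and m w p where "\<And>q. q \<in> Q \<Longrightarrow> freq (w q)"
    "\<And>x y. mollifier n (x - y :: real^'d) = (\<Sum>q\<in>Q. m q * (wave (w q) (p q) x * wave (w q) (p q) y))"
proof -
  obtain N :: nat and c and v :: "nat \<Rightarrow> real^'d" where
    v: "\<And>j. j < N \<Longrightarrow> freq (v j)" "\<And>x. mollifier n x = (\<Sum>j<N. c j * wave (v j) 0 x)"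
    using cospoly_repr[OF cospoly_mollifier] by metis
  show thesis
  \<comment> \<open>An index is a pair of a frequency number and a phase; the phases 0 and
    \<open>- pi / 2\<close> are the cosine and the sine part of \<open>wave_diff\<close>.\<close>
  proof (rule that[of "{..<N} \<times> {0, - pi / 2}" "\<lambda>q. v (fst q)" "\<lambda>q. c (fst q)" snd])
    fix x y :: "real^'d"
    have "mollifier n (x - y) = (\<Sum>j<N. c j * (wave (v j) 0 x * wave (v j) 0 y + wave (v j) (- pi / 2) x * wave (v j) (- pi / 2) y))"
      unfolding v(2) wave_diff by simp
    also have "\<dots> = (\<Sum>j<N. \<Sum>r\<in>{0, - pi / 2}. c j * (wave (v j) r x * wave (v j) r y))"
      by (simp add: distrib_left)
    also have "\<dots> = (\<Sum>q\<in>{..<N} \<times> {0, - pi / 2}. c (fst q) * (wave (v (fst q)) (snd q) x * wave (v (fst q)) (snd q) y))"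
      by (subst sum.cartesian_product) (simp add: split_beta)
    finally show "mollifier n (x - y) = (\<Sum>q\<in>{..<N} \<times> {0, - pi / 2}. c (fst q) * (wave (v (fst q)) (snd q) x * wave (v (fst q)) (snd q) y))" .
  qed (use v in auto)
qed

lemma conv_mollifier_repr:
  fixes w :: "'q \<Rightarrow> real^'d"
  assumes fr: "\<And>q. q \<in> Q \<Longrightarrow> freq (w q)"
    and repr: "\<And>x y. mollifier n (x - y) = (\<Sum>q\<in>Q. c q * (wave (w q) (p q) x * wave (w q) (p q) y))"
    and h: "integrable torus h"
  shows "torus_conv (mollifier n) h x = (\<Sum>q\<in>Q. c q * (LINT y|torus. h y * wave (w q) (p q) y) * wave (w q) (p q) x)"
proof -
  have he: "integrable torus (\<lambda>y. h y * wave (w q) (p q) y)" if "q \<in> Q" for q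
    using tcont_integrable_mult[OF tcont_wave[OF fr[OF that]] h] by simp
  have "torus_conv (mollifier n) h x = (LINT y|torus. (\<Sum>q\<in>Q. (c q * wave (w q) (p q) x) * (h y * wave (w q) (p q) y)))"
    unfolding torus_conv_real repr by (simp add: sum_distrib_left mult_ac)
  also have "\<dots> = (\<Sum>q\<in>Q. LINT y|torus. (c q * wave (w q) (p q) x) * (h y * wave (w q) (p q) y))"
    by (rule Bochner_Integration.integral_sum) (intro integrable_mult_right he)
  finally show ?thesis unfolding integral_mult_right_zero by (simp add: mult_ac)
qed

lemma conv_mollifier_pos:
  assumes "tcont (h :: real^'d \<Rightarrow> real)" "\<And>x. m \<le> h x"
  shows "m \<le> torus_conv (mollifier n) h x"
proof -
  have t: "tcont (\<lambda>y. mollifier n (x - y))" by (rule tcont_reflect[OF tcont_mollifier])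
  have "(LINT y|torus. m * mollifier n (x - y)) \<le> (LINT y|torus. h y * mollifier n (x - y))"
    by (rule integral_mono)
       (auto intro!: tcont_integrable tcont_mult assms t mult_right_mono less_imp_le[OF mollifier_pos])
  then show ?thesis by (simp add: torus_conv_real integral_mollifier_shift)
qed

text \<open>Mollification turns \<open>h\<close> into positive trigonometric sums, that is, into
  heat flows at time 0. They and their derivatives stay bounded and converge pointwise, and the
  lower bound \<open>m\<close> of \<open>h\<close> is kept, so every term passes to the limit by
  dominated convergence.\<close>

theorem log_sobolev_torus:
  fixes h :: "real^'d \<Rightarrow> real"
  assumes h: "tcont h" "\<And>i. tcont (h' i)" and d: "\<And>i. has_pd i h (h' i)" and pos: "\<And>x. 0 < h x"
  shows "(LINT x|torus. h x * ln (h x)) - (LINT x|torus. h x) * ln (LINT x|torus. h x)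
    \<le> 1 / (8 * pi\<^sup>2) * (\<Sum>i\<in>UNIV. LINT x|torus. (h' i x)\<^sup>2 / h x)"
proof -
  obtain m where m: "0 < m" "\<And>x. m \<le> h x" using tcont_pos_lower[OF h(1) pos] by blast
  obtain B where B: "0 < B" "\<And>x. norm (h x) \<le> B" using tcont_bounded[OF h(1)] by blast
  have "\<exists>B'. \<forall>x. norm (h' i x) \<le> B'" for i using tcont_bounded[OF h(2)] by metis
  then obtain B' where B': "\<And>i x. norm (h' i x) \<le> B' i" by metis
  define g where "g n = torus_conv (mollifier n) h" for n
  define g' where "g' i n = torus_conv (mollifier n) (h' i)" for i n
  have tg: "tcont (g n)" "tcont (g' i n)" for i n
    unfolding g_def g'_def by (intro tcont_conv tcont_mollifier tcont_integrable h)+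
  have gm: "m \<le> g n x" for n x unfolding g_def by (rule conv_mollifier_pos[OF h(1) m(2)])
  have gp: "0 < g n x" for n x using gm[of n x] m by linarith
  have dg: "has_pd i (g n) (g' i n)" for i n
  proof -
    have "has_pd i (torus_conv h (mollifier n)) (torus_conv (h' i) (mollifier n))"
      by (intro has_pd_conv h d tcont_integrable tcont_mollifier)
    then show ?thesis
      using conv_commute[OF h(1) tcont_mollifier] conv_commute[OF h(2) tcont_mollifier]
      by (simp add: g_def[abs_def] g'_def[abs_def] conv_commute[OF tcont_mollifier h(1), abs_def]
          conv_commute[OF tcont_mollifier h(2), abs_def])
  qed
  have lsi: "(LINT x|torus. g n x * ln (g n x)) - (LINT x|torus. g n x) * ln (LINT x|torus. g n x)
    \<le> 1 / (8 * pi\<^sup>2) * (\<Sum>i\<in>UNIV. LINT x|torus. (g' i n x)\<^sup>2 / g n x)" for n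
  proof -
    obtain Q :: "(nat \<times> real) set" and c p and w :: "nat \<times> real \<Rightarrow> real^'d" where
      Q: "\<And>q. q \<in> Q \<Longrightarrow> freq (w q)"
      "\<And>x y. mollifier n (x - y :: real^'d) = (\<Sum>q\<in>Q. c q * (wave (w q) (p q) x * wave (w q) (p q) y))"
      by (rule mollifier_repr[of n]) (rule that)
    define b where "b q = c q * (LINT y|torus. h y * wave (w q) (p q) y)" for q
    have "g n = heat_sum Q b w p (\<lambda>_. 1) 0 0"
      unfolding g_def b_def heat_sum_def fun_eq_iff
      using conv_mollifier_repr[OF Q(1) Q(2) tcont_integrable[OF h(1)]] by simp
    moreover have "has_pd i (heat_sum Q b w p (\<lambda>_. 1) 0 0) (heat_sum Q b w p (\<lambda>j. w j $ i) (pi / 2) 0)" for i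
      using has_pd_heat_sum[where J = Q and w = w and c = b and p = p and k = i and a = "\<lambda>_. 1" and q = 0 and t = 0, OF Q(1)] by simp
    \<comment> \<open>The mollified derivative and the termwise derivative of the sum are partial
      derivatives of the same function.\<close>
    ultimately have "g' i n = heat_sum Q b w p (\<lambda>j. w j $ i) (pi / 2) 0" for i
      using has_pd_unique dg by metis
    moreover have "0 < heat_sum Q b w p (\<lambda>_. 1) 0 0 x" for x
      using gp[of n x] \<open>g n = heat_sum Q b w p (\<lambda>_. 1) 0 0\<close> by simp
    ultimately show ?thesis
      using log_sobolev_heat_sum[where J = Q and w = w and c = b and p = p, OF Q(1)]
        \<open>g n = heat_sum Q b w p (\<lambda>_. 1) 0 0\<close> by simp
  qed
  have gB: "\<bar>g n x\<bar> \<le> B" "\<bar>g' i n x\<bar> \<le> B' i" for n x i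
  proof -
    have 1: "(LINT y|torus. \<bar>mollifier n (y::real^'d)\<bar>) = 1"
      using integral_mollifier[of n] by (simp add: abs_of_pos[OF mollifier_pos])
    have "\<bar>torus_conv F (mollifier n) x\<bar> \<le> K" if "tcont F" "\<And>z. \<bar>F z\<bar> \<le> K" for F :: "real^'d \<Rightarrow> real" and K
      using conv_bound[OF that(1) tcont_integrable[OF tcont_mollifier] that(2), of n x] 1 by simp
    then show "\<bar>g n x\<bar> \<le> B" "\<bar>g' i n x\<bar> \<le> B' i"
      using h B(2) B'[of i] by (simp_all add: g_def g'_def conv_commute[OF tcont_mollifier h(1)] conv_commute[OF tcont_mollifier h(2)])
  qed
  have lim: "(\<lambda>n. g n x) \<longlonglongrightarrow> h x" "(\<lambda>n. g' i n x) \<longlonglongrightarrow> h' i x" for x i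
    unfolding g_def g'_def by (intro conv_mollifier_tendsto h)+
  have L1: "(\<lambda>n. LINT x|torus. g n x * ln (g n x)) \<longlonglongrightarrow> (LINT x|torus. h x * ln (h x))"
  proof (rule integral_dominated_convergence[where w = "\<lambda>_. B * (\<bar>ln m\<bar> + \<bar>ln B\<bar>)"])
    show "AE x in torus. (\<lambda>n. g n x * ln (g n x)) \<longlonglongrightarrow> h x * ln (h x)"
      using pos by (intro AE_I2 tendsto_intros lim) (auto simp: less_imp_neq[symmetric])
    show "AE x in torus. norm (g n x * ln (g n x)) \<le> B * (\<bar>ln m\<bar> + \<bar>ln B\<bar>)" for n
    proof (rule AE_I2)
      fix x
      have 1: "m \<le> g n x" "g n x \<le> B" using gm[of n x] gB(1)[of n x] by auto
      then have "ln m \<le> ln (g n x)" "ln (g n x) \<le> ln B" using m by auto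
      then have "\<bar>ln (g n x)\<bar> \<le> \<bar>ln m\<bar> + \<bar>ln B\<bar>" by linarith
      then show "norm (g n x * ln (g n x)) \<le> B * (\<bar>ln m\<bar> + \<bar>ln B\<bar>)"
        unfolding real_norm_def abs_mult using 1 m by (intro mult_mono) auto
    qed
  qed (auto intro!: measurable_torus tcont_measurable tcont_xlnx tg gp h pos)
  have L2: "(\<lambda>n. LINT x|torus. g n x) \<longlonglongrightarrow> (LINT x|torus. h x)"
    by (rule integral_dominated_convergence[where w = "\<lambda>_. B"])
       (use gB(1) lim in \<open>auto intro!: measurable_torus tcont_measurable tg h\<close>)
  have L3: "(\<lambda>n. LINT x|torus. (g' i n x)\<^sup>2 / g n x) \<longlonglongrightarrow> (LINT x|torus. (h' i x)\<^sup>2 / h x)" for i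
  proof (rule integral_dominated_convergence[where w = "\<lambda>_. (B' i)\<^sup>2 / m"])
    show "AE x in torus. (\<lambda>n. (g' i n x)\<^sup>2 / g n x) \<longlonglongrightarrow> (h' i x)\<^sup>2 / h x"
      using pos by (intro AE_I2 tendsto_intros lim) (auto simp: less_imp_neq[symmetric])
    show "AE x in torus. norm ((g' i n x)\<^sup>2 / g n x) \<le> (B' i)\<^sup>2 / m" for n
    proof (rule AE_I2)
      fix x
      have "(g' i n x)\<^sup>2 \<le> (B' i)\<^sup>2" using gB(2) by (metis abs_ge_zero power2_abs power_mono)
      then have "(g' i n x)\<^sup>2 / g n x \<le> (B' i)\<^sup>2 / m"
        using gm[of n x] m by (intro frac_le) auto
      then show "norm ((g' i n x)\<^sup>2 / g n x) \<le> (B' i)\<^sup>2 / m" using gp[of n x] by simp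
    qed
  qed (auto intro!: measurable_torus tcont_measurable tcont_divide tcont_power tg h simp: less_imp_neq[OF gp, symmetric] less_imp_neq[OF pos, symmetric])
  have "0 < (LINT x|torus. h x)"
  proof -
    have "(LINT x|(torus::(real^'d) measure). m) \<le> (LINT x|torus. h x)"
      by (rule integral_mono) (auto intro!: tcont_integrable h m)
    then show ?thesis using m by simp
  qed
  then show ?thesis
    by (intro LIMSEQ_le[OF tendsto_diff[OF L1 tendsto_mult[OF L2 tendsto_ln[OF L2]]] tendsto_mult[OF tendsto_const tendsto_sum[OF L3]]])
       (use lsi in auto)
qed

subsection \<open>Functions of class \<open>C\<^sup>2\<close> and sup norms\<close>

lemma differentiable_has_pd:
  assumes "\<And>x. g differentiable (at x)"
  shows "has_pd i g (pderiv_dir i g)"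
  unfolding has_pd_def
proof
  fix x
  have D: "(g has_derivative frechet_derivative g (at (x + 0 *\<^sub>R axis i 1))) (at (x + 0 *\<^sub>R axis i 1))"
    using assms frechet_derivative_works by blast
  have "((\<lambda>s. x + s *\<^sub>R axis i 1) has_derivative (\<lambda>h. h *\<^sub>R axis i 1)) (at 0)"
    by (auto intro!: derivative_eq_intros)
  from has_derivative_compose[OF this D]
  have *: "((\<lambda>s. g (x + s *\<^sub>R axis i 1)) has_derivative (\<lambda>h. frechet_derivative g (at x) (h *\<^sub>R axis i 1))) (at 0)"
    by simp
  have "linear (frechet_derivative g (at x))" using D by (simp add: has_derivative_linear)
  then have "(\<lambda>h. frechet_derivative g (at x) (h *\<^sub>R axis i 1)) = (*) (pderiv_dir i g x)"
    by (auto simp: pderiv_dir_def linear_scale fun_eq_iff)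
  with * show "((\<lambda>s. g (x + s *\<^sub>R axis i 1)) has_real_derivative pderiv_dir i g x) (at 0)"
    by (simp add: has_field_derivative_def)
qed

lemma has_pd_periodic:
  assumes "has_pd i g g'" "lattice_periodic g"
  shows "lattice_periodic g'"
  unfolding lattice_periodic_def
proof (intro allI)
  fix x and k :: "int^'a"
  have "g (x + lattice_vec k + s *\<^sub>R axis i 1) = g (x + s *\<^sub>R axis i 1)" for s
  proof -
    have "x + lattice_vec k + s *\<^sub>R axis i 1 = (x + s *\<^sub>R axis i 1) + lattice_vec k" by simp
    then show ?thesis using assms(2) unfolding lattice_periodic_def by metis
  qed
  with has_pdD[OF assms(1), of "x + lattice_vec k"]
  have "((\<lambda>s. g (x + s *\<^sub>R axis i 1)) has_real_derivative g' (x + lattice_vec k)) (at 0)" by simp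
  then show "g' (x + lattice_vec k) = g' x"
    using has_pdD[OF assms(1)] DERIV_unique by blast
qed

lemma C2_torus_facts:
  assumes "C2_torus g"
  shows C2_tcont: "tcont g" and C2_tcont_pderiv: "tcont (pderiv_dir i g)"
    and C2_tcont_pderiv2: "tcont (pderiv_dir j (pderiv_dir i g))"
    and C2_has_pd: "has_pd i g (pderiv_dir i g)"
    and C2_has_pd2: "has_pd j (pderiv_dir i g) (pderiv_dir j (pderiv_dir i g))"
proof -
  note C = assms[unfolded C2_torus_def]
  show 1: "has_pd i g (pderiv_dir i g)" "has_pd j (pderiv_dir i g) (pderiv_dir j (pderiv_dir i g))" for i j
    using C by (auto intro: differentiable_has_pd)
  have c: "continuous_on UNIV f" if "\<And>x. f differentiable (at x)" for f :: "real^'a \<Rightarrow> real"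
    using that by (simp add: continuous_at_imp_continuous_on differentiable_imp_continuous_within)
  have p: "lattice_periodic g" using C by blast
  note p1 = has_pd_periodic[OF 1(1) p]
  show "tcont g" "tcont (pderiv_dir i g)" "tcont (pderiv_dir j (pderiv_dir i g))"
    using C p p1 has_pd_periodic[OF 1(2) p1] c unfolding tcont_def by auto
qed

lemma C2_tcont_grad: "C2_torus g \<Longrightarrow> tcont (grad g)"
  using C2_tcont_pderiv[of g] unfolding grad_def[abs_def] tcont_def lattice_periodic_def
  by (auto intro!: continuous_on_vec_lambda)

lemma C2_tcont_laplacian: "C2_torus g \<Longrightarrow> tcont (laplacian g)"
  unfolding laplacian_def[abs_def] by (intro tcont_sum C2_tcont_pderiv2)

text \<open>The set where the norm exceeds the essential supremum is open, so a single point of it,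
  moved into the cube, would give it positive measure. The two bounds on the essential supremum show
  that it is finite and \<open>real_of_ereal\<close> loses nothing.\<close>

lemma norm_le_Linf_norm:
  fixes F :: "real^'d \<Rightarrow> 'b::real_normed_vector"
  assumes F: "tcont F"
  shows "norm (F x) \<le> Linf_norm F"
proof -
  let ?g = "\<lambda>x. ereal (norm (F x))"
  obtain B where B: "\<And>x. norm (F x) \<le> B" using tcont_bounded[OF F] by metis
  have m: "?g \<in> borel_measurable torus"
    using tcont_measurable[OF tcont_norm[OF F]] by (intro measurable_torus borel_measurable_ereal)
  have "esssup torus ?g \<le> ereal B" using m B by (intro esssup_I) auto
  moreover have "0 \<le> esssup torus ?g"
  proof -
    have "esssup (torus::(real^'d) measure) (\<lambda>x. 0::ereal) \<le> esssup torus ?g"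
      by (rule esssup_mono) auto
    then show ?thesis by (simp add: esssup_const emeasure_torus_cbox)
  qed
  ultimately have e: "esssup torus ?g = ereal (Linf_norm F)"
    unfolding Linf_norm_def by (cases "esssup torus ?g") auto
  then have ae: "AE x in torus. norm (F x) \<le> Linf_norm F"
    using esssup_AE[of ?g torus] by simp
  show ?thesis
  proof (rule ccontr)
    assume less: "\<not> ?thesis"
    let ?O = "{x. Linf_norm F < norm (F x)}"
    have "open ?O"
      by (intro open_Collect_less continuous_intros tcont_continuous[OF F])
    moreover have "wrap x \<in> ?O"
      using less lattice_periodic_wrap[OF tcont_periodic[OF F]] by simp
    ultimately have p: "0 < measure torus (?O \<inter> cbox 0 1)"
      by (rule open_meets_torus) (rule wrap_in_cube)
    have "?O \<inter> cbox 0 1 \<in> sets torus"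
      using \<open>open ?O\<close> by (auto simp: torus_def sets_restrict_space)
    moreover have "AE x in torus. x \<notin> ?O \<inter> cbox 0 1" using ae by eventually_elim auto
    ultimately have "measure torus (?O \<inter> cbox 0 1) = 0"
      by (subst (asm) AE_iff_measurable[of "?O \<inter> cbox 0 1"]) (auto simp: measure_def)
    with p show False by simp
  qed
qed

lemma Linf_norm_nonneg: "tcont F \<Longrightarrow> 0 \<le> Linf_norm F"
  using norm_le_Linf_norm[of F 0] norm_ge_zero order_trans by blast

text \<open>The bound is taken for the vector-valued integral, which keeps the Euclidean norm;
  bounding the components one by one would introduce a factor depending on the dimension.\<close>

lemma norm_vec_conv_le:
  fixes K :: "real^'d \<Rightarrow> real^'d"
  assumes K: "tcont K" and f: "integrable torus f"
  shows "norm (\<chi> i. torus_conv (\<lambda>z. K z $ i) f x) \<le> Linf_norm K * (LINT y|torus. \<bar>f y\<bar>)"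
    and torus_conv_component: "torus_conv K f x $ i = torus_conv (\<lambda>z. K z $ i) f x"
proof -
  have int: "integrable torus (\<lambda>y. f y *\<^sub>R K (x - y))"
    by (rule tcont_integrable_mult[OF tcont_reflect[OF K] f])
  show comp: "torus_conv K f x $ i = torus_conv (\<lambda>z. K z $ i) f x" for i
    using integral_bounded_linear[OF bounded_linear_vec_nth int, of i] by (simp add: torus_conv_def)
  have "norm (torus_conv K f x) \<le> (LINT y|torus. norm (f y *\<^sub>R K (x - y)))"
    unfolding torus_conv_def by (rule integral_norm_bound)
  also have "\<dots> \<le> (LINT y|torus. Linf_norm K * \<bar>f y\<bar>)"
  proof (rule integral_mono[OF integrable_norm[OF int]])
    show "norm (f y *\<^sub>R K (x - y)) \<le> Linf_norm K * \<bar>f y\<bar>" for y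
      using mult_right_mono[OF norm_le_Linf_norm[OF K] abs_ge_zero, of "x - y" "f y"] by (simp add: mult.commute)
  qed (use f in simp)
  finally show "norm (\<chi> i. torus_conv (\<lambda>z. K z $ i) f x) \<le> Linf_norm K * (LINT y|torus. \<bar>f y\<bar>)"
    by (simp flip: comp)
qed

subsection \<open>The equilibrium density\<close>

lemma prob_density_integrable: "prob_density f \<Longrightarrow> integrable torus f"
  and prob_density_nonneg: "prob_density f \<Longrightarrow> 0 \<le> f x"
  and prob_density_integral: "prob_density f \<Longrightarrow> (LINT x|torus. f x) = 1"
  and prob_density_measurable: "prob_density f \<Longrightarrow> f \<in> borel_measurable borel"
  by (auto simp: prob_density_def)

lemma prob_density_abs: "prob_density f \<Longrightarrow> (LINT x|torus. \<bar>f x\<bar>) = 1"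
  by (simp add: prob_density_def)

locale equilibrium =
  fixes \<beta> :: real and V W finf :: "real^'d \<Rightarrow> real"
  assumes \<beta>: "0 < \<beta>" and V: "C2_torus V" and W: "C2_torus W"
    and invariant: "invariant_density \<beta> V W finf"
begin

definition U :: "real^'d \<Rightarrow> real" where "U x = V x + torus_conv W finf x"
definition dU :: "'d \<Rightarrow> real^'d \<Rightarrow> real" where
  "dU i x = pderiv_dir i V x + torus_conv (pderiv_dir i W) finf x"
definition Z :: real where "Z = (LINT x|torus. exp (- \<beta> * U x))"
definition \<mu> :: "real^'d \<Rightarrow> real" where "\<mu> x = exp (- \<beta> * U x) / Z"
definition osc :: real where "osc = Linf_norm V + Linf_norm W"
definition \<Gamma> :: real where "\<Gamma> = exp (2 * \<beta> * osc)"
definition K :: real where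
  "K = Linf_norm (laplacian W) + \<beta> * Linf_norm (grad W) * (Linf_norm (grad V) + Linf_norm (grad W))"

lemma prob_finf: "prob_density finf"
  using invariant by (simp add: invariant_density_def)

lemma tcont_U: "tcont U"
  unfolding U_def[abs_def]
  by (intro tcont_add tcont_conv C2_tcont V W prob_density_integrable prob_finf)

lemma tcont_dU: "tcont (dU i)"
  unfolding dU_def[abs_def]
  by (intro tcont_add tcont_conv C2_tcont_pderiv V W prob_density_integrable prob_finf)

lemma has_pd_U: "has_pd i U (dU i)"
  unfolding dU_def[abs_def] U_def[abs_def]
  by (intro has_pd_add has_pd_conv C2_has_pd C2_tcont C2_tcont_pderiv V W prob_density_integrable prob_finf)

lemma tcont_exp_U: "tcont (\<lambda>x. exp (- \<beta> * U x))"
  by (intro tcont_exp tcont_mult tcont_const tcont_U)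

lemma Z_pos: "0 < Z"
proof -
  obtain m where m: "0 < m" "\<And>x. m \<le> exp (- \<beta> * U x)"
    using tcont_pos_lower[OF tcont_exp_U] by auto
  have "(LINT x|(torus::(real^'d) measure). m) \<le> Z"
    unfolding Z_def by (rule integral_mono) (use m tcont_integrable[OF tcont_exp_U] in auto)
  then show ?thesis using m by simp
qed

lemma tcont_\<mu>: "tcont \<mu>"
  unfolding \<mu>_def[abs_def] by (intro tcont_divide tcont_exp_U tcont_const) (use Z_pos in simp)

lemma \<mu>_pos: "0 < \<mu> x"
  using Z_pos by (simp add: \<mu>_def)

lemma integral_\<mu>: "(LINT x|torus. \<mu> x) = 1"
  using Z_pos by (simp add: \<mu>_def Z_def)

lemma has_pd_\<mu>: "has_pd i \<mu> (\<lambda>x. - \<beta> * dU i x * \<mu> x)"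
proof -
  have "has_pd i (\<lambda>x. inverse Z * exp (- \<beta> * U x)) (\<lambda>x. inverse Z * (- \<beta> * dU i x * exp (- \<beta> * U x)))"
    by (intro has_pd_cmult has_pd_exp has_pd_U)
  moreover have "(\<lambda>x. inverse Z * exp (- \<beta> * U x)) = \<mu>"
    by (simp add: \<mu>_def fun_eq_iff divide_inverse)
  ultimately have "has_pd i \<mu> (\<lambda>x. inverse Z * (- \<beta> * dU i x * exp (- \<beta> * U x)))" by simp
  then show ?thesis
    by (rule has_pd_cong) (simp add: \<mu>_def divide_inverse)
qed

lemma AE_finf: "AE x in torus. finf x = \<mu> x"
  using invariant unfolding invariant_density_def \<mu>_def Z_def U_def by (simp add: Let_def)

lemma conv_finf:
  fixes F :: "real^'d \<Rightarrow> real"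
  assumes "tcont F" shows "torus_conv F finf x = torus_conv F \<mu> x"
  unfolding torus_conv_real
proof (rule integral_cong_AE)
  show "(\<lambda>y. finf y * F (x - y)) \<in> borel_measurable torus"
    using conv_integrable[OF assms prob_density_integrable[OF prob_finf], of x] by auto
  show "(\<lambda>y. \<mu> y * F (x - y)) \<in> borel_measurable torus"
    using conv_integrable[OF assms tcont_integrable[OF tcont_\<mu>], of x] by auto
  show "AE y in torus. finf y * F (x - y) = \<mu> y * F (x - y)" using AE_finf by eventually_elim simp
qed

lemma abs_U_le: "\<bar>U x\<bar> \<le> osc"
proof -
  have "\<bar>torus_conv W finf x\<bar> \<le> Linf_norm W * (LINT y|torus. \<bar>finf y\<bar>)"
    by (rule conv_bound) (use norm_le_Linf_norm[OF C2_tcont[OF W]] in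
        \<open>auto intro: C2_tcont W prob_density_integrable prob_finf\<close>)
  moreover have "\<bar>V x\<bar> \<le> Linf_norm V" using norm_le_Linf_norm[OF C2_tcont[OF V], of x] by simp
  ultimately show ?thesis using prob_density_abs[OF prob_finf] by (simp add: U_def osc_def)
qed

text \<open>This is the origin of \<open>\<Gamma>\<close>: it is the quotient of the two bounds,
  from which the normalization \<open>Z\<close> cancels.\<close>

lemma \<mu>_bounds: "exp (- \<beta> * osc) / Z \<le> \<mu> x" "\<mu> x \<le> exp (\<beta> * osc) / Z"
proof -
  have "U x \<le> osc" "- U x \<le> osc" using abs_U_le[of x] by auto
  then have "\<beta> * U x \<le> \<beta> * osc" "\<beta> * (- U x) \<le> \<beta> * osc"
    using \<beta> by (intro mult_left_mono; simp)+
  then have "- \<beta> * osc \<le> - \<beta> * U x" "- \<beta> * U x \<le> \<beta> * osc" by simp_all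
  then show "exp (- \<beta> * osc) / Z \<le> \<mu> x" "\<mu> x \<le> exp (\<beta> * osc) / Z"
    unfolding \<mu>_def using Z_pos by (auto intro!: divide_right_mono)
qed

lemma norm_dU_le: "norm (\<chi> i. dU i x) \<le> Linf_norm (grad V) + Linf_norm (grad W)"
proof -
  have "(\<chi> i. dU i x) = grad V x + (\<chi> i. torus_conv (\<lambda>z. grad W z $ i) finf x)"
    by (simp add: dU_def grad_def vec_eq_iff eta_contract_eq)
  also have "norm \<dots> \<le> norm (grad V x) + norm (\<chi> i. torus_conv (\<lambda>z. grad W z $ i) finf x)"
    by (rule norm_triangle_ineq)
  also have "\<dots> \<le> Linf_norm (grad V) + Linf_norm (grad W)"
    using norm_le_Linf_norm[OF C2_tcont_grad[OF V], of x]
      norm_vec_conv_le[OF C2_tcont_grad[OF W] prob_density_integrable[OF prob_finf], of x]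
    by (simp add: prob_density_abs[OF prob_finf])
  finally show ?thesis .
qed

lemma \<Gamma>_pos: "0 < \<Gamma>" by (simp add: \<Gamma>_def)

text \<open>Holley--Stroock perturbation: \<open>H(g|\<mu>)\<close> is the minimum over \<open>c\<close> of
  \<open>\<integral> (h ln (h / c) - h + c) d\<mu>\<close> with \<open>h = g / \<mu>\<close>.\<close>

lemma log_sobolev_\<mu>:
  assumes g: "tcont g" "\<And>i. tcont (g' i)" and d: "\<And>i. has_pd i g (g' i)"
    and pos: "\<And>x. 0 < g x" and one: "(LINT x|torus. g x) = 1"
  shows "8 * pi\<^sup>2 / \<Gamma> * (LINT x|torus. g x * ln (g x / \<mu> x)) \<le> (\<Sum>i\<in>UNIV. LINT x|torus. g x * (g' i x / g x + \<beta> * dU i x)\<^sup>2)"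
proof -
  have nz: "g x \<noteq> 0" "\<mu> x \<noteq> 0" for x using pos[of x] \<mu>_pos[of x] by auto
  define h where "h x = g x / \<mu> x" for x
  define l where "l i x = g' i x / g x + \<beta> * dU i x" for i x
  have hp: "0 < h x" for x using pos \<mu>_pos by (simp add: h_def)
  have th: "tcont h" unfolding h_def[abs_def] by (intro tcont_divide g tcont_\<mu> nz)
  have tl: "tcont (l i)" for i unfolding l_def[abs_def] by (intro tcont_add tcont_mult tcont_const tcont_divide g tcont_dU nz)
  have dh: "has_pd i h (\<lambda>x. h x * l i x)" for i
    unfolding h_def[abs_def]
  proof (rule has_pd_cong[OF has_pd_divide[OF d has_pd_\<mu> nz(2)]])
    fix x show "(g' i x * \<mu> x - g x * (- \<beta> * dU i x * \<mu> x)) / (\<mu> x)\<^sup>2 = g x / \<mu> x * l i x"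
      using nz[of x] by (simp add: l_def divide_simps power2_eq_square) (simp add: algebra_simps)
  qed
  \<comment> \<open>The mean of \<open>h\<close> under the uniform density. For this
    \<open>c\<close> the integral of \<open>\<phi>\<close> is the uniform entropy of
    \<open>h\<close>, while its integral against \<open>\<mu>\<close> exceeds the relative entropy
    of \<open>g\<close> by \<open>c - 1 - ln c\<close>, which is nonnegative.\<close>
  define c where "c = (LINT x|torus. h x)"
  define \<phi> where "\<phi> x = h x * ln (h x) - h x * ln c - h x + c" for x
  have c: "0 < c"
  proof -
    obtain m where m: "0 < m" "\<And>x. m \<le> h x" using tcont_pos_lower[OF th hp] by blast
    have "(LINT x|(torus::(real^'d) measure). m) \<le> c"
      unfolding c_def by (rule integral_mono) (use m tcont_integrable[OF th] in auto)
    then show ?thesis using m by simp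
  qed
  have tx: "tcont (\<lambda>x. h x * ln (h x))" by (rule tcont_xlnx[OF th hp])
  have t\<phi>: "tcont \<phi>" unfolding \<phi>_def[abs_def] by (intro tcont_add tcont_diff tcont_mult tcont_const th tcont_ln hp)
  have \<phi>0: "0 \<le> \<phi> x" for x
  proof -
    have "ln (c / h x) \<le> c / h x - 1" using c hp by (intro ln_le_minus_one) simp
    then have "h x * ln (c / h x) \<le> h x * (c / h x - 1)" using hp by (intro mult_left_mono) (auto intro: less_imp_le)
    then show ?thesis using hp[of x] c unfolding \<phi>_def by (simp add: ln_div algebra_simps)
  qed
  have S: "(LINT x|torus. \<phi> x) = (LINT x|torus. h x * ln (h x)) - c * ln c"
    using tx th by (simp add: \<phi>_def tcont_integrable c_def)
  have "(LINT x|torus. g x * ln (g x / \<mu> x)) \<le> (LINT x|torus. \<mu> x * \<phi> x)"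
  proof -
    have "(LINT x|torus. \<mu> x * \<phi> x) = (LINT x|torus. (g x * ln (g x / \<mu> x) - (1 + ln c) * g x) + c * \<mu> x)"
    proof (rule Bochner_Integration.integral_cong[OF refl])
      fix x show "\<mu> x * \<phi> x = (g x * ln (g x / \<mu> x) - (1 + ln c) * g x) + c * \<mu> x"
        using nz[of x] unfolding \<phi>_def h_def by (simp add: algebra_simps)
    qed
    also have "\<dots> = (LINT x|torus. g x * ln (g x / \<mu> x)) - (1 + ln c) * 1 + c * 1"
    proof -
      have "tcont (\<lambda>x. g x * ln (g x / \<mu> x))"
        using g hp th unfolding h_def by (intro tcont_mult tcont_ln) auto
      then show ?thesis using g tcont_\<mu> by (simp add: tcont_integrable one integral_\<mu>)
    qed
    finally have "(LINT x|torus. \<mu> x * \<phi> x) = (LINT x|torus. g x * ln (g x / \<mu> x)) + (c - 1 - ln c)" by simp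
    then show ?thesis using ln_le_minus_one[OF c] by simp
  qed
  also have "\<dots> \<le> (LINT x|torus. exp (\<beta> * osc) / Z * \<phi> x)"
  proof (rule integral_mono)
    show "\<mu> x * \<phi> x \<le> exp (\<beta> * osc) / Z * \<phi> x" for x
      by (rule mult_right_mono[OF \<mu>_bounds(2) \<phi>0])
  qed (intro tcont_integrable tcont_mult tcont_\<mu> t\<phi> tcont_const)+
  also have "\<dots> = exp (\<beta> * osc) / Z * ((LINT x|torus. h x * ln (h x)) - c * ln c)"
    using S by simp
  also have "\<dots> \<le> exp (\<beta> * osc) / Z * (1 / (8 * pi\<^sup>2) * (\<Sum>i\<in>UNIV. LINT x|torus. (h x * l i x)\<^sup>2 / h x))"
    unfolding c_def using Z_pos
    by (intro mult_left_mono log_sobolev_torus th tcont_mult tl dh hp) simp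
  \<comment> \<open>Back from the uniform density to \<open>g\<close>: the integrand
    \<open>(h l)^2 / h\<close> equals \<open>g l^2 / \<mu>\<close>. The lower bound of
    \<open>\<mu>\<close> used here and the upper bound used before combine to
    \<open>\<Gamma>\<close>.\<close>
  also have "\<dots> \<le> exp (\<beta> * osc) / Z * (1 / (8 * pi\<^sup>2) * (\<Sum>i\<in>UNIV. Z / exp (- \<beta> * osc) * (LINT x|torus. g x * (l i x)\<^sup>2)))"
  proof (intro mult_left_mono sum_mono)
    fix i
    have "(LINT x|torus. (h x * l i x)\<^sup>2 / h x) \<le> (LINT x|torus. Z / exp (- \<beta> * osc) * (g x * (l i x)\<^sup>2))"
    proof (rule integral_mono)
      fix x
      have "(h x * l i x)\<^sup>2 / h x = 1 / \<mu> x * (g x * (l i x)\<^sup>2)"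
        using hp[of x] nz[of x] by (simp add: power_mult_distrib power2_eq_square h_def)
      also have "\<dots> \<le> 1 / (exp (- \<beta> * osc) / Z) * (g x * (l i x)\<^sup>2)"
        using \<mu>_bounds(1)[of x] Z_pos pos[of x]
        by (intro mult_right_mono divide_left_mono mult_pos_pos \<mu>_pos) auto
      finally show "(h x * l i x)\<^sup>2 / h x \<le> Z / exp (- \<beta> * osc) * (g x * (l i x)\<^sup>2)" by simp
    qed (intro tcont_integrable tcont_divide tcont_power tcont_mult tcont_const th tl g less_imp_neq[OF hp, symmetric])+
    then show "(LINT x|torus. (h x * l i x)\<^sup>2 / h x) \<le> Z / exp (- \<beta> * osc) * (LINT x|torus. g x * (l i x)\<^sup>2)"
      by simp
  qed (use Z_pos in auto)
  also have "\<dots> = \<Gamma> / (8 * pi\<^sup>2) * (\<Sum>i\<in>UNIV. LINT x|torus. g x * (l i x)\<^sup>2)"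
  proof -
    have "\<Gamma> = exp (\<beta> * osc) * exp (\<beta> * osc)" by (simp add: \<Gamma>_def flip: exp_add)
    then show ?thesis using Z_pos by (simp add: exp_minus field_simps flip: sum_distrib_left)
  qed
  finally show ?thesis
    unfolding l_def using \<Gamma>_pos by (simp add: field_simps)
qed

end

text \<open>A pointwise comparison with the Hellinger distance, for Pinsker's inequality.\<close>

lemma sq_diff_sqrt_le:
  assumes "0 < a" "0 < (b::real)"
  shows "(sqrt a - sqrt b)\<^sup>2 \<le> a * ln (a / b) - a + b"
proof -
  define r where "r = sqrt b / sqrt a"
  have r: "0 < r" using assms by (simp add: r_def)
  have "ln (b / a) = 2 * ln r"
    using assms by (simp add: r_def ln_div ln_sqrt)
  then have "ln (a / b) = - 2 * ln r" using assms by (simp add: ln_div)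
  moreover have "a * ln r \<le> a * (r - 1)"
    using ln_le_minus_one[OF r] assms by (intro mult_left_mono) auto
  moreover have "a * r = sqrt a * sqrt b"
    using assms by (simp add: r_def real_div_sqrt field_simps)
  moreover have "(sqrt a - sqrt b)\<^sup>2 = a - 2 * (sqrt a * sqrt b) + b"
    using assms by (simp add: power2_diff)
  ultimately show ?thesis by (simp add: algebra_simps)
qed

lemma young_product:
  assumes s: "0 < (s::real)"
  shows "2 * (p * q) \<le> s * p\<^sup>2 + q\<^sup>2 / s"
proof -
  have "0 \<le> (s * p - q)\<^sup>2 / s" using s by simp
  also have "\<dots> = s * p\<^sup>2 - 2 * (p * q) + q\<^sup>2 / s"
    using s by (simp add: field_simps power2_eq_square)
  finally show ?thesis by simp
qed

text \<open>The difference factors as \<open>(sqrt g - sqrt \<nu>) * (sqrt g + sqrt \<nu>)\<close>.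
  The square of the first factor has integral at most the entropy, that of the second at most 4. The
  constant 4 is twice the optimal one and within the factor 8 before \<open>K\<close> in the decay
  rate.\<close>

lemma pinsker_weak:
  fixes g \<nu> :: "real^'d \<Rightarrow> real"
  assumes t: "tcont g" "tcont \<nu>" and pos: "\<And>x. 0 < g x" "\<And>x. 0 < \<nu> x"
    and one: "(LINT x|torus. g x) = 1" "(LINT x|torus. \<nu> x) = 1"
  shows "0 \<le> (LINT x|torus. g x * ln (g x / \<nu> x))"
    and "(LINT x|torus. \<bar>g x - \<nu> x\<bar>)\<^sup>2 \<le> 4 * (LINT x|torus. g x * ln (g x / \<nu> x))"
proof -
  let ?H = "LINT x|torus. g x * ln (g x / \<nu> x)"
  define X where "X = (LINT x|torus. (sqrt (g x) - sqrt (\<nu> x))\<^sup>2)"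
  have tl: "tcont (\<lambda>x. g x * ln (g x / \<nu> x))"
    using pos by (intro tcont_mult tcont_ln tcont_divide t) (auto simp: less_imp_neq[symmetric])
  have X0: "0 \<le> X" unfolding X_def by simp
  have "X \<le> (LINT x|torus. (g x * ln (g x / \<nu> x) - g x) + \<nu> x)"
    unfolding X_def
    by (rule integral_mono) (auto intro!: tcont_integrable tcont_add tcont_diff tcont_sqrt tcont_power t tl sq_diff_sqrt_le pos)
  also have "\<dots> = ?H" using tl t one by (simp add: tcont_integrable)
  finally have XH: "X \<le> ?H" .
  with X0 show "0 \<le> ?H" by linarith
  define D where "D = (LINT x|torus. \<bar>g x - \<nu> x\<bar>)"
  \<comment> \<open>The Cauchy-Schwarz inequality with a free parameter \<open>s\<close>, obtained
    from a pointwise estimate.\<close>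
  have D: "2 * D \<le> s * X + 4 / s" if s: "0 < s" for s
  proof -
    have "(LINT x|torus. 2 * \<bar>g x - \<nu> x\<bar>) \<le> (LINT x|torus. s * (sqrt (g x) - sqrt (\<nu> x))\<^sup>2 + 2 / s * (g x + \<nu> x))"
    proof (rule integral_mono)
      fix x
      let ?a = "sqrt (g x) - sqrt (\<nu> x)" and ?b = "sqrt (g x) + sqrt (\<nu> x)"
      have "g x - \<nu> x = ?a * ?b" using pos[of x] by (simp add: algebra_simps less_imp_le)
      then have "2 * \<bar>g x - \<nu> x\<bar> = 2 * (\<bar>?a\<bar> * \<bar>?b\<bar>)" by (simp add: abs_mult)
      also have "\<dots> \<le> s * ?a\<^sup>2 + ?b\<^sup>2 / s"
        using young_product[OF s, of "\<bar>?a\<bar>" "\<bar>?b\<bar>"] by simp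
      also have "?b\<^sup>2 \<le> 2 * (g x + \<nu> x)"
      proof -
        have "?b\<^sup>2 = 2 * ((sqrt (g x))\<^sup>2 + (sqrt (\<nu> x))\<^sup>2) - ?a\<^sup>2" by (simp add: power2_eq_square algebra_simps)
        then show ?thesis using pos[of x] by (simp add: less_imp_le)
      qed
      finally show "2 * \<bar>g x - \<nu> x\<bar> \<le> s * ?a\<^sup>2 + 2 / s * (g x + \<nu> x)"
        using s by (simp add: divide_right_mono)
    qed (intro tcont_integrable tcont_mult tcont_const tcont_abs tcont_add tcont_diff tcont_power tcont_sqrt t)+
    also have "\<dots> = s * X + 2 / s * (1 + 1)"
    proof -
      have "integrable torus (\<lambda>x. (sqrt (g x) - sqrt (\<nu> x))\<^sup>2)"
        by (intro tcont_integrable tcont_diff tcont_power tcont_sqrt t)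
      then show ?thesis using t one unfolding X_def by (simp add: tcont_integrable)
    qed
    finally show ?thesis by (simp add: D_def)
  qed
  have D0: "0 \<le> D" unfolding D_def by simp
  have "D\<^sup>2 \<le> 4 * X"
  proof (cases "D = 0")
    case False
    with D0 have "0 < D" by simp
    \<comment> \<open>The choice that makes \<open>4 / s\<close> equal to \<open>D\<close>.\<close>
    from D[of "4 / D"] this have "D\<^sup>2 \<le> 4 * X" by (simp add: field_simps power2_eq_square)
    then show ?thesis .
  qed (use X0 in simp)
  with XH show "(LINT x|torus. \<bar>g x - \<nu> x\<bar>)\<^sup>2 \<le> 4 * ?H" by (simp add: D_def)
qed

subsection \<open>Dissipation of the mollified entropy\<close>

text \<open>The kernel has a positive minimum, so unit mass makes the mollified density positive
  even where \<open>f\<close> vanishes; its logarithm is then continuous.\<close>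

lemma prob_density_conv_mollifier:
  assumes f: "prob_density f"
  shows "tcont (torus_conv (mollifier n) f)" and "0 < torus_conv (mollifier n) f x"
    and "(LINT x|torus. torus_conv (mollifier n) f x) = 1"
proof -
  note i = prob_density_integrable[OF f]
  show "tcont (torus_conv (mollifier n) f)" by (rule tcont_conv[OF tcont_mollifier i])
  obtain m where m: "0 < m" "\<And>z::real^'a. m \<le> mollifier n z" using tcont_pos_lower[OF tcont_mollifier mollifier_pos] by blast
  have "(LINT y|torus. f y * m) \<le> (LINT y|torus. f y * mollifier n (x - y))"
    by (rule integral_mono) (auto intro!: conv_integrable tcont_mollifier i mult_left_mono m prob_density_nonneg[OF f] integrable_mult_left)
  then show "0 < torus_conv (mollifier n) f x" using m prob_density_integral[OF f] by (simp add: torus_conv_real)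
  obtain B where B: "\<And>z::real^'a. norm (mollifier n z) \<le> B" using tcont_bounded[OF tcont_mollifier] by metis
  have "(LINT x|torus. torus_conv (mollifier n) f x) = (LINT y|torus. f y * (LINT x|torus. mollifier n (x - y)))"
    unfolding torus_conv_real
    by (rule torus_fubini(1)[OF measurable_pair_diff[OF tcont_mollifier] _ i, of n B]) (use B in simp)
  also have "\<dots> = 1"
    using prob_density_integral[OF f]
    by (simp add: integral_torus_diff[OF tcont_measurable[OF tcont_mollifier] tcont_periodic[OF tcont_mollifier]] integral_mollifier)
  finally show "(LINT x|torus. torus_conv (mollifier n) f x) = 1" .
qed

context equilibrium
begin

definition force :: "(real^'d \<Rightarrow> real) \<Rightarrow> 'd \<Rightarrow> real^'d \<Rightarrow> real" where
  "force f i x = pderiv_dir i V x + torus_conv (pderiv_dir i W) f x"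

lemma tcont_force: "integrable torus f \<Longrightarrow> tcont (force f i)"
  unfolding force_def[abs_def] by (intro tcont_add tcont_conv C2_tcont_pderiv V W)

text \<open>With \<open>\<rho>\<close> the mollifier and \<open>b\<close> the force, this bounds \<open>\<integral> |\<rho> * (b f) - b (\<rho> * f)|\<^sup>2 / (\<rho> * f)\<close>.\<close>

definition commutator_error :: "nat \<Rightarrow> (real^'d \<Rightarrow> real) \<Rightarrow> 'd \<Rightarrow> real" where
  "commutator_error n f i = (LINT x|torus. LINT y|torus.
     f y * (mollifier n (x - y) * (force f i y - force (torus_conv (mollifier n) f) i x)\<^sup>2))"

lemma mollified_force_measurable:
  assumes "integrable torus f" "integrable torus g"
  shows "(\<lambda>(x, y). mollifier n (x - y) * (force f i y - force g i x)\<^sup>2) \<in> borel_measurable (borel \<Otimes>\<^sub>M borel)"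
  using tcont_measurable[OF tcont_force[OF assms(1), of i]] tcont_measurable[OF tcont_force[OF assms(2), of i]]
    tcont_measurable[OF tcont_mollifier, of n] by measurable

lemma mollified_force_bounded:
  assumes "integrable torus f" "integrable torus g"
  obtains B where "\<And>x y. \<bar>mollifier n (x - y) * (force f i y - force g i x)\<^sup>2\<bar> \<le> B"
proof -
  obtain A where A: "0 < A" "\<And>z::real^'d. norm (mollifier n z) \<le> A" using tcont_bounded[OF tcont_mollifier] by metis
  obtain B where B: "0 < B" "\<And>z. norm (force f i z) \<le> B" using tcont_bounded[OF tcont_force[OF assms(1)]] by metis
  obtain C where C: "0 < C" "\<And>z. norm (force g i z) \<le> C" using tcont_bounded[OF tcont_force[OF assms(2)]] by metis
  have "\<bar>mollifier n (x - y) * (force f i y - force g i x)\<^sup>2\<bar> \<le> A * (B + C)\<^sup>2" for x y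
  proof -
    have "\<bar>force f i y - force g i x\<bar> \<le> B + C" using B(2)[of y] C(2)[of x] by simp
    then have "\<bar>force f i y - force g i x\<bar>\<^sup>2 \<le> (B + C)\<^sup>2" by (intro power_mono) auto
    then show ?thesis unfolding abs_mult using A by (intro mult_mono) auto
  qed
  with that show thesis by blast
qed

text \<open>Uniformity in \<open>f\<close> holds because \<open>f\<close> enters the force only
  through a convolution and has mass 1, so the bound and the modulus of continuity of the force
  depend on \<open>V\<close> and \<open>W\<close> alone. The squared difference of the forces is at
  most \<open>M\<close> times its absolute value, which \<open>sep\<close> controls; integrating out
  \<open>f\<close> leaves a mean of \<open>sep\<close> under the kernel.\<close>

lemma commutator_error_tendsto:
  assumes \<kappa>: "0 < \<kappa>"
  shows "\<forall>\<^sub>F n in sequentially. \<forall>f. prob_density f \<longrightarrow> commutator_error n f i \<le> \<kappa>"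
proof -
  define v where "v = pderiv_dir i V"
  define k where "k = pderiv_dir i W"
  have tv: "tcont v" and tk: "tcont k" unfolding v_def k_def by (intro C2_tcont_pderiv V W)+
  obtain Bv where Bv: "0 < Bv" "\<And>x. norm (v x) \<le> Bv" using tcont_bounded[OF tv] by metis
  obtain Bk where Bk: "0 < Bk" "\<And>x. norm (k x) \<le> Bk" using tcont_bounded[OF tk] by metis
  \<comment> \<open>Each force is at most \<open>Bv + Bk\<close> in absolute value, so
    \<open>M\<close> bounds the difference of two.\<close>
  define M where "M = 2 * (Bv + Bk)"
  have M: "0 < M" using Bv Bk by (simp add: M_def)
  \<comment> \<open>Three tolerances add up: for \<open>v\<close>, for \<open>k\<close>, and for the
    mollified \<open>k\<close>. Then \<open>3 * \<eta> * M = \<kappa> / 2\<close>, and the other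
    half is left for the terms with \<open>sep\<close>.\<close>
  define \<eta> where "\<eta> = \<kappa> / (6 * M)"
  have \<eta>: "0 < \<eta>" using M \<kappa> by (simp add: \<eta>_def)
  obtain C1 where C1: "0 \<le> C1" "\<And>x y. \<bar>v x - v y\<bar> \<le> \<eta> + C1 * sep (x - y)" using korovkin[OF tv \<eta>] by metis
  obtain C2 where C2: "0 \<le> C2" "\<And>x y. \<bar>k x - k y\<bar> \<le> \<eta> + C2 * sep (x - y)" using korovkin[OF tk \<eta>] by metis
  define s where "s n = (LINT z|torus. mollifier n z * sep (z::real^'d))" for n
  have "(\<lambda>n. M * (C1 + 2 * C2) * s n) \<longlonglongrightarrow> M * (C1 + 2 * C2) * 0"
    unfolding s_def by (intro tendsto_mult tendsto_const mollifier_concentration)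
  then have "\<forall>\<^sub>F n in sequentially. M * (C1 + 2 * C2) * s n < \<kappa> / 2"
    using \<kappa> by (intro order_tendstoD(2)[of _ 0]) auto
  then show ?thesis
  proof eventually_elim
    case (elim n)
    show ?case
    proof (intro allI impI)
      fix f :: "real^'d \<Rightarrow> real" assume f: "prob_density f"
      define g where "g = torus_conv (mollifier n) f"
      note fi = prob_density_integrable[OF f]
      have g: "tcont g" "\<And>x. 0 < g x" "(LINT x|torus. g x) = 1"
        using prob_density_conv_mollifier[OF f] by (auto simp: g_def)
      have gabs: "(LINT x|torus. \<bar>g x\<bar>) = 1" using g by (simp add: abs_of_pos)
      have bd: "\<bar>force h i x\<bar> \<le> Bv + Bk" if "integrable torus h" "(LINT x|torus. \<bar>h x\<bar>) = 1" for h x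
        using conv_bound[OF tk that(1), of Bk x] that(2) Bk(2) Bv(2)[of x] unfolding force_def v_def[symmetric] k_def[symmetric] by simp
      have e: "\<bar>force f i y - force g i x\<bar> \<le> 3 * \<eta> + (C1 + C2) * sep (x - y) + C2 * s n" for x y
      proof -
        \<comment> \<open>The mollifier moves from \<open>f\<close> to the continuous kernel
          \<open>k\<close>, so that no regularity of \<open>f\<close> is called upon.\<close>
        have "torus_conv k g x = torus_conv (torus_conv (mollifier n) k) f x"
          unfolding g_def by (rule conv_assoc[OF tk tcont_mollifier fi])
        then have "torus_conv k f y - torus_conv k g x = (LINT z|torus. f z * (k (y - z) - torus_conv (mollifier n) k (x - z)))"
          using conv_integrable[OF tk fi, of y] conv_integrable[OF tcont_conv[OF tcont_mollifier tcont_integrable[OF tk]] fi, of n x]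
          by (simp add: torus_conv_real[of k f] torus_conv_real[of "torus_conv (mollifier n) k" f] right_diff_distrib)
        also have "\<bar>\<dots>\<bar> \<le> (LINT z|torus. \<bar>f z * (k (y - z) - torus_conv (mollifier n) k (x - z))\<bar>)"
          by (rule integral_abs_bound)
        also have "\<dots> \<le> (LINT z|torus. f z * (2 * \<eta> + C2 * sep (x - y) + C2 * s n))"
        proof (rule integral_mono)
          fix z
          have "\<bar>k (y - z) - k (x - z)\<bar> \<le> \<eta> + C2 * sep (x - y)"
            using C2(2)[of "y - z" "x - z"] by (simp add: sep_commute[of x y])
          moreover have "\<bar>torus_conv (mollifier n) k (x - z) - k (x - z)\<bar> \<le> \<eta> + C2 * s n"
            unfolding s_def by (rule conv_mollifier_approx[OF tk C2(2)])
          ultimately have "\<bar>k (y - z) - torus_conv (mollifier n) k (x - z)\<bar> \<le> 2 * \<eta> + C2 * sep (x - y) + C2 * s n"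
            by linarith
          then show "\<bar>f z * (k (y - z) - torus_conv (mollifier n) k (x - z))\<bar> \<le> f z * (2 * \<eta> + C2 * sep (x - y) + C2 * s n)"
            using prob_density_nonneg[OF f, of z] by (simp add: abs_mult mult_left_mono)
        next
          show "integrable torus (\<lambda>z. \<bar>f z * (k (y - z) - torus_conv (mollifier n) k (x - z))\<bar>)"
            using conv_integrable[OF tk fi, of y] conv_integrable[OF tcont_conv[OF tcont_mollifier tcont_integrable[OF tk]] fi, of n x]
            by (auto simp: right_diff_distrib)
        qed (use fi in auto)
        also have "\<dots> = 2 * \<eta> + C2 * sep (x - y) + C2 * s n"
          by (simp add: prob_density_integral[OF f])
        finally have "\<bar>torus_conv k f y - torus_conv k g x\<bar> \<le> 2 * \<eta> + C2 * sep (x - y) + C2 * s n" .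
        moreover have "\<bar>v y - v x\<bar> \<le> \<eta> + C1 * sep (x - y)"
          using C1(2)[of y x] by (simp add: sep_commute[of x y])
        ultimately show ?thesis
          unfolding force_def v_def[symmetric] k_def[symmetric] distrib_right by linarith
      qed
      define G where "G z = mollifier n z * (M * (3 * \<eta> + (C1 + C2) * sep z + C2 * s n))" for z :: "real^'d"
      have tG: "tcont G" unfolding G_def[abs_def] by (intro tcont_mult tcont_add tcont_const tcont_mollifier tcont_sep)
      obtain BG where BG: "\<And>z. norm (G z) \<le> BG" using tcont_bounded[OF tG] by metis
      obtain BE where BE: "\<And>x y. \<bar>mollifier n (x - y) * (force f i y - force g i x)\<^sup>2\<bar> \<le> BE"
        using mollified_force_bounded[OF fi tcont_integrable[OF g(1)]] by metis
      note fubE = torus_fubini[OF mollified_force_measurable[OF fi tcont_integrable[OF g(1)], of n i] BE fi]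
      note fubG = torus_fubini[OF measurable_pair_diff[OF tG] BG[unfolded real_norm_def] fi]
      have sq: "mollifier n (x - y) * (force f i y - force g i x)\<^sup>2 \<le> G (x - y)" for x y
      proof -
        have "\<bar>force f i y - force g i x\<bar> \<le> M"
          using bd[OF fi prob_density_abs[OF f], of y] bd[OF tcont_integrable[OF g(1)] gabs, of x] by (simp add: M_def)
        then have "\<bar>force f i y - force g i x\<bar> * \<bar>force f i y - force g i x\<bar> \<le> M * (3 * \<eta> + (C1 + C2) * sep (x - y) + C2 * s n)"
          using e[of y x] M by (intro mult_mono) auto
        then have "(force f i y - force g i x)\<^sup>2 \<le> M * (3 * \<eta> + (C1 + C2) * sep (x - y) + C2 * s n)"
          by (simp add: power2_eq_square flip: abs_mult)
        then show ?thesis unfolding G_def by (intro mult_left_mono less_imp_le[OF mollifier_pos])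
      qed
      have "commutator_error n f i = (LINT y|torus. f y * (LINT x|torus. mollifier n (x - y) * (force f i y - force g i x)\<^sup>2))"
        unfolding commutator_error_def g_def[symmetric] by (rule fubE(1))
      also have "\<dots> \<le> (LINT y|torus. f y * (LINT x|torus. G (x - y)))"
      proof (rule integral_mono[OF fubE(3) fubG(3)])
        fix y
        have "(LINT x|torus. mollifier n (x - y) * (force f i y - force g i x)\<^sup>2) \<le> (LINT x|torus. G (x - y))"
        proof (rule integral_mono)
          have tt: "tcont (\<lambda>x. mollifier n (x - y))" "tcont (\<lambda>x. G (x - y))"
            using tcont_translate[OF tcont_mollifier, of n "- y"] tcont_translate[OF tG, of "- y"] by simp_all
          show "integrable torus (\<lambda>x. mollifier n (x - y) * (force f i y - force g i x)\<^sup>2)" "integrable torus (\<lambda>x. G (x - y))"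
            by (intro tcont_integrable tcont_mult tcont_power tcont_diff tcont_const tcont_force g tt)+
        qed (rule sq)
        then show "f y * (LINT x|torus. mollifier n (x - y) * (force f i y - force g i x)\<^sup>2) \<le> f y * (LINT x|torus. G (x - y))"
          by (rule mult_left_mono) (rule prob_density_nonneg[OF f])
      qed
      also have "\<dots> = (LINT z|torus. G z)"
        by (simp add: integral_torus_diff[OF tcont_measurable[OF tG] tcont_periodic[OF tG]] prob_density_integral[OF f])
      also have "\<dots> = (LINT z|torus. M * (3 * \<eta> + C2 * s n) * mollifier n (z::real^'d) + M * (C1 + C2) * (mollifier n z * sep z))"
        unfolding G_def by (rule Bochner_Integration.integral_cong) (auto simp: algebra_simps)
      also have "\<dots> = M * (3 * \<eta> + C2 * s n) + M * (C1 + C2) * s n"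
      proof -
        have "integrable torus (\<lambda>z::real^'d. mollifier n z * sep z)" by (intro tcont_integrable tcont_mult tcont_mollifier tcont_sep)
        then show ?thesis by (simp add: tcont_integrable tcont_mollifier integral_mollifier s_def)
      qed
      also have "\<dots> = \<kappa> / 2 + M * (C1 + 2 * C2) * s n"
        using M by (simp add: \<eta>_def field_simps)
      also have "\<dots> \<le> \<kappa>" using elim by simp
      finally show "commutator_error n f i \<le> \<kappa>" .
    qed
  qed
qed

text \<open>Integration by parts removes the derivative of the density and leaves its integral
  against \<open>E\<close>, which is built from \<open>\<sigma> = g - \<mu>\<close>. For
  \<open>\<mu>\<close> in place of \<open>g\<close> the bracket vanishes identically, so
  \<open>g\<close> may be replaced by \<open>\<sigma>\<close>. The sup norm of the sum of the
  \<open>E i\<close> is at most \<open>K\<close> times the L1 norm of \<open>\<sigma>\<close>, which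
  makes the bound quadratic.\<close>

lemma interaction_bound:
  assumes g: "tcont g" "\<And>i. tcont (g' i)" and d: "\<And>i. has_pd i g (g' i)"
    and pos: "\<And>x. 0 < g x" and one: "(LINT x|torus. g x) = 1"
  shows "- (\<Sum>i\<in>UNIV. LINT x|torus. (g' i x + \<beta> * dU i x * g x) * torus_conv (pderiv_dir i W) (\<lambda>y. g y - \<mu> y) x)
    \<le> K * (LINT x|torus. \<bar>g x - \<mu> x\<bar>)\<^sup>2"
proof -
  define \<sigma> where "\<sigma> y = g y - \<mu> y" for y
  have t\<sigma>: "tcont \<sigma>" unfolding \<sigma>_def[abs_def] by (intro tcont_diff g tcont_\<mu>)
  note i\<sigma> = tcont_integrable[OF t\<sigma>]
  define C where "C i = torus_conv (pderiv_dir i W) \<sigma>" for i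
  define D where "D i = torus_conv (pderiv_dir i (pderiv_dir i W)) \<sigma>" for i
  have tC: "tcont (C i)" "tcont (D i)" for i
    unfolding C_def D_def by (intro tcont_conv C2_tcont_pderiv C2_tcont_pderiv2 W i\<sigma>)+
  have dC: "has_pd i (C i) (D i)" for i
    unfolding C_def D_def by (intro has_pd_conv C2_tcont_pderiv C2_tcont_pderiv2 C2_has_pd2 W i\<sigma>)
  define E where "E i x = D i x - \<beta> * dU i x * C i x" for i x
  have tE: "tcont (E i)" for i
    unfolding E_def[abs_def] by (intro tcont_diff tcont_mult tcont_const tcont_dU tC)
  have parts: "- (LINT x|torus. (r' x + \<beta> * dU i x * r x) * C i x) = (LINT x|torus. r x * E i x)"
    if r: "tcont r" "tcont r'" "has_pd i r r'" for r r' i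
  proof -
    have "(LINT x|torus. (r' x + \<beta> * dU i x * r x) * C i x)
      = (LINT x|torus. r' x * C i x) + (LINT x|torus. \<beta> * dU i x * C i x * r x)"
      by (subst Bochner_Integration.integral_add[symmetric])
         (auto intro!: tcont_integrable tcont_mult tcont_const tcont_dU tC r simp: algebra_simps)
    moreover have "(LINT x|torus. r x * E i x) = (LINT x|torus. r x * D i x) - (LINT x|torus. \<beta> * dU i x * C i x * r x)"
      by (subst Bochner_Integration.integral_diff[symmetric])
         (auto intro!: tcont_integrable tcont_mult tcont_const tcont_dU tC r simp: algebra_simps E_def)
    ultimately show ?thesis using integral_torus_by_parts[OF r tC dC] by simp
  qed
  have zero: "(LINT x|torus. \<mu> x * E i x) = 0" for i
  proof -
    have "tcont (\<lambda>x. - \<beta> * dU i x * \<mu> x)" by (intro tcont_mult tcont_const tcont_dU tcont_\<mu>)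
    from parts[OF tcont_\<mu> this has_pd_\<mu>] show ?thesis by simp
  qed
  have "- (\<Sum>i\<in>UNIV. LINT x|torus. (g' i x + \<beta> * dU i x * g x) * C i x) = (\<Sum>i\<in>UNIV. LINT x|torus. \<sigma> x * E i x)"
    unfolding sum_negf[symmetric]
  proof (rule sum.cong[OF refl])
    fix i
    have "(LINT x|torus. \<sigma> x * E i x) = (LINT x|torus. g x * E i x) - (LINT x|torus. \<mu> x * E i x)"
      unfolding \<sigma>_def left_diff_distrib
      by (rule Bochner_Integration.integral_diff) (intro tcont_integrable tcont_mult g tcont_\<mu> tE)+
    then show "- (LINT x|torus. (g' i x + \<beta> * dU i x * g x) * C i x) = (LINT x|torus. \<sigma> x * E i x)"
      using parts[OF g(1,2) d] zero by simp
  qed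
  also have "\<dots> = (LINT x|torus. (\<Sum>i\<in>UNIV. \<sigma> x * E i x))"
    by (rule Bochner_Integration.integral_sum[symmetric]) (intro tcont_integrable tcont_mult t\<sigma> tE)
  also have "\<dots> \<le> (LINT x|torus. K * (LINT x|torus. \<bar>\<sigma> x\<bar>) * \<bar>\<sigma> x\<bar>)"
  proof (rule integral_mono)
    fix x
    let ?S = "LINT x|torus. \<bar>\<sigma> x\<bar>"
    have S: "0 \<le> ?S" by simp
    have lap: "\<bar>\<Sum>i\<in>UNIV. D i x\<bar> \<le> Linf_norm (laplacian W) * ?S"
    proof -
      have "(\<Sum>i\<in>UNIV. D i x) = torus_conv (laplacian W) \<sigma> x"
        unfolding D_def torus_conv_real laplacian_def sum_distrib_left
        by (rule Bochner_Integration.integral_sum[symmetric]) (intro conv_integrable C2_tcont_pderiv2 W i\<sigma>)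
      also have "\<bar>\<dots>\<bar> \<le> Linf_norm (laplacian W) * ?S"
        using norm_le_Linf_norm[OF C2_tcont_laplacian[OF W]] by (intro conv_bound C2_tcont_laplacian W i\<sigma>) auto
      finally show ?thesis .
    qed
    have "(\<Sum>i\<in>UNIV. dU i x * C i x) = (\<chi> i. dU i x) \<bullet> (\<chi> i. C i x)"
      by (simp add: inner_vec_def)
    also have "\<bar>\<dots>\<bar> \<le> norm (\<chi> i. dU i x) * norm (\<chi> i. C i x)"
      by (rule Cauchy_Schwarz_ineq2)
    also have "\<dots> \<le> (Linf_norm (grad V) + Linf_norm (grad W)) * (Linf_norm (grad W) * ?S)"
    proof (intro mult_mono norm_dU_le)
      show "norm (\<chi> i. C i x) \<le> Linf_norm (grad W) * ?S"
        using norm_vec_conv_le[OF C2_tcont_grad[OF W] i\<sigma>, of x] by (simp add: C_def grad_def eta_contract_eq)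
      show "0 \<le> Linf_norm (grad V) + Linf_norm (grad W)"
        using Linf_norm_nonneg[OF C2_tcont_grad[OF W]] Linf_norm_nonneg[OF C2_tcont_grad[OF V]] by simp
    qed simp
    finally have "\<bar>\<Sum>i\<in>UNIV. dU i x * C i x\<bar> \<le> (Linf_norm (grad V) + Linf_norm (grad W)) * (Linf_norm (grad W) * ?S)" .
    then have inter: "\<beta> * \<bar>\<Sum>i\<in>UNIV. dU i x * C i x\<bar> \<le> \<beta> * ((Linf_norm (grad V) + Linf_norm (grad W)) * (Linf_norm (grad W) * ?S))"
      using \<beta> by (intro mult_left_mono) auto
    have "(\<Sum>i\<in>UNIV. E i x) = (\<Sum>i\<in>UNIV. D i x) - \<beta> * (\<Sum>i\<in>UNIV. dU i x * C i x)"
      unfolding E_def by (simp add: sum_subtractf sum_distrib_left mult.assoc)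
    also have "\<bar>\<dots>\<bar> \<le> \<bar>\<Sum>i\<in>UNIV. D i x\<bar> + \<beta> * \<bar>\<Sum>i\<in>UNIV. dU i x * C i x\<bar>"
      using \<beta> abs_triangle_ineq4[of "\<Sum>i\<in>UNIV. D i x" "\<beta> * (\<Sum>i\<in>UNIV. dU i x * C i x)"] by (simp add: abs_mult)
    also have "\<dots> \<le> K * ?S"
      using lap inter by (simp add: K_def algebra_simps)
    finally have "\<bar>\<sigma> x\<bar> * \<bar>\<Sum>i\<in>UNIV. E i x\<bar> \<le> \<bar>\<sigma> x\<bar> * (K * ?S)" by (rule mult_left_mono) simp
    then show "(\<Sum>i\<in>UNIV. \<sigma> x * E i x) \<le> K * ?S * \<bar>\<sigma> x\<bar>"
      using abs_ge_self[of "\<sigma> x * (\<Sum>i\<in>UNIV. E i x)"] by (simp add: abs_mult mult_ac flip: sum_distrib_left)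
  qed (intro tcont_integrable tcont_mult tcont_const tcont_sum tcont_abs t\<sigma> tE)+
  also have "\<dots> = K * (LINT x|torus. \<bar>\<sigma> x\<bar>)\<^sup>2"
    by (simp add: power2_eq_square)
  finally show ?thesis by (simp add: C_def \<sigma>_def[abs_def])
qed

lemma K_nonneg: "0 \<le> K"
  unfolding K_def using \<beta> Linf_norm_nonneg[OF C2_tcont_laplacian[OF W]] Linf_norm_nonneg[OF C2_tcont_grad[OF W]] Linf_norm_nonneg[OF C2_tcont_grad[OF V]]
  by (intro add_nonneg_nonneg mult_nonneg_nonneg) auto

definition entropy :: "(real^'d \<Rightarrow> real) \<Rightarrow> real" where
  "entropy g = (LINT x|torus. g x * ln (g x / \<mu> x))"

text \<open>The share \<open>\<delta>\<close> of the Fisher information is given up to absorb the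
  commutator; at \<open>\<delta> = 0\<close> this is the decay rate of the theorem.\<close>

definition rate :: "real \<Rightarrow> real" where
  "rate \<delta> = 8 * pi\<^sup>2 / \<Gamma> * (1 / \<beta> - \<delta>) - 8 * K"

text \<open>The first factor is the flux of the mollified equation, the second is the derivative
  \<open>l\<close> of \<open>ln (g / \<mu>)\<close>. The flux splits as
  \<open>g * l / \<beta> + R + g * C\<close> with the commutator \<open>R = m - g * force g\<close>
  and the excess force \<open>C\<close> over equilibrium. The three parts yield the Fisher
  information, an error absorbed by Young's inequality, and the term of
  \<open>interaction_bound\<close>.\<close>

lemma dissipation:
  fixes n :: nat and f
  assumes f: "prob_density f" and \<delta>: "0 < \<delta>" "\<delta> < 1 / \<beta>"
  defines "g \<equiv> torus_conv (mollifier n) f"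
    and "m \<equiv> \<lambda>i. torus_conv (mollifier n) (\<lambda>y. f y * force f i y)"
  assumes d: "\<And>i. has_pd i g (g' i)" and tg': "\<And>i. tcont (g' i)"
  shows "- (\<Sum>i\<in>UNIV. LINT x|torus. (g' i x / \<beta> + m i x) * (g' i x / g x + \<beta> * dU i x))
    \<le> - rate \<delta> * entropy g + (\<Sum>i\<in>UNIV. commutator_error n f i) / (4 * \<delta>)"
proof -
  note fi = prob_density_integrable[OF f]
  have g: "tcont g" "\<And>x. 0 < g x" "(LINT x|torus. g x) = 1"
    using prob_density_conv_mollifier[OF f] by (auto simp: g_def)
  have nz: "g x \<noteq> 0" for x using g(2)[of x] by simp
  define C where "C i = torus_conv (pderiv_dir i W) (\<lambda>y. g y - \<mu> y)" for i
  have tC: "tcont (C i)" for i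
    unfolding C_def by (intro tcont_conv C2_tcont_pderiv W tcont_integrable tcont_diff g tcont_\<mu>)
  have fg: "force g i x = dU i x + C i x" for i x
    using conv_diff[OF C2_tcont_pderiv[OF W] C2_tcont_pderiv[OF W] tcont_integrable[OF g(1)] tcont_integrable[OF tcont_\<mu>], of i x]
    by (simp add: force_def dU_def C_def conv_finf[OF C2_tcont_pderiv[OF W]])
  define l where "l i x = g' i x / g x + \<beta> * dU i x" for i x
  have tl: "tcont (l i)" for i
    unfolding l_def[abs_def] by (intro tcont_add tcont_mult tcont_const tcont_divide tg' g nz tcont_dU)
  have fF: "integrable torus (\<lambda>y. f y * force f i y)" for i
    using tcont_integrable_mult[OF tcont_force[OF fi] fi] by simp
  have tm: "tcont (m i)" for i unfolding m_def by (intro tcont_conv tcont_mollifier fF)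
  define S where "S i x = (LINT y|torus. f y * (mollifier n (x - y) * (force f i y - force g i x)\<^sup>2))" for i x
  have "\<exists>B. \<forall>x y. \<bar>mollifier n (x - y) * (force f i y - force g i x)\<^sup>2\<bar> \<le> B" for i
    using mollified_force_bounded[OF fi tcont_integrable[OF g(1)]] by metis
  then obtain B where B: "\<And>i x y. \<bar>mollifier n (x - y) * (force f i y - force g i x)\<^sup>2\<bar> \<le> B i" by metis
  have iS: "integrable torus (S i)" for i
    unfolding S_def by (rule torus_fubini(2)[OF mollified_force_measurable[OF fi tcont_integrable[OF g(1)]] B fi])
  have pw: "- ((g' i x / \<beta> + m i x) * l i x) \<le> - (1 / \<beta> - \<delta>) * (g x * (l i x)\<^sup>2) + S i x / (4 * \<delta>) - g x * l i x * C i x" for i x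
  proof -
    have gc: "g x = (LINT y|torus. f y * mollifier n (x - y))" by (simp add: g_def torus_conv_real)
    have ig: "integrable torus (\<lambda>y. f y * mollifier n (x - y))"
      by (rule conv_integrable[OF tcont_mollifier fi])
    have im: "integrable torus (\<lambda>y. f y * force f i y * mollifier n (x - y))"
      by (rule conv_integrable[OF tcont_mollifier fF])
    let ?e = "\<lambda>y. force f i y - force g i x"
    have tmx: "tcont (\<lambda>y. mollifier n (x - y))" by (rule tcont_reflect[OF tcont_mollifier])
    have te: "tcont ?e" by (intro tcont_diff tcont_force fi tcont_const)
    have iq: "integrable torus (\<lambda>y. f y * (mollifier n (x - y) * (?e y)\<^sup>2))"
      using tcont_integrable_mult[OF tcont_mult[OF tmx tcont_power[OF te]] fi] by simp
    define R where "R = m i x - g x * force g i x"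
    have "R * l i x = (LINT y|torus. (f y * force f i y * mollifier n (x - y)) * l i x - (f y * mollifier n (x - y)) * (force g i x * l i x))"
      using ig im by (simp add: R_def gc m_def torus_conv_real left_diff_distrib)
    also have "\<dots> = (LINT y|torus. f y * mollifier n (x - y) * (?e y * l i x))"
      by (rule Bochner_Integration.integral_cong) (auto simp: algebra_simps)
    finally have "- (R * l i x) = (LINT y|torus. - (f y * mollifier n (x - y) * (?e y * l i x)))" by simp
    also have "\<dots> = (LINT y|torus. f y * mollifier n (x - y) * (- ?e y * l i x))"
      by (rule Bochner_Integration.integral_cong) (auto simp: algebra_simps)
    \<comment> \<open>Young's inequality is used under the integral in \<open>y\<close>. The weight
      \<open>f y * mollifier n (x - y)\<close> has total mass \<open>g x\<close>, so the quadratic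
      part becomes exactly \<open>\<delta> * g * l^2\<close>.\<close>
    also have "\<dots> \<le> (LINT y|torus. (1 / (4 * \<delta>)) * (f y * (mollifier n (x - y) * (?e y)\<^sup>2)) + (\<delta> * (l i x)\<^sup>2) * (f y * mollifier n (x - y)))"
    proof (rule integral_mono)
      have "integrable torus (\<lambda>y. f y * (mollifier n (x - y) * (- ?e y * l i x)))"
        using tcont_integrable_mult[OF tcont_mult[OF tmx tcont_mult[OF tcont_minus[OF te] tcont_const[of "l i x"]]] fi] by simp
      then show "integrable torus (\<lambda>y. f y * mollifier n (x - y) * (- ?e y * l i x))" by (simp add: mult.assoc)
      fix y
      have "- e * r \<le> e\<^sup>2 / (4 * \<delta>) + \<delta> * r\<^sup>2" for e r
        using young_product[of "2 * \<delta>" r "- e"] \<delta> by (simp add: field_simps)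
      then have "- ?e y * l i x \<le> (?e y)\<^sup>2 / (4 * \<delta>) + \<delta> * (l i x)\<^sup>2" .
      then have "(f y * mollifier n (x - y)) * (- ?e y * l i x) \<le> (f y * mollifier n (x - y)) * ((?e y)\<^sup>2 / (4 * \<delta>) + \<delta> * (l i x)\<^sup>2)"
        by (rule mult_left_mono) (intro mult_nonneg_nonneg prob_density_nonneg[OF f] less_imp_le[OF mollifier_pos])
      then show "f y * mollifier n (x - y) * (- ?e y * l i x)
        \<le> (1 / (4 * \<delta>)) * (f y * (mollifier n (x - y) * (?e y)\<^sup>2)) + (\<delta> * (l i x)\<^sup>2) * (f y * mollifier n (x - y))"
        by (simp add: distrib_left mult_ac)
    qed (use iq ig in auto)
    also have "\<dots> = S i x / (4 * \<delta>) + \<delta> * (l i x)\<^sup>2 * g x"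
      using iq ig by (simp add: S_def gc)
    finally have R: "- (R * l i x) \<le> S i x / (4 * \<delta>) + \<delta> * (l i x)\<^sup>2 * g x" .
    have "g' i x / \<beta> + m i x = g x * l i x / \<beta> + R + g x * C i x"
      using nz[of x] \<beta> by (simp add: R_def fg l_def field_simps)
    then have "- ((g' i x / \<beta> + m i x) * l i x) = - (R * l i x) - g x * (l i x)\<^sup>2 / \<beta> - g x * l i x * C i x"
      by (simp add: algebra_simps power2_eq_square)
    then show ?thesis using R by (simp add: algebra_simps)
  qed
  have tgl: "tcont (\<lambda>x. g x * (l i x)\<^sup>2)" "tcont (\<lambda>x. g x * l i x * C i x)" for i
    by (intro tcont_mult tcont_power g tl tC)+
  have "- (\<Sum>i\<in>UNIV. LINT x|torus. (g' i x / \<beta> + m i x) * l i x) = (\<Sum>i\<in>UNIV. LINT x|torus. - ((g' i x / \<beta> + m i x) * l i x))"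
    by (simp add: sum_negf)
  also have "\<dots> \<le> (\<Sum>i\<in>UNIV. LINT x|torus. - (1 / \<beta> - \<delta>) * (g x * (l i x)\<^sup>2) + S i x / (4 * \<delta>) - g x * l i x * C i x)"
  proof (intro sum_mono integral_mono pw)
    fix i
    show "integrable torus (\<lambda>x. - ((g' i x / \<beta> + m i x) * l i x))"
      using \<beta> by (intro tcont_integrable tcont_minus tcont_mult tcont_add tcont_divide tcont_const tg' tm tl) auto
    show "integrable torus (\<lambda>x. - (1 / \<beta> - \<delta>) * (g x * (l i x)\<^sup>2) + S i x / (4 * \<delta>) - g x * l i x * C i x)"
      using tcont_integrable[OF tgl(1)[of i]] tcont_integrable[OF tgl(2)[of i]] iS[of i] by auto
  qed
  also have "\<dots> = (\<Sum>i\<in>UNIV. - (1 / \<beta> - \<delta>) * (LINT x|torus. g x * (l i x)\<^sup>2) + commutator_error n f i / (4 * \<delta>) - (LINT x|torus. g x * l i x * C i x))"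
  proof (rule sum.cong[OF refl])
    fix i
    have "commutator_error n f i = (LINT x|torus. S i x)" by (simp add: commutator_error_def S_def g_def)
    then show "(LINT x|torus. - (1 / \<beta> - \<delta>) * (g x * (l i x)\<^sup>2) + S i x / (4 * \<delta>) - g x * l i x * C i x)
      = - (1 / \<beta> - \<delta>) * (LINT x|torus. g x * (l i x)\<^sup>2) + commutator_error n f i / (4 * \<delta>) - (LINT x|torus. g x * l i x * C i x)"
      using tcont_integrable[OF tgl(1)[of i]] tcont_integrable[OF tgl(2)[of i]] iS[of i] by simp
  qed
  also have "\<dots> = - (1 / \<beta> - \<delta>) * (\<Sum>i\<in>UNIV. LINT x|torus. g x * (l i x)\<^sup>2) + (\<Sum>i\<in>UNIV. commutator_error n f i) / (4 * \<delta>)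
      - (\<Sum>i\<in>UNIV. LINT x|torus. g x * l i x * C i x)"
    by (simp add: sum.distrib sum_subtractf sum_distrib_left sum_divide_distrib)
  finally have main: "- (\<Sum>i\<in>UNIV. LINT x|torus. (g' i x / \<beta> + m i x) * l i x) \<le> \<dots>" .
  have lsi: "8 * pi\<^sup>2 / \<Gamma> * entropy g \<le> (\<Sum>i\<in>UNIV. LINT x|torus. g x * (l i x)\<^sup>2)"
    unfolding entropy_def l_def by (rule log_sobolev_\<mu>[OF g(1) tg' d g(2,3)])
  have "g x * l i x = g' i x + \<beta> * dU i x * g x" for i x
    using nz[of x] by (simp add: l_def algebra_simps)
  then have "- (\<Sum>i\<in>UNIV. LINT x|torus. g x * l i x * C i x) \<le> K * (LINT x|torus. \<bar>g x - \<mu> x\<bar>)\<^sup>2"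
    using interaction_bound[OF g(1) tg' d g(2,3)] by (simp add: C_def)
  also have "\<dots> \<le> K * (4 * entropy g)"
    unfolding entropy_def by (intro mult_left_mono pinsker_weak g tcont_\<mu> \<mu>_pos integral_\<mu> K_nonneg)
  \<comment> \<open>From the 4 of \<open>pinsker_weak\<close> to the 8 of the stated rate; the
    entropy is nonnegative.\<close>
  also have "\<dots> \<le> K * (8 * entropy g)"
    unfolding entropy_def using pinsker_weak(1)[OF g(1) tcont_\<mu> g(2) \<mu>_pos g(3) integral_\<mu>] K_nonneg by (intro mult_left_mono) auto
  finally have inter: "- (\<Sum>i\<in>UNIV. LINT x|torus. g x * l i x * C i x) \<le> 8 * K * entropy g" by simp
  have "(1 / \<beta> - \<delta>) * (8 * pi\<^sup>2 / \<Gamma> * entropy g) \<le> (1 / \<beta> - \<delta>) * (\<Sum>i\<in>UNIV. LINT x|torus. g x * (l i x)\<^sup>2)"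
    using lsi \<delta> by (intro mult_left_mono) auto
  moreover have "- rate \<delta> * entropy g = 8 * K * entropy g - (1 / \<beta> - \<delta>) * (8 * pi\<^sup>2 / \<Gamma> * entropy g)"
    by (simp add: rate_def algebra_simps)
  ultimately show ?thesis
    using main inter unfolding l_def by linarith
qed

end

subsection \<open>Evolution of the mollified entropy\<close>

locale mean_field_flow = equilibrium \<beta> V W finf
  for \<beta> :: real and V W finf :: "real^'d \<Rightarrow> real" +
  fixes f0 :: "real^'d \<Rightarrow> real" and f :: "real \<Rightarrow> real^'d \<Rightarrow> real"
  assumes sol: "McKean_Vlasov_solution \<beta> V W f0 f"
begin

lemma initial: "f 0 = f0"
  and prob: "0 \<le> t \<Longrightarrow> prob_density (f t)"
  and narrow: "tcont \<phi> \<Longrightarrow> continuous_on {0..} (\<lambda>t. LINT x|torus. \<phi> x * f t x)"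
  and weak: "C2_torus \<phi> \<Longrightarrow> 0 \<le> t \<Longrightarrow>
            ((\<lambda>s. LINT x|torus. (laplacian \<phi> x / \<beta>
                - grad \<phi> x \<bullet> (grad V x + torus_conv (grad W) (f s) x)) * f s x)
             has_integral ((LINT x|torus. \<phi> x * f t x) - (LINT x|torus. \<phi> x * f0 x))) {0..t}"
  using sol unfolding McKean_Vlasov_solution_def tcont_def by blast+

lemma flow_integrable: "0 \<le> t \<Longrightarrow> integrable torus (f t)"
  by (rule prob_density_integrable[OF prob])

lemma flow_integrable_mult: "0 \<le> t \<Longrightarrow> tcont \<phi> \<Longrightarrow> integrable torus (\<lambda>x. \<phi> x * f t x)"
  using tcont_integrable_mult[OF _ flow_integrable, of \<phi> t] by (simp add: mult.commute)

text \<open>The integral is quadratic in \<open>f s\<close>, while narrow continuity concerns linear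
  functionals. Separating the variables of the wave turns it into a sum of products of linear
  ones.\<close>

lemma continuous_interaction_wave:
  assumes w: "freq w" and \<phi>: "tcont \<phi>"
  shows "continuous_on {0..} (\<lambda>s. LINT y|torus. \<phi> y * torus_conv (wave w p) (f s) y * f s y)"
proof -
  note tw = tcont_wave[OF w]
  have "(LINT y|torus. \<phi> y * torus_conv (wave w p) (f s) y * f s y)
    = (LINT y|torus. wave w 0 y * f s y) * (LINT y|torus. \<phi> y * wave w p y * f s y)
      + (LINT y|torus. wave w (- pi / 2) y * f s y) * (LINT y|torus. \<phi> y * wave w (p - pi / 2) y * f s y)"
    if s: "s \<in> {0..}" for s
  proof -
    have c: "torus_conv (wave w p) (f s) y
      = wave w p y * (LINT z|torus. wave w 0 z * f s z) + wave w (p - pi / 2) y * (LINT z|torus. wave w (- pi / 2) z * f s z)" for y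
    proof -
      have "torus_conv (wave w p) (f s) y
        = (LINT z|torus. wave w p y * (wave w 0 z * f s z) + wave w (p - pi / 2) y * (wave w (- pi / 2) z * f s z))"
        unfolding torus_conv_real wave_diff by (rule Bochner_Integration.integral_cong) (auto simp: algebra_simps)
      also have "\<dots> = (LINT z|torus. wave w p y * (wave w 0 z * f s z)) + (LINT z|torus. wave w (p - pi / 2) y * (wave w (- pi / 2) z * f s z))"
        using s by (intro Bochner_Integration.integral_add integrable_mult_right flow_integrable_mult tw) auto
      finally show ?thesis by simp
    qed
    let ?A = "LINT z|torus. wave w 0 z * f s z" and ?B = "LINT z|torus. wave w (- pi / 2) z * f s z"
    have "(LINT y|torus. \<phi> y * torus_conv (wave w p) (f s) y * f s y)
      = (LINT y|torus. ?A * (\<phi> y * wave w p y * f s y) + ?B * (\<phi> y * wave w (p - pi / 2) y * f s y))"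
      unfolding c by (rule Bochner_Integration.integral_cong) (auto simp: algebra_simps)
    also have "\<dots> = (LINT y|torus. ?A * (\<phi> y * wave w p y * f s y)) + (LINT y|torus. ?B * (\<phi> y * wave w (p - pi / 2) y * f s y))"
      using s by (intro Bochner_Integration.integral_add integrable_mult_right flow_integrable_mult tcont_mult tw \<phi>) auto
    finally show ?thesis by simp
  qed
  then show ?thesis
    by (subst continuous_on_cong[OF refl]) (assumption, intro continuous_intros narrow tcont_mult tw \<phi>)
qed

text \<open>Mollified kernels are finite sums of waves and converge uniformly to \<open>k\<close>.
  Since every \<open>f s\<close> has mass 1, the integrals converge uniformly in time, and a uniform
  limit of continuous functions is continuous.\<close>

lemma continuous_interaction:
  assumes k: "tcont k" and \<phi>: "tcont \<phi>"
  shows "continuous_on {0..} (\<lambda>s. LINT y|torus. \<phi> y * torus_conv k (f s) y * f s y)"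
proof -
  define kn where "kn n = torus_conv (mollifier n) k" for n
  have tkn: "tcont (kn n)" for n unfolding kn_def by (intro tcont_conv tcont_mollifier tcont_integrable k)
  have "continuous_on {0..} (\<lambda>s. LINT y|torus. \<phi> y * torus_conv (kn n) (f s) y * f s y)" for n
  proof -
    obtain Q :: "(nat \<times> real) set" and c w p where
      Q: "\<And>q. q \<in> Q \<Longrightarrow> freq (w q)"
      "\<And>x y. mollifier n (x - y :: real^'d) = (\<Sum>q\<in>Q. c q * (wave (w q) (p q) x * wave (w q) (p q) y))"
      by (rule mollifier_repr[of n]) (rule that)
    define b where "b q = c q * (LINT y|torus. k y * wave (w q) (p q) y)" for q
    have kn: "kn n = (\<lambda>x. \<Sum>q\<in>Q. b q * wave (w q) (p q) x)"
      unfolding kn_def b_def fun_eq_iff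
      using conv_mollifier_repr[OF Q(1) Q(2) tcont_integrable[OF k]] by simp
    have "(LINT y|torus. \<phi> y * torus_conv (kn n) (f s) y * f s y)
      = (\<Sum>q\<in>Q. b q * (LINT y|torus. \<phi> y * torus_conv (wave (w q) (p q)) (f s) y * f s y))" if s: "s \<in> {0..}" for s
    proof -
      have s0: "0 \<le> s" using s by simp
      have c: "torus_conv (kn n) (f s) y = (\<Sum>q\<in>Q. b q * torus_conv (wave (w q) (p q)) (f s) y)" for y
      proof -
        have "torus_conv (kn n) (f s) y = (LINT z|torus. (\<Sum>q\<in>Q. b q * (f s z * wave (w q) (p q) (y - z))))"
          unfolding torus_conv_real kn by (simp add: sum_distrib_left mult_ac)
        also have "\<dots> = (\<Sum>q\<in>Q. LINT z|torus. b q * (f s z * wave (w q) (p q) (y - z)))"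
          by (rule Bochner_Integration.integral_sum)
             (intro integrable_mult_right conv_integrable tcont_wave Q flow_integrable s0)
        finally show ?thesis by (simp add: torus_conv_real)
      qed
      have "(LINT y|torus. \<phi> y * torus_conv (kn n) (f s) y * f s y)
        = (LINT y|torus. (\<Sum>q\<in>Q. b q * (\<phi> y * torus_conv (wave (w q) (p q)) (f s) y * f s y)))"
        unfolding c by (simp add: sum_distrib_left sum_distrib_right mult_ac)
      also have "\<dots> = (\<Sum>q\<in>Q. LINT y|torus. b q * (\<phi> y * torus_conv (wave (w q) (p q)) (f s) y * f s y))"
        by (rule Bochner_Integration.integral_sum)
           (intro integrable_mult_right flow_integrable_mult tcont_mult \<phi> tcont_conv tcont_wave Q flow_integrable s0)
      finally show ?thesis by simp
    qed
    then show ?thesis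
      by (subst continuous_on_cong[OF refl])
         (assumption, intro continuous_on_sum continuous_on_mult continuous_on_const continuous_interaction_wave Q \<phi>)
  qed
  moreover have "uniform_limit {0..} (\<lambda>n s. LINT y|torus. \<phi> y * torus_conv (kn n) (f s) y * f s y)
     (\<lambda>s. LINT y|torus. \<phi> y * torus_conv k (f s) y * f s y) sequentially"
    unfolding uniform_limit_iff
  proof (intro allI impI)
    fix e :: real assume e: "0 < e"
    obtain B where B: "0 < B" "\<And>x. norm (\<phi> x) \<le> B" using tcont_bounded[OF \<phi>] by metis
    have "\<forall>\<^sub>F n in sequentially. \<forall>x. \<bar>kn n x - k x\<bar> \<le> e / (2 * B)"
      unfolding kn_def by (rule conv_mollifier_uniform[OF k]) (use B e in simp)
    then show "\<forall>\<^sub>F n in sequentially. \<forall>s\<in>{0..}. dist (LINT y|torus. \<phi> y * torus_conv (kn n) (f s) y * f s y)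
        (LINT y|torus. \<phi> y * torus_conv k (f s) y * f s y) < e"
    proof eventually_elim
      case (elim n)
      show ?case
      proof
        fix s :: real assume "s \<in> {0..}"
        then have s: "0 \<le> s" by simp
        note fi = flow_integrable[OF s]
        have td: "tcont (\<lambda>z. kn n z - k z)" by (intro tcont_diff tkn k)
        have "(LINT y|torus. \<phi> y * torus_conv (kn n) (f s) y * f s y) - (LINT y|torus. \<phi> y * torus_conv k (f s) y * f s y)
          = (LINT y|torus. \<phi> y * torus_conv (\<lambda>z. kn n z - k z) (f s) y * f s y)"
        proof -
          have "integrable torus (\<lambda>y. \<phi> y * torus_conv h (f s) y * f s y)" if "tcont h" for h
            by (intro flow_integrable_mult s tcont_mult \<phi> tcont_conv that fi)
          from Bochner_Integration.integral_diff[OF this[OF tkn] this[OF k], symmetric] show ?thesis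
            unfolding conv_diff_kernel[OF tkn k fi fi] by (simp add: algebra_simps)
        qed
        also have "\<bar>\<dots>\<bar> \<le> (LINT y|torus. \<bar>\<phi> y * torus_conv (\<lambda>z. kn n z - k z) (f s) y * f s y\<bar>)"
          by (rule integral_abs_bound)
        also have "\<dots> \<le> (LINT y|torus. (B * (e / (2 * B))) * f s y)"
        proof (rule integral_mono)
          fix y
          have "\<bar>torus_conv (\<lambda>z. kn n z - k z) (f s) y\<bar> \<le> e / (2 * B)"
            using conv_bound[OF td fi, of "e / (2 * B)" y] elim prob_density_abs[OF prob[OF s]] by simp
          then have "\<bar>\<phi> y * torus_conv (\<lambda>z. kn n z - k z) (f s) y\<bar> \<le> B * (e / (2 * B))"
            unfolding abs_mult using B(2)[of y] B(1) by (intro mult_mono) auto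
          then show "\<bar>\<phi> y * torus_conv (\<lambda>z. kn n z - k z) (f s) y * f s y\<bar> \<le> (B * (e / (2 * B))) * f s y"
            using prob_density_nonneg[OF prob[OF s], of y] unfolding abs_mult[of _ "f s y"]
            by (simp add: mult_right_mono)
        qed (intro integrable_abs integrable_mult_right flow_integrable_mult s tcont_mult \<phi> tcont_conv td fi)+
        also have "\<dots> = e / 2" using B(1) by (simp add: prob_density_integral[OF prob[OF s]])
        also have "\<dots> < e" using e by simp
        finally show "dist (LINT y|torus. \<phi> y * torus_conv (kn n) (f s) y * f s y)
          (LINT y|torus. \<phi> y * torus_conv k (f s) y * f s y) < e" by (simp add: dist_real_def)
      qed
    qed
  qed
  ultimately show ?thesis
    by (intro uniform_limit_theorem[where F = sequentially]) auto
qed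

section \<open>Time derivatives of the Fourier coefficients\<close>

definition mode_rate :: "real^'d \<Rightarrow> real \<Rightarrow> real \<Rightarrow> real" where
  "mode_rate w p s = - (w \<bullet> w) / \<beta> * (LINT y|torus. wave w p y * f s y)
     - (\<Sum>i\<in>UNIV. w $ i * (LINT y|torus. f s y * force (f s) i y * wave w (p + pi / 2) y))"

lemma mode_rate_eq:
  assumes w: "freq w" and s: "0 \<le> s"
  shows "(LINT x|torus. (laplacian (wave w p) x / \<beta>
                - grad (wave w p) x \<bullet> (grad V x + torus_conv (grad W) (f s) x)) * f s x) = mode_rate w p s"
proof -
  note fi = flow_integrable[OF s]
  note tw = tcont_wave[OF w]
  have fr: "(grad V x + torus_conv (grad W) (f s) x) $ i = force (f s) i x" for i x
    by (simp add: force_def torus_conv_component[OF C2_tcont_grad[OF W] fi]) (simp add: grad_def eta_contract_eq)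
  have "(laplacian (wave w p) x / \<beta> - grad (wave w p) x \<bullet> (grad V x + torus_conv (grad W) (f s) x)) * f s x
    = (- (w \<bullet> w) / \<beta>) * (wave w p x * f s x) - (\<Sum>i\<in>UNIV. w $ i * (f s x * force (f s) i x * wave w (p + pi / 2) x))" for x
  proof -
    have gr: "grad (wave w p) x \<bullet> (grad V x + torus_conv (grad W) (f s) x) = (\<Sum>i\<in>UNIV. wave w (p + pi / 2) x * w $ i * force (f s) i x)"
      unfolding inner_vec_def fr grad_wave by (simp add: mult.assoc)
    show ?thesis
      unfolding laplacian_wave gr left_diff_distrib sum_distrib_right by (simp add: mult_ac)
  qed
  moreover have i1: "integrable torus (\<lambda>x. wave w p x * f s x)" by (intro flow_integrable_mult s tw)
  moreover have i2: "integrable torus (\<lambda>x. f s x * force (f s) i x * wave w (p + pi / 2) x)" for i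
    using flow_integrable_mult[OF s tcont_mult[OF tcont_force[OF fi, of i] tw[of "p + pi/2"]]] by (simp add: mult_ac)
  ultimately show ?thesis
    unfolding mode_rate_def by simp
qed

lemma continuous_mode_rate:
  assumes w: "freq w"
  shows "continuous_on {0..} (mode_rate w p)"
proof -
  note tw = tcont_wave[OF w]
  have "(LINT y|torus. f s y * force (f s) i y * wave w q y)
    = (LINT y|torus. wave w q y * pderiv_dir i V y * f s y) + (LINT y|torus. wave w q y * torus_conv (pderiv_dir i W) (f s) y * f s y)"
    if "s \<in> {0..}" for s i q
  proof -
    have s: "0 \<le> s" using that by simp
    have "integrable torus (\<lambda>y. wave w q y * pderiv_dir i V y * f s y)"
      "integrable torus (\<lambda>y. wave w q y * torus_conv (pderiv_dir i W) (f s) y * f s y)"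
      by (intro flow_integrable_mult s tcont_mult tw C2_tcont_pderiv V W tcont_conv flow_integrable)+
    from Bochner_Integration.integral_add[OF this, symmetric] show ?thesis
      unfolding force_def by (simp add: algebra_simps)
  qed
  moreover have "continuous_on {0..} (\<lambda>s. (LINT y|torus. wave w q y * pderiv_dir i V y * f s y)
      + (LINT y|torus. wave w q y * torus_conv (pderiv_dir i W) (f s) y * f s y))" for i q
    by (intro continuous_on_add narrow continuous_interaction tcont_mult tw C2_tcont_pderiv V W)
  ultimately have "continuous_on {0..} (\<lambda>s. LINT y|torus. f s y * force (f s) i y * wave w q y)" for i q
    by (subst continuous_on_cong[OF refl]) (assumption, blast)
  then show ?thesis
    unfolding mode_rate_def[abs_def] by (intro continuous_intros narrow tw)
qed

text \<open>The weak equation tested with one wave makes the coefficient a time integral of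
  \<open>mode_rate\<close>. As the latter is continuous, the fundamental theorem of calculus yields
  a classical derivative, one-sided at time 0.\<close>

lemma mode_derivative:
  assumes w: "freq w" and t: "0 \<le> t"
  shows "((\<lambda>t. LINT y|torus. wave w p y * f t y) has_real_derivative mode_rate w p t) (at t within {0..})"
proof -
  \<comment> \<open>The interval ends strictly after \<open>t\<close>, so derivatives at
    \<open>t\<close> within it and within \<open>{0..}\<close> agree.\<close>
  have c: "continuous_on {0..t + 1} (mode_rate w p)"
    by (rule continuous_on_subset[OF continuous_mode_rate[OF w]]) auto
  have eq: "(LINT y|torus. wave w p y * f s y) = (LINT y|torus. wave w p y * f0 y) + integral {0..s} (mode_rate w p)"
    if "0 \<le> s" for s
  proof -
    have "((mode_rate w p) has_integral ((LINT x|torus. wave w p x * f s x) - (LINT x|torus. wave w p x * f0 x))) {0..s}"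
      by (rule has_integral_eq[OF _ weak[OF C2_torus_wave[OF w] that]]) (use mode_rate_eq[OF w] in auto)
    then show ?thesis by (simp add: integral_unique)
  qed
  have "((\<lambda>s. integral {0..s} (mode_rate w p)) has_real_derivative mode_rate w p t) (at t within {0..t + 1})"
    by (rule integral_has_real_derivative[OF c]) (use t in auto)
  from DERIV_add[OF DERIV_const this]
  have "((\<lambda>s. (LINT y|torus. wave w p y * f0 y) + integral {0..s} (mode_rate w p)) has_real_derivative mode_rate w p t) (at t within {0..t + 1})"
    by simp
  then have "((\<lambda>t. LINT y|torus. wave w p y * f t y) has_real_derivative mode_rate w p t) (at t within {0..t + 1})"
    by (rule has_field_derivative_transform_within[OF _ zero_less_one]) (use t eq in auto)
  moreover have "at t within {0..t + 1} = at t within {0..}"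
    by (rule at_within_nhd[of t "{..<t + 1}"]) auto
  ultimately show ?thesis by simp
qed

abbreviation moll :: "nat \<Rightarrow> real \<Rightarrow> real^'d \<Rightarrow> real" where
  "moll n t \<equiv> torus_conv (mollifier n) (f t)"

text \<open>The time dependence of the mollified density sits in finitely many differentiable
  coefficients, so it solves a divergence-form equation classically, with flux
  \<open>g1 i / \<beta> + m i\<close>. Differentiation under the integral and integration by parts
  against \<open>ln (g / \<mu>) + 1\<close> then produce the expression bounded in
  \<open>dissipation\<close>.\<close>

lemma entropy_derivative:
  assumes \<delta>: "0 < \<delta>" "\<delta> < 1 / \<beta>"
  obtains H' where "\<And>t. 0 \<le> t \<Longrightarrow> ((\<lambda>t. entropy (moll n t)) has_real_derivative H' t) (at t within {0..})"
    "\<And>t. 0 \<le> t \<Longrightarrow> H' t \<le> - rate \<delta> * entropy (moll n t) + (\<Sum>i\<in>UNIV. commutator_error n (f t) i) / (4 * \<delta>)"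
proof -
  obtain Q :: "(nat \<times> real) set" and c w p where
    Q: "\<And>q. q \<in> Q \<Longrightarrow> freq (w q)"
    and repr: "\<And>x y. mollifier n (x - y :: real^'d) = (\<Sum>q\<in>Q. c q * (wave (w q) (p q) x * wave (w q) (p q) y))"
    by (rule mollifier_repr[of n]) (rule that)
  define e where "e q = wave (w q) (p q)" for q
  define e1 where "e1 q = wave (w q) (p q + pi / 2)" for q
  have te: "tcont (e q)" "tcont (e1 q)" if "q \<in> Q" for q
    unfolding e_def e1_def by (intro tcont_wave Q that)+
  have de: "has_pd i (e q) (\<lambda>x. w q $ i * e1 q x)" "has_pd i (e1 q) (\<lambda>x. - w q $ i * e q x)" for i q
    unfolding e_def e1_def
    by (rule has_pd_wave, rule has_pd_cong[OF has_pd_wave], unfold wave_pi, simp)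
  note repr' = repr[folded e_def]
  text \<open>The translation invariance of \<open>mollifier n (x - y)\<close>, differentiated.\<close>
  have transl: "(\<Sum>q\<in>Q. c q * w q $ i * (e1 q x * e q y + e q x * e1 q y)) = 0" for i x y
  proof -
    have "((\<lambda>s. \<Sum>q\<in>Q. c q * (e q (x + s *\<^sub>R axis i 1) * e q (y + s *\<^sub>R axis i 1))) has_real_derivative
        (\<Sum>q\<in>Q. c q * ((w q $ i * e1 q x) * e q (y + 0 *\<^sub>R axis i 1) + (w q $ i * e1 q y) * e q (x + 0 *\<^sub>R axis i 1)))) (at 0)"
      by (intro DERIV_sum DERIV_cmult DERIV_mult has_pdD[OF de(1)])
    then have "((\<lambda>s::real. mollifier n (x - y)) has_real_derivative
        (\<Sum>q\<in>Q. c q * ((w q $ i * e1 q x) * e q y + (w q $ i * e1 q y) * e q x))) (at 0)"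
      by (simp flip: repr')
    then have "(\<Sum>q\<in>Q. c q * ((w q $ i * e1 q x) * e q y + (w q $ i * e1 q y) * e q x)) = 0"
      using DERIV_const DERIV_unique by blast
    then show ?thesis by (simp add: algebra_simps)
  qed
  \<comment> \<open>Here \<open>a\<close> and \<open>a'\<close> are the coefficients of
    \<open>g\<close> and their time derivatives, and \<open>gt\<close> is the time derivative of
    \<open>g\<close>; \<open>g1\<close> and \<open>g2\<close> are first and second partial
    derivatives of \<open>g\<close>. The coefficients of the mollified drift flux \<open>m\<close>
    are \<open>b\<close>, and \<open>m1\<close> is a partial derivative of \<open>m\<close>.\<close>
  define a where "a q t = c q * (LINT y|torus. e q y * f t y)" for q t
  define a' where "a' q t = c q * mode_rate (w q) (p q) t" for q t
  define g where "g t x = (\<Sum>q\<in>Q. a q t * e q x)" for t x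
  define g1 where "g1 i t x = (\<Sum>q\<in>Q. a q t * (w q $ i * e1 q x))" for i t x
  define g2 where "g2 i t x = (\<Sum>q\<in>Q. a q t * (w q $ i * (- w q $ i * e q x)))" for i t x
  define b where "b i q t = c q * (LINT y|torus. f t y * force (f t) i y * e q y)" for i q t
  define m1 where "m1 i t x = (\<Sum>q\<in>Q. b i q t * (w q $ i * e1 q x))" for i t x
  define gt where "gt t x = (\<Sum>q\<in>Q. a' q t * e q x)" for t x
  have da: "((\<lambda>t. a q t) has_real_derivative a' q t) (at t within {0..})" if "q \<in> Q" "0 \<le> t" for q t
    unfolding a_def a'_def e_def by (intro DERIV_cmult mode_derivative Q that)
  have ca: "continuous_on {0..} (a q)" if "q \<in> Q" for q
    using da[OF that] by (auto simp: continuous_on_eq_continuous_within intro: DERIV_continuous)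
  have ca': "continuous_on {0..} (a' q)" if "q \<in> Q" for q
    unfolding a'_def by (intro continuous_intros continuous_mode_rate Q that)
  have conv_repr: "torus_conv (mollifier n) h x = (\<Sum>q\<in>Q. c q * (LINT y|torus. h y * e q y) * e q x)" if "integrable torus h" for h x
    unfolding e_def by (rule conv_mollifier_repr[OF Q repr that])
  have gmoll: "moll n t = g t" if "0 \<le> t" for t
    unfolding g_def a_def using conv_repr[OF flow_integrable[OF that]] by (auto simp: mult.commute)
  have fF: "integrable torus (\<lambda>y. f t y * force (f t) i y)" if "0 \<le> t" for t i
    using tcont_integrable_mult[OF tcont_force[OF flow_integrable[OF that]] flow_integrable[OF that]] by simp
  define m where "m i t = torus_conv (mollifier n) (\<lambda>y. f t y * force (f t) i y)" for i t
  have m_eq: "m i t = (\<lambda>x. \<Sum>q\<in>Q. b i q t * e q x)" if "0 \<le> t" for i t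
    unfolding m_def b_def using conv_repr[OF fF[OF that]] by auto
  have tg: "tcont (g t)" "tcont (g1 i t)" "tcont (g2 i t)" "tcont (m1 i t)" "tcont (gt t)" for i t
    unfolding g_def g1_def g2_def m1_def gt_def by (intro tcont_sum tcont_mult tcont_const te; assumption)+
  have dg: "has_pd i (g t) (g1 i t)" "has_pd i (g1 i t) (g2 i t)" for i t
    unfolding g_def g1_def g2_def by (intro has_pd_sum has_pd_cmult de)+
  have dm: "has_pd i (m i t) (m1 i t)" if "0 \<le> t" for i t
    unfolding m_eq[OF that] m1_def by (intro has_pd_sum has_pd_cmult de)
  have tm: "tcont (m i t)" if "0 \<le> t" for i t
    unfolding m_def by (intro tcont_conv tcont_mollifier fF that)
  have gp: "0 < g t x" "(LINT x|torus. g t x) = 1" if "0 \<le> t" for t x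
    using prob_density_conv_mollifier[OF prob[OF that], of n] gmoll[OF that] by auto
  have gt_eq: "gt t x = (\<Sum>i\<in>UNIV. g2 i t x / \<beta> + m1 i t x)" if t: "0 \<le> t" for t x
  proof -
    have lap: "(\<Sum>i\<in>UNIV. g2 i t x / \<beta>) = (\<Sum>q\<in>Q. c q * (- (w q \<bullet> w q) / \<beta> * (LINT y|torus. e q y * f t y)) * e q x)"
      unfolding g2_def sum_divide_distrib
      by (subst sum.swap) (simp add: inner_vec_def a_def sum_distrib_left sum_distrib_right sum_divide_distrib sum_negf mult_ac)
    \<comment> \<open>The weak equation differentiates the test function in \<open>y\<close>,
      whereas \<open>m1\<close> differentiates the kernel in \<open>x\<close>; by
      \<open>transl\<close> the two differ only in sign.\<close>
    have "m1 i t x = (\<Sum>q\<in>Q. - (c q * w q $ i * (LINT y|torus. f t y * force (f t) i y * e1 q y) * e q x))" for i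
    proof -
      have i0: "integrable torus (\<lambda>y. f t y * force (f t) i y * e q y)" "integrable torus (\<lambda>y. f t y * force (f t) i y * e1 q y)" if "q \<in> Q" for q
        using tcont_integrable_mult[OF te(1)[OF that] fF[OF t]] tcont_integrable_mult[OF te(2)[OF that] fF[OF t]] by auto
      have "m1 i t x + (\<Sum>q\<in>Q. c q * w q $ i * (LINT y|torus. f t y * force (f t) i y * e1 q y) * e q x)
        = (\<Sum>q\<in>Q. LINT y|torus. (c q * w q $ i * e1 q x) * (f t y * force (f t) i y * e q y) + (c q * w q $ i * e q x) * (f t y * force (f t) i y * e1 q y))"
        unfolding m1_def b_def sum.distrib[symmetric]
      proof (rule sum.cong[OF refl])
        fix q assume q: "q \<in> Q"
        show "c q * (LINT y|torus. f t y * force (f t) i y * e q y) * (w q $ i * e1 q x) + c q * w q $ i * (LINT y|torus. f t y * force (f t) i y * e1 q y) * e q x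
          = (LINT y|torus. (c q * w q $ i * e1 q x) * (f t y * force (f t) i y * e q y) + (c q * w q $ i * e q x) * (f t y * force (f t) i y * e1 q y))"
          unfolding Bochner_Integration.integral_add[OF integrable_mult_right[OF i0(1)[OF q]] integrable_mult_right[OF i0(2)[OF q]]]
            integral_mult_right_zero by (simp add: mult_ac)
      qed
      also have "\<dots> = (LINT y|torus. (\<Sum>q\<in>Q. (c q * w q $ i * e1 q x) * (f t y * force (f t) i y * e q y) + (c q * w q $ i * e q x) * (f t y * force (f t) i y * e1 q y)))"
        by (rule Bochner_Integration.integral_sum[symmetric]) (intro Bochner_Integration.integrable_add integrable_mult_right i0)
      also have "\<dots> = (LINT y|torus. f t y * force (f t) i y * (\<Sum>q\<in>Q. c q * w q $ i * (e1 q x * e q y + e q x * e1 q y)))"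
        by (rule Bochner_Integration.integral_cong) (auto simp: sum_distrib_left algebra_simps)
      also have "\<dots> = 0" unfolding transl by simp
      finally show ?thesis by (simp add: sum_negf)
    qed
    then have "(\<Sum>i\<in>UNIV. m1 i t x) = (\<Sum>q\<in>Q. - (c q * (\<Sum>i\<in>UNIV. w q $ i * (LINT y|torus. f t y * force (f t) i y * e1 q y)) * e q x))"
      by simp (subst sum.swap, simp add: sum_distrib_left sum_distrib_right sum_negf mult_ac)
    then show ?thesis
      unfolding sum.distrib lap
      by (simp add: gt_def a'_def mode_rate_def e_def e1_def right_diff_distrib left_diff_distrib sum_subtractf sum_negf)
  qed
  \<comment> \<open>The derivative of \<open>a * ln (a / \<mu> x)\<close> with respect to
    \<open>a\<close>, at \<open>a = g t x\<close>.\<close>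
  define L where "L t x = ln (g t x / \<mu> x) + 1" for t x
  define H' where "H' t = (LINT x|torus. gt t x * L t x)" for t
  have comp: "continuous_on ({0..} \<times> UNIV) (\<lambda>z. h (fst z))" if "continuous_on {0..} h" for h :: "real \<Rightarrow> real"
    by (rule continuous_on_compose2[OF that]) (auto intro!: continuous_intros)
  have comp2: "continuous_on ({0..} \<times> UNIV) (\<lambda>z. h (snd z))" if "tcont h" for h :: "real^'d \<Rightarrow> real"
    by (rule continuous_on_compose2[OF tcont_continuous[OF that]]) (auto intro!: continuous_intros)
  have \<mu>nz: "\<mu> x \<noteq> 0" for x using \<mu>_pos[of x] by simp
  have der: "((\<lambda>t. entropy (moll n t)) has_real_derivative H' t) (at t within {0..})" if t: "0 \<le> t" for t
  proof -
    have "((\<lambda>t. LINT x|torus. g t x * ln (g t x / \<mu> x)) has_real_derivative H' t) (at t within {0..})"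
      unfolding H'_def
    proof (rule torus_leibniz)
      fix s :: real and x assume "s \<in> {0..}"
      then have s: "0 \<le> s" by simp
      have dgt: "((\<lambda>t. g t x) has_real_derivative gt s x) (at s within {0..})"
        unfolding g_def gt_def by (rule DERIV_sum) (rule DERIV_cmult_right[OF da], use s in auto)
      have pos: "0 < g s x / \<mu> x" using gp(1)[OF s] \<mu>_pos by simp
      have "((\<lambda>t. ln (g t x / \<mu> x)) has_real_derivative 1 / (g s x / \<mu> x) * (gt s x / \<mu> x)) (at s within {0..})"
        by (rule DERIV_chain2[where f = ln, OF DERIV_ln_divide[OF pos] DERIV_cdivide[OF dgt]])
      from DERIV_mult[OF dgt this]
      show "((\<lambda>t. g t x * ln (g t x / \<mu> x)) has_real_derivative gt s x * L s x) (at s within {0..})"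
        by (rule DERIV_cong) (use gp(1)[OF s, of x] \<mu>nz[of x] in \<open>simp add: L_def algebra_simps\<close>)
    next
      show "continuous_on UNIV (\<lambda>x. g s x * ln (g s x / \<mu> x))" if "s \<in> {0..}" for s
        by (rule tcont_continuous, intro tcont_mult tcont_ln tcont_divide tg tcont_\<mu> \<mu>nz)
           (use gp(1) \<mu>_pos that in auto)
      have cg: "continuous_on ({0..} \<times> UNIV) (\<lambda>z. g (fst z) (snd z))"
        unfolding g_def by (intro continuous_on_sum continuous_on_mult comp comp2 ca te)
      have cgt: "continuous_on ({0..} \<times> UNIV) (\<lambda>z. gt (fst z) (snd z))"
        unfolding gt_def by (intro continuous_on_sum continuous_on_mult comp comp2 ca' te)
      show "continuous_on ({0..} \<times> UNIV) (\<lambda>(t, x). gt t x * L t x)"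
        unfolding split_beta L_def
        by (intro continuous_on_mult continuous_on_add continuous_on_const continuous_on_ln continuous_on_divide cg cgt comp2 tcont_\<mu>)
           (use gp(1) \<mu>_pos \<mu>nz in \<open>auto simp: less_imp_neq[symmetric]\<close>)
    qed (use t in auto)
    then show ?thesis
      unfolding entropy_def
      by (rule has_field_derivative_transform_within[OF _ zero_less_one]) (use t gmoll in auto)
  qed
  have bound: "H' t \<le> - rate \<delta> * entropy (moll n t) + (\<Sum>i\<in>UNIV. commutator_error n (f t) i) / (4 * \<delta>)" if t: "0 \<le> t" for t
  proof -
    have gnz: "g t x \<noteq> 0" for x using gp(1)[OF t, of x] by simp
    define l where "l i x = g1 i t x / g t x + \<beta> * dU i x" for i x
    have tl: "tcont (l i)" for i
      unfolding l_def[abs_def] by (intro tcont_add tcont_mult tcont_divide tcont_const tg gnz tcont_dU)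
    have tL: "tcont (L t)"
      unfolding L_def[abs_def] by (intro tcont_add tcont_ln tcont_divide tcont_const tg tcont_\<mu> \<mu>nz divide_pos_pos gp t \<mu>_pos)
    have dL: "has_pd i (L t) (l i)" for i
    proof -
      have "has_pd i (\<lambda>x. ln (g t x) - ln (\<mu> x) + 1) (\<lambda>x. g1 i t x / g t x - (- \<beta> * dU i x * \<mu> x) / \<mu> x + 0)"
        by (intro has_pd_add has_pd_diff has_pd_ln dg has_pd_\<mu> gp t \<mu>_pos has_pd_const)
      moreover have "L t = (\<lambda>x. ln (g t x) - ln (\<mu> x) + 1)"
        using gp(1)[OF t] \<mu>_pos by (simp add: L_def[abs_def] ln_div gnz \<mu>nz)
      ultimately show ?thesis by (elim ssubst) (rule has_pd_cong, assumption, simp add: l_def \<mu>nz)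
    qed
    have tf: "tcont (\<lambda>x. g1 i t x / \<beta> + m i t x)" "tcont (\<lambda>x. g2 i t x / \<beta> + m1 i t x)" for i
      using \<beta> by (intro tcont_add tcont_divide tcont_const tg tm t; simp)+
    have df: "has_pd i (\<lambda>x. g1 i t x / \<beta> + m i t x) (\<lambda>x. g2 i t x / \<beta> + m1 i t x)" for i
      using has_pd_add[OF has_pd_cmult[OF dg(2)[of i t], of "1 / \<beta>"] dm[OF t]] by simp
    have "H' t = (LINT x|torus. (\<Sum>i\<in>UNIV. L t x * (g2 i t x / \<beta> + m1 i t x)))"
      unfolding H'_def gt_eq[OF t] by (simp add: sum_distrib_left mult.commute)
    also have "\<dots> = (\<Sum>i\<in>UNIV. LINT x|torus. L t x * (g2 i t x / \<beta> + m1 i t x))"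
      by (rule Bochner_Integration.integral_sum) (intro tcont_integrable tcont_mult tL tf)
    also have "\<dots> = (\<Sum>i\<in>UNIV. - (LINT x|torus. l i x * (g1 i t x / \<beta> + m i t x)))"
      by (intro sum.cong refl integral_torus_by_parts[OF tL tl dL tf df])
    also have "\<dots> = - (\<Sum>i\<in>UNIV. LINT x|torus. (g1 i t x / \<beta> + m i t x) * (g1 i t x / g t x + \<beta> * dU i x))"
      by (simp add: sum_negf l_def mult.commute)
    also have "\<dots> \<le> - rate \<delta> * entropy (moll n t) + (\<Sum>i\<in>UNIV. commutator_error n (f t) i) / (4 * \<delta>)"
      using dissipation[OF prob[OF t] \<delta>, of n "\<lambda>i. g1 i t"] dg(1) tg(2) unfolding gmoll[OF t] m_def by simp
    finally show ?thesis .
  qed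
  show thesis by (rule that[OF der bound])
qed

text \<open>Gronwall's argument: with the integrating factor \<open>exp (rate \<delta> * s)\<close>,
  the linear function \<open>A * s\<close> minus the weighted entropy is nondecreasing.\<close>

lemma entropy_decay:
  assumes \<delta>: "0 < \<delta>" "\<delta> < 1 / \<beta>" and t: "0 \<le> t"
    and err: "\<And>h. prob_density h \<Longrightarrow> (\<Sum>i\<in>UNIV. commutator_error n h i) \<le> \<kappa>" and \<kappa>: "0 \<le> \<kappa>"
  shows "exp (rate \<delta> * t) * entropy (moll n t) \<le> entropy (moll n 0) + \<kappa> / (4 * \<delta>) * exp (\<bar>rate \<delta>\<bar> * t) * t"
proof -
  obtain H' where H': "\<And>t. 0 \<le> t \<Longrightarrow> ((\<lambda>t. entropy (moll n t)) has_real_derivative H' t) (at t within {0..})"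
    "\<And>t. 0 \<le> t \<Longrightarrow> H' t \<le> - rate \<delta> * entropy (moll n t) + (\<Sum>i\<in>UNIV. commutator_error n (f t) i) / (4 * \<delta>)"
    using entropy_derivative[OF \<delta>] by blast
  \<comment> \<open>The sign of \<open>rate \<delta>\<close> is not known;
    \<open>\<bar>rate \<delta>\<bar> * t\<close> bounds \<open>rate \<delta> * s\<close> for all
    \<open>s\<close> between 0 and \<open>t\<close>.\<close>
  define A where "A = \<kappa> / (4 * \<delta>) * exp (\<bar>rate \<delta>\<bar> * t)"
  define \<psi> where "\<psi> s = A * s - exp (rate \<delta> * s) * entropy (moll n s)" for s
  define \<psi>' where "\<psi>' s = A - (rate \<delta> * exp (rate \<delta> * s) * entropy (moll n s) + H' s * exp (rate \<delta> * s))" for s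
  have d: "(\<psi> has_real_derivative \<psi>' s) (at s within {0..})" if "0 \<le> s" for s
    unfolding \<psi>_def[abs_def] \<psi>'_def
    by (rule derivative_eq_intros H'(1)[OF that] refl | simp)+
  have nn: "0 \<le> \<psi>' s" if s: "0 \<le> s" "s \<le> t" for s
  proof -
    have "(\<Sum>i\<in>UNIV. commutator_error n (f s) i) / (4 * \<delta>) \<le> \<kappa> / (4 * \<delta>)"
      using err[OF prob[OF s(1)]] \<delta> by (intro divide_right_mono) auto
    then have "H' s + rate \<delta> * entropy (moll n s) \<le> \<kappa> / (4 * \<delta>)"
      using H'(2)[OF s(1)] by linarith
    then have "exp (rate \<delta> * s) * (H' s + rate \<delta> * entropy (moll n s)) \<le> exp (rate \<delta> * s) * (\<kappa> / (4 * \<delta>))"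
      by (intro mult_left_mono) auto
    also have "\<dots> \<le> exp (\<bar>rate \<delta>\<bar> * t) * (\<kappa> / (4 * \<delta>))"
    proof (intro mult_right_mono)
      have "rate \<delta> * s \<le> \<bar>rate \<delta>\<bar> * t" using s by (intro mult_mono) auto
      then show "exp (rate \<delta> * s) \<le> exp (\<bar>rate \<delta>\<bar> * t)" by simp
    qed (use \<kappa> \<delta> in simp)
    finally show ?thesis by (simp add: \<psi>'_def A_def algebra_simps)
  qed
  have "\<psi> 0 \<le> \<psi> t"
  proof (rule DERIV_nonneg_imp_increasing_open[of 0 t \<psi>])
    show "continuous_on {0..t} \<psi>"
      using d by (intro continuous_on_subset[of "{0..}" \<psi> "{0..t}"])
        (auto simp: continuous_on_eq_continuous_within intro: DERIV_continuous)
    fix s assume "0 < s" "s < t"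
    then show "\<exists>y. (\<psi> has_real_derivative y) (at s) \<and> 0 \<le> y"
      using d[of s] nn[of s] at_within_interior[of s "{0..}"] by (auto simp: interior_real_atLeast)
  qed (use t in auto)
  then show ?thesis by (simp add: \<psi>_def A_def)
qed

end

subsection \<open>Approximation in \<open>L\<^sup>1\<close>\<close>

text \<open>The lattice is closed, and adding a compact set keeps it closed. The sum is the
  periodization of \<open>T\<close>, to which a periodic distance function is attached.\<close>

lemma closed_lattice_sums:
  assumes "compact (T :: (real^'d) set)"
  shows "closed (\<Union>x\<in>range lattice_vec. \<Union>y\<in>T. {x + y})"
proof (rule closed_compact_sums[OF _ assms])
  have "range lattice_vec = (\<Inter>i. {x::real^'d. x $ i \<in> \<int>})"
  proof (intro equalityI subsetI)
    fix x :: "real^'d" assume "x \<in> (\<Inter>i. {x. x $ i \<in> \<int>})"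
    then have "\<And>i. x $ i \<in> \<int>" by blast
    then have "x = lattice_vec (\<chi> i. \<lfloor>x $ i\<rfloor>)" by (auto simp: vec_eq_iff elim!: Ints_cases)
    then show "x \<in> range lattice_vec" by blast
  qed auto
  also have "closed \<dots>"
  proof (intro closed_INT ballI)
    fix i
    have "closed ((\<lambda>x::real^'d. x $ i) -` \<int>)"
      by (intro closed_vimage closed_Ints continuous_intros)
    then show "closed {x::real^'d. x $ i \<in> \<int>}" by (simp add: vimage_def)
  qed
  finally show "closed (range (lattice_vec :: int^'d \<Rightarrow> real^'d))" .
qed

text \<open>Inner regularity supplies a compact \<open>T\<close> inside \<open>A\<close> that misses
  little of it. Its periodization \<open>P\<close> is closed, and the periodic functions
  \<open>max 0 (1 - m * infdist x P)\<close> converge to the indicator of \<open>P\<close>, which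
  agrees with that of \<open>T\<close> on the cube.\<close>

lemma indicator_approx:
  assumes A: "A \<in> sets (torus :: (real^'d) measure)" and e: "0 < (e::real)"
  obtains \<psi> where "tcont \<psi>" "(LINT x|torus. \<bar>indicator A x - \<psi> x\<bar>) < e"
proof -
  have sets: "B \<in> sets borel \<Longrightarrow> B \<subseteq> cbox 0 1 \<Longrightarrow> B \<in> sets (torus :: (real^'d) measure)" for B
    by (auto simp: torus_def sets_restrict_space_iff)
  have A': "A \<in> sets borel" "A \<subseteq> cbox 0 1"
    using A by (auto simp: torus_def sets_restrict_space_iff)
  \<comment> \<open>The intersection with the open box loses a null set only, and keeps the other
    lattice translates of \<open>T\<close> from touching the faces of the cube.\<close>
  define S where "S = A \<inter> box 0 1"
  have S: "S \<in> sets borel" using A' by (simp add: S_def)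
  then have SL: "S \<in> sets lebesgue" by simp
  have "0 < e / 2" using e by simp
  obtain T where T: "closed T" "T \<subseteq> S" "emeasure lebesgue (S - T) < ennreal (e / 2)"
    by (rule sets_lebesgue_inner_closed[OF SL \<open>0 < e / 2\<close>]) (rule that)
  have Tc: "compact T"
    using T(1,2) bounded_subset[OF bounded_box[of 0 1], of T] by (auto simp: compact_eq_bounded_closed S_def)
  have Tb: "T \<in> sets borel" using T(1) by simp
  have "emeasure torus (A - T) = emeasure lborel (A - T)"
    unfolding torus_def using A' by (intro emeasure_restrict_space) auto
  also have "\<dots> \<le> emeasure lborel ((S - T) \<union> (cbox 0 1 - box 0 1))"
    using A' S Tb by (intro emeasure_mono) (auto simp: S_def)
  also have "\<dots> \<le> emeasure lborel (S - T) + emeasure lborel (cbox (0::real^'d) 1 - box 0 1)"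
    using S Tb by (intro emeasure_subadditive) auto
  also have "emeasure lborel (cbox (0::real^'d) 1 - box 0 1) = 0"
    using emeasure_Diff[of lborel "box (0::real^'d) 1" "cbox 0 1"]
    by (simp add: emeasure_lborel_box_eq emeasure_lborel_cbox_eq box_subset_cbox)
  also have "emeasure lborel (S - T) = emeasure lebesgue (S - T)"
    using S Tb by (simp add: emeasure_completion)
  finally have "emeasure torus (A - T) < ennreal (e / 2)" using T(3) by simp
  then have AT: "measure torus (A - T) < e / 2"
    using e by (simp add: torus.emeasure_eq_measure ennreal_less_iff)
  show thesis
  proof (cases "T = {}")
    \<comment> \<open>The distance to the empty set is 0 by convention and would make the functions
      \<open>\<psi>\<close> below constantly 1; the zero function serves instead.\<close>
    case True
    show thesis
      by (rule that[of "\<lambda>_. 0"]) (use True AT e A in \<open>auto simp: Int_absorb2 A'\<close>)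
  next
    case False
    define P where "P = (\<Union>x\<in>range lattice_vec. \<Union>y\<in>T. {x + y})"
    have P: "closed P" "P \<noteq> {}" using closed_lattice_sums[OF Tc] False by (auto simp: P_def)
    have Pper: "x + lattice_vec k \<in> P \<longleftrightarrow> x \<in> P" for x k
    proof -
      have "x + lattice_vec k \<in> P" if "x \<in> P" for x k
      proof -
        from that obtain l y where "x = lattice_vec l + y" "y \<in> T" by (auto simp: P_def)
        then have "x + lattice_vec k = lattice_vec (l + k) + y" by (simp add: vec_eq_iff)
        then show ?thesis using \<open>y \<in> T\<close> unfolding P_def by blast
      qed
      moreover have "x + lattice_vec k + lattice_vec (- k) = x" by (simp add: vec_eq_iff)
      ultimately show ?thesis by metis
    qed
    have PT: "x \<in> P \<longleftrightarrow> x \<in> T" if x: "x \<in> cbox 0 1" for x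
    proof
      assume "x \<in> P"
      then obtain l y where ly: "x = lattice_vec l + y" "y \<in> T" by (auto simp: P_def)
      then have y: "y \<in> box 0 1" using T(2) by (auto simp: S_def)
      have "l $ i = 0" for i
      proof -
        have "real_of_int (l $ i) = x $ i - y $ i" using ly(1) by simp
        moreover have "0 \<le> x $ i \<and> x $ i \<le> 1 \<and> 0 < y $ i \<and> y $ i < 1"
          using x y by (auto simp: mem_box_cart)
        ultimately have "\<bar>real_of_int (l $ i)\<bar> < 1" by linarith
        then show ?thesis by linarith
      qed
      then have "x = y" using ly(1) by (simp add: vec_eq_iff)
      then show "x \<in> T" using ly by simp
    next
      assume "x \<in> T"
      moreover have "x = lattice_vec 0 + x" by (simp add: vec_eq_iff)
      ultimately show "x \<in> P" unfolding P_def by blast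
    qed
    define \<psi> where "\<psi> m x = max 0 (1 - real m * infdist x P)" for m x
    have "infdist (x + lattice_vec k) P = infdist x P" for x k
    proof -
      have "dist (x + lattice_vec k) ` P = dist x ` P"
      proof (intro equalityI subsetI; elim imageE)
        fix r a assume "r = dist (x + lattice_vec k) a" "a \<in> P"
        moreover have "dist (x + lattice_vec k) a = dist x (a + lattice_vec (- k))"
        proof -
          have "x + lattice_vec k - a = x - (a + lattice_vec (- k))" by (simp add: vec_eq_iff)
          then show ?thesis by (simp only: dist_norm)
        qed
        ultimately show "r \<in> dist x ` P" using Pper[of a "- k"] by blast
      next
        fix r a assume "r = dist x a" "a \<in> P"
        moreover have "dist x a = dist (x + lattice_vec k) (a + lattice_vec k)" by simp
        ultimately show "r \<in> dist (x + lattice_vec k) ` P" using Pper[of a k] by blast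
      qed
      then show ?thesis using P(2) by (simp add: infdist_notempty)
    qed
    then have t\<psi>: "tcont (\<psi> m)" for m
      unfolding tcont_def lattice_periodic_def \<psi>_def by (auto intro!: continuous_intros)
    have \<psi>01: "0 \<le> \<psi> m x" "\<psi> m x \<le> 1" for m x
      by (auto simp: \<psi>_def infdist_nonneg)
    have lim: "(\<lambda>m. \<psi> m x) \<longlonglongrightarrow> indicator P x" for x
    proof (cases "x \<in> P")
      case True
      then show ?thesis by (simp add: \<psi>_def)
    next
      case False
      then have d: "0 < infdist x P" using infdist_pos_not_in_closed[OF P] by blast
      obtain N :: nat where N: "1 / infdist x P < real N" using reals_Archimedean2 by blast
      have "\<psi> m x = 0" if "m \<ge> N" for m
      proof -
        have "1 / infdist x P \<le> real m" using N that by linarith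
        then show ?thesis using d by (simp add: \<psi>_def field_simps)
      qed
      then have "\<forall>\<^sub>F m in sequentially. \<psi> m x = 0" by (auto simp: eventually_sequentially)
      then show ?thesis using False by (auto intro: tendsto_eventually)
    qed
    have Ts: "T \<in> sets torus" using Tb T(2) A' by (intro sets) (auto simp: S_def)
    have "(\<lambda>m. LINT x|torus. \<bar>indicator A x - \<psi> m x\<bar>) \<longlonglongrightarrow> (LINT x|torus. indicator (A - T) x)"
    proof (rule integral_dominated_convergence[where w = "\<lambda>_. 1"])
      show "AE x in torus. (\<lambda>m. \<bar>indicator A x - \<psi> m x\<bar>) \<longlonglongrightarrow> indicator (A - T) x"
      proof (rule AE_I2)
        fix x :: "real^'d" assume x: "x \<in> space torus"
        have "(\<lambda>m. \<bar>indicator A x - \<psi> m x\<bar>) \<longlonglongrightarrow> \<bar>indicator A x - indicator P x\<bar>"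
          by (intro tendsto_intros lim)
        moreover have "\<bar>indicator A x - indicator P x\<bar> = (indicator (A - T) x :: real)"
          using x PT[of x] T(2) by (auto simp: indicator_def S_def)
        ultimately show "(\<lambda>m. \<bar>indicator A x - \<psi> m x\<bar>) \<longlonglongrightarrow> indicator (A - T) x" by simp
      qed
      show "AE x in torus. norm \<bar>indicator A x - \<psi> m x\<bar> \<le> 1" for m
      proof (rule AE_I2)
        fix x show "norm \<bar>indicator A x - \<psi> m x\<bar> \<le> 1"
          using \<psi>01[of m x] by (simp add: indicator_def abs_le_iff)
      qed
      show "(\<lambda>x. \<bar>indicator A x - \<psi> m x\<bar>) \<in> borel_measurable torus" for m
        using measurable_torus[OF tcont_measurable[OF t\<psi>[of m]]] A by measurable
      show "(indicator (A - T) :: real^'d \<Rightarrow> real) \<in> borel_measurable torus" using A Ts by measurable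
    qed simp
    also have "(LINT x|torus. indicator (A - T) x) = measure torus (A - T)"
    proof -
      have "(A - T) \<inter> cbox 0 1 = A - T" using A' by auto
      then show ?thesis by simp
    qed
    finally have "(\<lambda>m. LINT x|torus. \<bar>indicator A x - \<psi> m x\<bar>) \<longlonglongrightarrow> measure torus (A - T)" .
    moreover have "measure torus (A - T) < e" using AT e by linarith
    ultimately have "\<forall>\<^sub>F m in sequentially. (LINT x|torus. \<bar>indicator A x - \<psi> m x\<bar>) < e"
      by (rule order_tendstoD(2))
    then obtain m where "(LINT x|torus. \<bar>indicator A x - \<psi> m x\<bar>) < e"
      by (auto simp: eventually_sequentially)
    then show thesis by (rule that[OF t\<psi>])
  qed
qed

lemma tcont_dense_L1:
  fixes u :: "real^'d \<Rightarrow> real"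
  assumes "integrable torus u"
  shows "\<forall>e>0. \<exists>c. tcont c \<and> (LINT x|torus. \<bar>u x - c x\<bar>) < e"
  using assms
proof (induction rule: integrable_induct)
  case (base A r)
  show ?case
  proof (intro allI impI)
    fix e :: real assume "0 < e"
    then have "0 < e / (\<bar>r\<bar> + 1)" by simp
    from indicator_approx[OF base(1) this] obtain \<psi> where
      \<psi>: "tcont \<psi>" "(LINT x|torus. \<bar>indicator A x - \<psi> x\<bar>) < e / (\<bar>r\<bar> + 1)" by blast
    have "\<bar>indicator A x *\<^sub>R r - r * \<psi> x\<bar> = \<bar>r\<bar> * \<bar>indicator A x - \<psi> x\<bar>" for x
      by (simp add: right_diff_distrib mult.commute flip: abs_mult)
    then have "(LINT x|torus. \<bar>indicator A x *\<^sub>R r - r * \<psi> x\<bar>) = \<bar>r\<bar> * (LINT x|torus. \<bar>indicator A x - \<psi> x\<bar>)"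
      by simp
    also have "\<dots> \<le> \<bar>r\<bar> * (e / (\<bar>r\<bar> + 1))" using \<psi>(2) by (intro mult_left_mono) auto
    also have "\<dots> < e" using mult_divide_succ_less[OF \<open>0 < e\<close>, of "\<bar>r\<bar>"] by (simp add: mult.commute)
    finally show "\<exists>c. tcont c \<and> (LINT x|torus. \<bar>indicator A x *\<^sub>R r - c x\<bar>) < e"
      using \<psi>(1) by (intro exI[of _ "\<lambda>x. r * \<psi> x"]) auto
  qed
next
  case (add u v)
  show ?case
  proof (intro allI impI)
    fix e :: real assume "0 < e"
    then have "0 < e / 2" by simp
    with add obtain b c where b: "tcont b" "(LINT x|torus. \<bar>u x - b x\<bar>) < e / 2"
      and c: "tcont c" "(LINT x|torus. \<bar>v x - c x\<bar>) < e / 2" by meson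
    note i = add(1,2) tcont_integrable[OF b(1)] tcont_integrable[OF c(1)]
    have "(LINT x|torus. \<bar>(u x + v x) - (b x + c x)\<bar>) \<le> (LINT x|torus. \<bar>u x - b x\<bar> + \<bar>v x - c x\<bar>)"
      using i by (intro integral_mono) auto
    also have "\<dots> = (LINT x|torus. \<bar>u x - b x\<bar>) + (LINT x|torus. \<bar>v x - c x\<bar>)"
      using i by (intro Bochner_Integration.integral_add) auto
    also have "\<dots> < e" using b c by linarith
    finally show "\<exists>d. tcont d \<and> (LINT x|torus. \<bar>(u x + v x) - d x\<bar>) < e"
      using tcont_add[OF b(1) c(1)] by blast
  qed
next
  case (lim u s)
  show ?case
  proof (intro allI impI)
    fix e :: real assume "0 < e"
    have [measurable]: "u \<in> borel_measurable torus" "s i \<in> borel_measurable torus" for i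
      using lim by auto
    have "(\<lambda>i. LINT x|torus. \<bar>u x - s i x\<bar>) \<longlonglongrightarrow> (LINT x|(torus :: (real^'d) measure). 0)"
    proof (rule integral_dominated_convergence[where w = "\<lambda>x. 3 * \<bar>u x\<bar>"])
      show "AE x in torus. (\<lambda>i. \<bar>u x - s i x\<bar>) \<longlonglongrightarrow> 0"
      proof (rule AE_I2)
        fix x :: "real^'d" assume "x \<in> space torus"
        from tendsto_rabs[OF tendsto_diff[OF tendsto_const[of "u x"] lim(2)[OF this]]]
        show "(\<lambda>i. \<bar>u x - s i x\<bar>) \<longlonglongrightarrow> 0" by simp
      qed
      show "AE x in torus. norm \<bar>u x - s i x\<bar> \<le> 3 * \<bar>u x\<bar>" for i
      proof (rule AE_I2)
        fix x :: "real^'d" assume "x \<in> space torus"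
        then have "\<bar>s i x\<bar> \<le> 2 * \<bar>u x\<bar>" using lim(3)[of x i] by simp
        then show "norm \<bar>u x - s i x\<bar> \<le> 3 * \<bar>u x\<bar>"
          using abs_triangle_ineq4[of "u x" "s i x"] by simp
      qed
    qed (use lim(4) in auto)
    then have "\<forall>\<^sub>F i in sequentially. (LINT x|torus. \<bar>u x - s i x\<bar>) < e / 2"
      using \<open>0 < e\<close> by (intro order_tendstoD(2)) auto
    then obtain i where i: "(LINT x|torus. \<bar>u x - s i x\<bar>) < e / 2" by (auto simp: eventually_sequentially)
    obtain c where c: "tcont c" "(LINT x|torus. \<bar>s i x - c x\<bar>) < e / 2"
      using lim(5)[of i] \<open>0 < e\<close> by (meson half_gt_zero)
    note int = lim(4) lim(1)[of i] tcont_integrable[OF c(1)]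
    have "(LINT x|torus. \<bar>u x - c x\<bar>) \<le> (LINT x|torus. \<bar>u x - s i x\<bar> + \<bar>s i x - c x\<bar>)"
      using int by (intro integral_mono) auto
    also have "\<dots> = (LINT x|torus. \<bar>u x - s i x\<bar>) + (LINT x|torus. \<bar>s i x - c x\<bar>)"
      using int by (intro Bochner_Integration.integral_add) auto
    also have "\<dots> < e" using i c by linarith
    finally show "\<exists>c. tcont c \<and> (LINT x|torus. \<bar>u x - c x\<bar>) < e" using c(1) by blast
  qed
qed

section \<open>Mollification of integrable functions\<close>

lemma conv_mollifier_L1_le:
  fixes u :: "real^'d \<Rightarrow> real"
  assumes u: "integrable torus u"
  shows "(LINT x|torus. \<bar>torus_conv (mollifier n) u x\<bar>) \<le> (LINT x|torus. \<bar>u x\<bar>)"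
proof -
  obtain B where B: "\<And>z::real^'d. norm (mollifier n z) \<le> B" using tcont_bounded[OF tcont_mollifier] by metis
  note fub = torus_fubini[OF measurable_pair_diff[OF tcont_mollifier] B[unfolded real_norm_def] integrable_abs[OF u]]
  have "(LINT x|torus. \<bar>torus_conv (mollifier n) u x\<bar>) \<le> (LINT x|torus. LINT y|torus. \<bar>u y\<bar> * mollifier n (x - y))"
  proof (rule integral_mono[OF _ fub(2)])
    show "integrable torus (\<lambda>x. \<bar>torus_conv (mollifier n) u x\<bar>)"
      by (intro tcont_integrable tcont_abs tcont_conv tcont_mollifier u)
    fix x
    have "\<bar>torus_conv (mollifier n) u x\<bar> \<le> (LINT y|torus. \<bar>u y * mollifier n (x - y)\<bar>)"
      unfolding torus_conv_real by (rule integral_abs_bound)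
    then show "\<bar>torus_conv (mollifier n) u x\<bar> \<le> (LINT y|torus. \<bar>u y\<bar> * mollifier n (x - y))"
      by (simp add: abs_mult abs_of_pos[OF mollifier_pos])
  qed
  also have "\<dots> = (LINT x|torus. \<bar>u x\<bar>)"
    unfolding fub(1)
    by (simp add: integral_torus_diff[OF tcont_measurable[OF tcont_mollifier] tcont_periodic[OF tcont_mollifier]] integral_mollifier)
  finally show ?thesis .
qed

text \<open>A continuous approximation \<open>c\<close> is mollified with uniformly small error. The
  remainder \<open>u - c\<close> contributes twice, once as it stands and once mollified, where the
  L1 norm does not grow.\<close>

lemma conv_mollifier_L1:
  fixes u :: "real^'d \<Rightarrow> real"
  assumes u: "integrable torus u"
  shows "(\<lambda>n. LINT x|torus. \<bar>torus_conv (mollifier n) u x - u x\<bar>) \<longlonglongrightarrow> 0"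
proof (rule LIMSEQ_I)
  fix r :: real assume r: "0 < r"
  then have "0 < r / 4" by simp
  then obtain c where c: "tcont c" "(LINT x|torus. \<bar>u x - c x\<bar>) < r / 4"
    using tcont_dense_L1[OF u] by meson
  note ic = tcont_integrable[OF c(1)]
  have "\<forall>\<^sub>F n in sequentially. \<forall>x. \<bar>torus_conv (mollifier n) c x - c x\<bar> \<le> r / 4"
    by (rule conv_mollifier_uniform[OF c(1)]) (use r in simp)
  then have "\<forall>\<^sub>F n in sequentially. norm ((LINT x|torus. \<bar>torus_conv (mollifier n) u x - u x\<bar>) - 0) < r"
  proof eventually_elim
    case (elim n)
    let ?d = "\<lambda>y. u y - c y"
    have id: "integrable torus ?d" using u ic by auto
    have tc: "tcont (torus_conv (mollifier n) ?d)" "tcont (torus_conv (mollifier n) u)"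
      by (intro tcont_conv tcont_mollifier id u)+
    have "(LINT x|torus. \<bar>torus_conv (mollifier n) u x - u x\<bar>)
      \<le> (LINT x|torus. \<bar>torus_conv (mollifier n) ?d x\<bar> + \<bar>u x - c x\<bar> + r / 4)"
    proof (rule integral_mono)
      fix x
      have "torus_conv (mollifier n) ?d x = torus_conv (mollifier n) u x - torus_conv (mollifier n) c x"
        by (rule conv_diff[OF tcont_mollifier tcont_mollifier u ic])
      then show "\<bar>torus_conv (mollifier n) u x - u x\<bar> \<le> \<bar>torus_conv (mollifier n) ?d x\<bar> + \<bar>u x - c x\<bar> + r / 4"
        using elim[rule_format, of x] by linarith
    qed (use tcont_integrable[OF tc(1)] tcont_integrable[OF tc(2)] id u in auto)
    also have "\<dots> = (LINT x|torus. \<bar>torus_conv (mollifier n) ?d x\<bar>) + (LINT x|torus. \<bar>u x - c x\<bar>) + r / 4"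
      using tcont_integrable[OF tcont_abs[OF tc(1)]] id by simp
    also have "\<dots> \<le> (LINT x|torus. \<bar>u x - c x\<bar>) + (LINT x|torus. \<bar>u x - c x\<bar>) + r / 4"
      using conv_mollifier_L1_le[OF id, of n] by simp
    also have "\<dots> < r" using c(2) r by linarith
    finally show ?case by simp
  qed
  then show "\<exists>N. \<forall>n\<ge>N. norm ((LINT x|torus. \<bar>torus_conv (mollifier n) u x - u x\<bar>) - 0) < r"
    by (simp add: eventually_sequentially)
qed

subsection \<open>Passing to the limit\<close>

text \<open>Densities may vanish, so the case \<open>b = 0\<close> matters: there
  \<open>r = a / m\<close> satisfies \<open>\<bar>r * ln r\<bar> \<le> 2 * sqrt r\<close> once it is
  below 1, by the bound \<open>ln y \<le> y\<close> at \<open>y = 1 / sqrt r\<close>.\<close>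

lemma xlnx_tendsto:
  fixes a :: "nat \<Rightarrow> real"
  assumes lim: "a \<longlonglongrightarrow> b" and pos: "\<And>n. 0 < a n" and m: "0 < m"
  shows "(\<lambda>n. a n * ln (a n / m)) \<longlonglongrightarrow> b * ln (b / m)"
proof (cases "b = 0")
  case False
  moreover have "0 \<le> b" using LIMSEQ_le_const[OF lim] pos by (meson less_imp_le)
  ultimately show ?thesis using m by (intro tendsto_intros lim) auto
next
  case True
  define r where "r n = a n / m" for n
  have r0: "0 < r n" for n using pos m by (simp add: r_def)
  have rl: "r \<longlonglongrightarrow> 0" using tendsto_divide[OF lim tendsto_const, of m] m True by (simp add: r_def[abs_def])
  have "(\<lambda>n. r n * ln (r n)) \<longlonglongrightarrow> 0"
  proof (rule Lim_null_comparison)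
    show "(\<lambda>n. 2 * sqrt (r n)) \<longlonglongrightarrow> 0"
      using tendsto_mult[OF tendsto_const[of 2] tendsto_real_sqrt[OF rl]] by simp
    have "\<forall>\<^sub>F n in sequentially. r n < 1" using rl by (intro order_tendstoD(2)[of _ 0]) auto
    then show "\<forall>\<^sub>F n in sequentially. norm (r n * ln (r n)) \<le> 2 * sqrt (r n)"
    proof eventually_elim
      case (elim n)
      have s: "0 < sqrt (r n)" using r0 by simp
      have "ln (1 / sqrt (r n)) \<le> 1 / sqrt (r n)" using ln_le_minus_one[of "1 / sqrt (r n)"] s by simp
      then have "- ln (r n) \<le> 2 * (1 / sqrt (r n))" using s r0[of n] by (simp add: ln_div ln_sqrt)
      then have "r n * - ln (r n) \<le> r n * (2 * (1 / sqrt (r n)))" using r0[of n] by (intro mult_left_mono) auto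
      also have "\<dots> = 2 * (r n / sqrt (r n))" by simp
      also have "\<dots> = 2 * sqrt (r n)" using r0[of n] by (simp only: real_div_sqrt less_imp_le)
      finally show ?case using r0[of n] elim by (simp add: abs_mult)
    qed
  qed
  from tendsto_mult[OF tendsto_const[of m] this] show ?thesis
    using m True by (simp add: r_def)
qed

context equilibrium
begin

text \<open>The Bregman divergence of \<open>a ln a\<close> between \<open>h x\<close> and
  \<open>\<mu> x\<close>. The added terms integrate to zero when \<open>h\<close> is a density, and
  they make the function nonnegative.\<close>

definition excess :: "(real^'d \<Rightarrow> real) \<Rightarrow> real^'d \<Rightarrow> real" where
  "excess h x = h x * ln (h x / \<mu> x) - h x + \<mu> x"

lemma excess_nonneg: "0 \<le> h x \<Longrightarrow> 0 \<le> excess h x"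
proof (cases "h x = 0")
  case False
  assume "0 \<le> h x"
  with False have "0 < h x" by simp
  then show ?thesis
    using sq_diff_sqrt_le[OF _ \<mu>_pos, of "h x" x] zero_le_power2[of "sqrt (h x) - sqrt (\<mu> x)"]
    unfolding excess_def by linarith
qed (simp add: excess_def less_imp_le[OF \<mu>_pos])

lemma xlnx_measurable:
  assumes "h \<in> borel_measurable borel"
  shows "(\<lambda>x. h x * ln (h x / \<mu> x)) \<in> borel_measurable borel"
  by (intro borel_measurable_times borel_measurable_ln borel_measurable_divide assms tcont_measurable tcont_\<mu>)

lemma excess_measurable: "h \<in> borel_measurable borel \<Longrightarrow> excess h \<in> borel_measurable torus"
  unfolding excess_def[abs_def]
  by (intro measurable_torus borel_measurable_add borel_measurable_diff xlnx_measurable tcont_measurable[OF tcont_\<mu>])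

text \<open>The negative part of the entropy integrand is at most \<open>\<mu>\<close> and so has a
  finite integral \<open>N\<close>. The identity for \<open>excess\<close> is rearranged so that all
  terms are nonnegative; the masses of \<open>\<mu>\<close> and \<open>h\<close>, both 1, cancel,
  and then the finite \<open>N\<close>.\<close>

lemma rel_entropy_eq:
  assumes h: "prob_density h"
  shows "rel_entropy h finf = enn2ereal (\<integral>\<^sup>+x. ennreal (excess h x) \<partial>torus)"
proof -
  define \<phi> where "\<phi> x = h x * ln (h x / \<mu> x)" for x
  have hm: "h \<in> borel_measurable borel" by (rule prob_density_measurable[OF h])
  have \<phi>m [measurable]: "\<phi> \<in> borel_measurable torus"
    unfolding \<phi>_def[abs_def] by (intro measurable_torus xlnx_measurable hm)
  have hm' [measurable]: "h \<in> borel_measurable torus" by (rule measurable_torus[OF hm])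
  have \<mu>m [measurable]: "\<mu> \<in> borel_measurable torus" by (intro measurable_torus tcont_measurable tcont_\<mu>)
  have em [measurable]: "excess h \<in> borel_measurable torus" by (rule excess_measurable[OF hm])
  have int: "entropy_integrand (h x) (\<mu> x) = ereal (\<phi> x)" for x
    using \<mu>_pos[of x] by (simp add: entropy_integrand_def \<phi>_def)
  define P where "P = (\<integral>\<^sup>+x. ennreal (\<phi> x) \<partial>torus)"
  define N where "N = (\<integral>\<^sup>+x. ennreal (- \<phi> x) \<partial>torus)"
  have "(\<integral>\<^sup>+x. e2ennreal (entropy_integrand (h x) (finf x)) \<partial>torus) = P"
    unfolding P_def
    by (rule nn_integral_cong_AE) (use AE_finf in \<open>eventually_elim, simp add: int e2ennreal_ereal\<close>)
  moreover have "(\<integral>\<^sup>+x. e2ennreal (- entropy_integrand (h x) (finf x)) \<partial>torus) = N"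
    unfolding N_def
    by (rule nn_integral_cong_AE) (use AE_finf in \<open>eventually_elim, simp add: int e2ennreal_ereal\<close>)
  ultimately have rel: "rel_entropy h finf = enn2ereal P - enn2ereal N"
    by (simp add: rel_entropy_def)
  have I\<mu>: "(\<integral>\<^sup>+x. ennreal (\<mu> x) \<partial>torus) = 1"
    using nn_integral_eq_integral[OF tcont_integrable[OF tcont_\<mu>]] integral_\<mu> by (simp add: less_imp_le[OF \<mu>_pos])
  have Ih: "(\<integral>\<^sup>+x. ennreal (h x) \<partial>torus) = 1"
    using nn_integral_eq_integral[OF prob_density_integrable[OF h]] prob_density_integral[OF h]
    by (simp add: prob_density_nonneg[OF h])
  have "N \<le> (\<integral>\<^sup>+x. ennreal (\<mu> x) \<partial>torus)"
    unfolding N_def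
  proof (rule nn_integral_mono)
    fix x
    show "ennreal (- \<phi> x) \<le> ennreal (\<mu> x)"
      using excess_nonneg[of h x, OF prob_density_nonneg[OF h]] prob_density_nonneg[OF h, of x]
      by (intro ennreal_leI) (simp add: excess_def \<phi>_def)
  qed
  then have N1: "N < \<infinity>" unfolding I\<mu> by (rule le_less_trans) simp
  have "P + 1 = (\<integral>\<^sup>+x. ennreal (\<phi> x) + ennreal (\<mu> x) \<partial>torus)"
    unfolding P_def I\<mu>[symmetric] by (rule nn_integral_add[symmetric]) measurable
  also have "\<dots> = (\<integral>\<^sup>+x. (ennreal (excess h x) + ennreal (- \<phi> x)) + ennreal (h x) \<partial>torus)"
  proof (rule nn_integral_cong)
    fix x
    have 0: "0 \<le> h x" "0 \<le> \<mu> x" "0 \<le> excess h x"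
      using prob_density_nonneg[OF h, of x] \<mu>_pos[of x] excess_nonneg[of h x] by auto
    have ex: "excess h x = \<phi> x - h x + \<mu> x" by (simp add: excess_def \<phi>_def)
    show "ennreal (\<phi> x) + ennreal (\<mu> x) = (ennreal (excess h x) + ennreal (- \<phi> x)) + ennreal (h x)"
    proof (cases "0 \<le> \<phi> x")
      case True
      then have "ennreal (- \<phi> x) = 0" by (simp add: ennreal_neg)
      then show ?thesis using True 0 by (simp add: ex flip: ennreal_plus)
    next
      case False
      then have "ennreal (\<phi> x) = 0" by (simp add: ennreal_neg)
      then show ?thesis using False 0 by (simp add: ex flip: ennreal_plus)
    qed
  qed
  also have "\<dots> = (\<integral>\<^sup>+x. ennreal (excess h x) \<partial>torus) + N + 1"
    unfolding N_def Ih[symmetric] by (simp add: nn_integral_add)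
  finally have "1 + P = 1 + ((\<integral>\<^sup>+x. ennreal (excess h x) \<partial>torus) + N)" by (simp add: ac_simps)
  then have "P = (\<integral>\<^sup>+x. ennreal (excess h x) \<partial>torus) + N"
    by (simp add: ennreal_add_left_cancel)
  moreover have "a + ereal r - ereal r = a" for a r by (cases a) auto
  ultimately show ?thesis
    unfolding rel using N1 by (cases N) (auto simp: plus_ennreal.rep_eq enn2ereal_ennreal)
qed

lemma nn_integral_excess:
  assumes g: "tcont g" "\<And>x. 0 < g x" "(LINT x|torus. g x) = 1"
  shows "(\<integral>\<^sup>+x. ennreal (excess g x) \<partial>torus) = ennreal (entropy g)"
proof -
  have t: "tcont (\<lambda>x. g x * ln (g x / \<mu> x))"
    using g \<mu>_pos by (intro tcont_mult tcont_ln tcont_divide tcont_\<mu>) (auto simp: less_imp_neq[symmetric])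
  have te: "tcont (excess g)" unfolding excess_def[abs_def] by (intro tcont_add tcont_diff t g tcont_\<mu>)
  have "(LINT x|torus. excess g x) = entropy g"
    unfolding excess_def entropy_def
    using tcont_integrable[OF t] tcont_integrable[OF g(1)] tcont_integrable[OF tcont_\<mu>] g(3) integral_\<mu> by simp
  then show ?thesis
    using nn_integral_eq_integral[OF tcont_integrable[OF te]] excess_nonneg[of g, OF less_imp_le[OF g(2)]] by simp
qed

text \<open>The entropy splits into the integrals of \<open>g ln g\<close> and of
  \<open>- g ln \<mu>\<close>. Convexity shows that mollification does not increase the first; in
  the second the even kernel passes from \<open>h\<close> to the continuous function
  \<open>ln \<mu>\<close>, which it changes by at most \<open>\<kappa>\<close>.\<close>

lemma entropy_mollifier_le:
  assumes h: "prob_density h" and e: "integrable torus (excess h)" and \<kappa>: "0 < \<kappa>"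
  shows "\<forall>\<^sub>F n in sequentially. entropy (torus_conv (mollifier n) h) \<le> (LINT x|torus. excess h x) + \<kappa>"
proof -
  note hi = prob_density_integrable[OF h]
  define l where "l x = ln (\<mu> x)" for x
  have tl: "tcont l" unfolding l_def[abs_def] by (intro tcont_ln tcont_\<mu> \<mu>_pos)
  have ihl: "integrable torus (\<lambda>x. h x * l x)" using tcont_integrable_mult[OF tl hi] by simp
  have hlnh: "h x * ln (h x) = excess h x + h x - \<mu> x + h x * l x" for x
  proof (cases "h x = 0")
    case False
    then show ?thesis using \<mu>_pos[of x] prob_density_nonneg[OF h, of x]
      by (simp add: excess_def l_def ln_div algebra_simps)
  qed (simp add: excess_def)
  define \<phi> where "\<phi> x = h x * ln (h x)" for x
  have i\<phi>: "integrable torus \<phi>"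
    unfolding \<phi>_def[abs_def] hlnh using e hi ihl tcont_integrable[OF tcont_\<mu>] by simp
  have I: "(LINT x|torus. \<phi> x) - (LINT x|torus. h x * l x) = (LINT x|torus. excess h x)"
    unfolding \<phi>_def hlnh using e hi ihl tcont_integrable[OF tcont_\<mu>] prob_density_integral[OF h] integral_\<mu> by simp
  have "\<forall>\<^sub>F n in sequentially. \<forall>x. \<bar>torus_conv (mollifier n) l x - l x\<bar> \<le> \<kappa>"
    by (rule conv_mollifier_uniform[OF tl \<kappa>])
  then show ?thesis
  proof eventually_elim
    case (elim n)
    define g where "g = torus_conv (mollifier n) h"
    have g: "tcont g" "\<And>x. 0 < g x" "(LINT x|torus. g x) = 1"
      using prob_density_conv_mollifier[OF h] by (auto simp: g_def)
    obtain B where B: "\<And>z::real^'d. norm (mollifier n z) \<le> B" using tcont_bounded[OF tcont_mollifier] by metis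
    note fub = torus_fubini[OF measurable_pair_diff[OF tcont_mollifier] B[unfolded real_norm_def] i\<phi>]
    have sh: "(LINT x|torus. mollifier n (x - y)) = 1" for y :: "real^'d"
      by (simp add: integral_torus_diff[OF tcont_measurable[OF tcont_mollifier] tcont_periodic[OF tcont_mollifier]] integral_mollifier)
    text \<open>Jensen's inequality, by the tangent of \<open>a ln a\<close> at \<open>g x\<close>.\<close>
    have jensen: "(LINT x|torus. g x * ln (g x)) \<le> (LINT x|torus. \<phi> x)"
    proof -
      have "(LINT x|torus. g x * ln (g x)) \<le> (LINT x|torus. LINT y|torus. \<phi> y * mollifier n (x - y))"
      proof (rule integral_mono[OF _ fub(2)])
        show "integrable torus (\<lambda>x. g x * ln (g x))" by (intro tcont_integrable tcont_xlnx g)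
        fix x :: "real^'d"
        have ir: "integrable torus (\<lambda>y. mollifier n (x - y))" by (intro tcont_integrable tcont_reflect tcont_mollifier)
        have ih: "integrable torus (\<lambda>y. h y * mollifier n (x - y))" by (rule conv_integrable[OF tcont_mollifier hi])
        have "(LINT y|torus. (ln (g x) + 1) * (h y * mollifier n (x - y)) - g x * mollifier n (x - y)) \<le> (LINT y|torus. \<phi> y * mollifier n (x - y))"
        proof (rule integral_mono)
          show "integrable torus (\<lambda>y. \<phi> y * mollifier n (x - y))" by (rule conv_integrable[OF tcont_mollifier i\<phi>])
          fix y
          have "h y * ln (g x) + h y - g x \<le> \<phi> y"
          proof (cases "h y = 0")
            case False
            with prob_density_nonneg[OF h, of y] have hy: "0 < h y" by simp
            have "h y * ln (g x / h y) \<le> h y * (g x / h y - 1)"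
              using hy g(2)[of x] by (intro mult_left_mono ln_le_minus_one) auto
            then show ?thesis using hy g(2)[of x] by (simp add: \<phi>_def ln_div algebra_simps)
          qed (use g(2)[of x] in \<open>simp add: \<phi>_def\<close>)
          then have "(h y * ln (g x) + h y - g x) * mollifier n (x - y) \<le> \<phi> y * mollifier n (x - y)"
            by (rule mult_right_mono) (rule less_imp_le[OF mollifier_pos])
          then show "(ln (g x) + 1) * (h y * mollifier n (x - y)) - g x * mollifier n (x - y) \<le> \<phi> y * mollifier n (x - y)"
            by (simp add: algebra_simps)
        qed (use ir ih in simp)
        also have "(LINT y|torus. (ln (g x) + 1) * (h y * mollifier n (x - y)) - g x * mollifier n (x - y)) = (ln (g x) + 1) * g x - g x"
          using ir ih by (simp add: integral_mollifier_shift g_def torus_conv_real)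
        finally show "g x * ln (g x) \<le> (LINT y|torus. \<phi> y * mollifier n (x - y))" by (simp add: algebra_simps)
      qed
      also have "\<dots> = (LINT y|torus. \<phi> y)" unfolding fub(1) by (simp add: sh)
      finally show ?thesis .
    qed
    have "(LINT x|torus. g x * l x) \<ge> (LINT x|torus. h x * l x) - \<kappa>"
    proof -
      obtain D where D: "\<And>x. norm (l x) \<le> D" using tcont_bounded[OF tl] by metis
      have m: "(\<lambda>(x, y). mollifier n (x - y) * l x) \<in> borel_measurable (borel \<Otimes>\<^sub>M borel)"
        using tcont_measurable[OF tcont_mollifier, of n] tcont_measurable[OF tl] by measurable
      have bd: "\<bar>mollifier n (x - y) * l x\<bar> \<le> B * D" for x y
        unfolding abs_mult using B[of "x - y"] D[of x] order_trans[OF norm_ge_zero B]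
        by (intro mult_mono) auto
      note fub2 = torus_fubini[OF m bd hi]
      have cl: "(LINT x|torus. mollifier n (x - y) * l x) = torus_conv (mollifier n) l y" for y
      proof -
        \<comment> \<open>Evenness of the kernel makes mollification self-adjoint.\<close>
        have "mollifier n (x - y) = mollifier n (y - x)" for x using mollifier_uminus[of n "x - y"] by simp
        then show ?thesis by (simp add: torus_conv_real mult.commute)
      qed
      have "(LINT x|torus. g x * l x) = (LINT x|torus. LINT y|torus. h y * (mollifier n (x - y) * l x))"
      proof (rule Bochner_Integration.integral_cong[OF refl])
        fix x :: "real^'d" show "g x * l x = (LINT y|torus. h y * (mollifier n (x - y) * l x))"
          using integral_mult_left_zero[of torus "\<lambda>y. h y * mollifier n (x - y)" "l x"]
          by (simp add: g_def torus_conv_real mult.assoc)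
      qed
      also have "\<dots> = (LINT y|torus. h y * torus_conv (mollifier n) l y)" unfolding fub2(1) cl ..
      also have "\<dots> \<ge> (LINT y|torus. h y * l y - \<kappa> * h y)"
      proof (rule integral_mono)
        show "integrable torus (\<lambda>y. h y * torus_conv (mollifier n) l y)"
          using tcont_integrable_mult[OF tcont_conv[OF tcont_mollifier tcont_integrable[OF tl]] hi] by simp
        fix y
        have "l y - \<kappa> \<le> torus_conv (mollifier n) l y" using elim[rule_format, of y] by linarith
        from mult_left_mono[OF this prob_density_nonneg[OF h, of y]]
        show "h y * l y - \<kappa> * h y \<le> h y * torus_conv (mollifier n) l y" by (simp add: algebra_simps)
      qed (use ihl hi in simp)
      also have "(LINT y|torus. h y * l y - \<kappa> * h y) = (LINT x|torus. h x * l x) - \<kappa>"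
        using ihl hi prob_density_integral[OF h] by simp
      finally show ?thesis .
    qed
    moreover have "entropy g = (LINT x|torus. g x * ln (g x)) - (LINT x|torus. g x * l x)"
    proof -
      have "g x * ln (g x / \<mu> x) = g x * ln (g x) - g x * l x" for x
        using g(2)[of x] \<mu>_pos[of x] by (simp add: l_def ln_div algebra_simps)
      then show ?thesis
        unfolding entropy_def using tcont_integrable[OF tcont_xlnx[OF g(1,2)]] tcont_integrable[OF tcont_mult[OF g(1) tl]] by simp
    qed
    ultimately show ?case using jensen I unfolding g_def by linarith
  qed
qed

text \<open>Convergence in L1 gives convergence almost everywhere along a subsequence, which
  suffices because the bound \<open>B\<close> holds for all large indices. Fatou's lemma is applied
  to the nonnegative \<open>excess\<close>.\<close>

lemma entropy_lower_semicontinuous: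
  assumes h: "prob_density h" and B: "\<forall>\<^sub>F n in sequentially. entropy (torus_conv (mollifier n) h) \<le> B"
  shows "(\<integral>\<^sup>+x. ennreal (excess h x) \<partial>torus) \<le> ennreal B"
proof -
  note hi = prob_density_integrable[OF h]
  define g where "g n = torus_conv (mollifier n) h" for n
  have g: "tcont (g n)" "0 < g n x" "(LINT x|torus. g n x) = 1" for n x
    using prob_density_conv_mollifier[OF h] by (auto simp: g_def)
  have "\<exists>r. strict_mono r \<and> (AE x in torus. (\<lambda>n. g (r n) x - h x) \<longlonglongrightarrow> 0)"
  proof (rule tendsto_L1_AE_subseq)
    show "integrable torus (\<lambda>x. g n x - h x)" for n using tcont_integrable[OF g(1)] hi by simp
    show "(\<lambda>n. LINT x|torus. norm (g n x - h x)) \<longlonglongrightarrow> 0"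
      using conv_mollifier_L1[OF hi] by (simp add: g_def)
  qed
  then obtain r where r: "strict_mono r" "AE x in torus. (\<lambda>n. g (r n) x - h x) \<longlonglongrightarrow> 0" by blast
  have "AE x in torus. ennreal (excess h x) = liminf (\<lambda>n. ennreal (excess (g (r n)) x))"
    using r(2)
  proof eventually_elim
    case (elim x)
    then have "(\<lambda>n. g (r n) x) \<longlonglongrightarrow> h x" by (simp add: LIM_zero_iff)
    then have "(\<lambda>n. ennreal (excess (g (r n)) x)) \<longlonglongrightarrow> ennreal (excess h x)"
      unfolding excess_def by (intro tendsto_intros xlnx_tendsto g \<mu>_pos)
    then show ?case by (simp add: lim_imp_Liminf)
  qed
  then have "(\<integral>\<^sup>+x. ennreal (excess h x) \<partial>torus) = (\<integral>\<^sup>+x. liminf (\<lambda>n. ennreal (excess (g (r n)) x)) \<partial>torus)"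
    by (rule nn_integral_cong_AE)
  also have "\<dots> \<le> liminf (\<lambda>n. \<integral>\<^sup>+x. ennreal (excess (g (r n)) x) \<partial>torus)"
    by (rule nn_integral_liminf) (intro measurable_compose[OF _ measurable_ennreal] excess_measurable tcont_measurable g)
  also have "\<dots> = liminf (\<lambda>n. ennreal (entropy (g (r n))))"
    by (simp add: nn_integral_excess g)
  also have "\<dots> \<le> ennreal B"
  proof -
    have "\<forall>\<^sub>F n in sequentially. entropy (g (r n)) \<le> B"
      using eventually_compose_filterlim[OF B filterlim_subseq[OF r(1)]] by (simp add: g_def)
    then have "\<forall>\<^sub>F n in sequentially. ennreal (entropy (g (r n))) \<le> ennreal B"
      by eventually_elim (rule ennreal_leI)
    then have "liminf (\<lambda>n. ennreal (entropy (g (r n)))) \<le> limsup (\<lambda>n. ennreal (entropy (g (r n))))"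
        "limsup (\<lambda>n. ennreal (entropy (g (r n)))) \<le> ennreal B"
      by (auto intro: Liminf_le_Limsup Limsup_bounded)
    then show ?thesis by (rule order_trans)
  qed
  finally show ?thesis .
qed

end

context mean_field_flow
begin

definition \<eta> :: real where "\<eta> = 8 * (pi\<^sup>2 / (\<beta> * \<Gamma>) - K)"

text \<open>The tolerance \<open>\<kappa>\<close> depends on \<open>\<delta>\<close> and
  \<open>t\<close> but not on \<open>n\<close>. For large \<open>n\<close> the initial entropy and
  the accumulated commutator error each take half of the extra \<open>\<delta>\<close>.\<close>

lemma mollified_bound:
  assumes \<delta>: "0 < \<delta>" "\<delta> < 1 / \<beta>" and t: "0 \<le> t" and e: "integrable torus (excess f0)"
  shows "(\<integral>\<^sup>+x. ennreal (excess (f t) x) \<partial>torus) \<le> ennreal (exp (- rate \<delta> * t) * ((LINT x|torus. excess f0 x) + \<delta>))"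
proof (rule entropy_lower_semicontinuous[OF prob[OF t]])
  define A where "A = exp (\<bar>rate \<delta>\<bar> * t) * t"
  have A: "0 \<le> A" using t by (simp add: A_def)
  \<comment> \<open>Chosen so that
    \<open>\<kappa> / (4 * \<delta>) * A = \<delta> / 2 * (A / (A + 1))\<close>.\<close>
  define \<kappa> where "\<kappa> = 2 * \<delta>\<^sup>2 / (A + 1)"
  have \<kappa>: "0 < \<kappa>" using A \<delta> by (simp add: \<kappa>_def)
  have k2: "\<kappa> / (4 * \<delta>) * A \<le> \<delta> / 2"
  proof -
    have "\<kappa> / (4 * \<delta>) = (2 * \<delta>\<^sup>2 / (4 * \<delta>)) / (A + 1)" by (simp add: \<kappa>_def mult.commute)
    also have "2 * \<delta>\<^sup>2 / (4 * \<delta>) = \<delta> / 2" using \<delta> by (simp add: power2_eq_square)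
    finally have "\<kappa> / (4 * \<delta>) = (\<delta> / 2) / (A + 1)" .
    then have "\<kappa> / (4 * \<delta>) * A = (\<delta> / 2) / (A + 1) * A" by simp
    also have "\<dots> \<le> \<delta> / 2" using mult_divide_succ_less[of "\<delta> / 2" A] \<delta> A by simp
    finally show ?thesis .
  qed
  have f0: "prob_density f0" using prob[of 0] initial by simp
  have "\<forall>\<^sub>F n in sequentially. \<forall>i\<in>UNIV. \<forall>h. prob_density h \<longrightarrow> commutator_error n h i \<le> \<kappa> / CARD('d)"
    using commutator_error_tendsto[of "\<kappa> / CARD('d)"] \<kappa> by (intro eventually_ball_finite) auto
  moreover have "\<forall>\<^sub>F n in sequentially. entropy (moll n 0) \<le> (LINT x|torus. excess f0 x) + \<delta> / 2"
    unfolding initial by (rule entropy_mollifier_le[OF f0 e]) (use \<delta> in simp)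
  ultimately show "\<forall>\<^sub>F n in sequentially. entropy (moll n t) \<le> exp (- rate \<delta> * t) * ((LINT x|torus. excess f0 x) + \<delta>)"
  proof eventually_elim
    case (elim n)
    have "(\<Sum>i\<in>UNIV. commutator_error n h i) \<le> \<kappa>" if "prob_density h" for h
    proof -
      have "(\<Sum>i\<in>UNIV. commutator_error n h i) \<le> (\<Sum>i\<in>(UNIV::'d set). \<kappa> / CARD('d))"
        using elim(1) that by (intro sum_mono) auto
      then show ?thesis by simp
    qed
    from entropy_decay[OF \<delta> t this less_imp_le[OF \<kappa>]]
    have "exp (rate \<delta> * t) * entropy (moll n t) \<le> entropy (moll n 0) + \<kappa> / (4 * \<delta>) * A"
      by (simp add: A_def mult.assoc)
    also have "\<dots> \<le> (LINT x|torus. excess f0 x) + \<delta>" using elim(2) k2 by linarith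
    finally have "exp (- rate \<delta> * t) * (exp (rate \<delta> * t) * entropy (moll n t)) \<le> exp (- rate \<delta> * t) * ((LINT x|torus. excess f0 x) + \<delta>)"
      by (rule mult_left_mono) simp
    then show ?case by (simp add: exp_minus field_simps)
  qed
qed

text \<open>An infinite initial entropy makes the right-hand side infinite, as the exponential is
  positive. Otherwise the bounds for the mollified flow depend continuously on
  \<open>\<delta>\<close>, which tends to 0 from the right.\<close>

lemma excess_decay:
  assumes t: "0 \<le> t"
  shows "(\<integral>\<^sup>+x. ennreal (excess (f t) x) \<partial>torus) \<le> (\<integral>\<^sup>+x. ennreal (excess f0 x) \<partial>torus) * ennreal (exp (- \<eta> * t))"
proof (cases "(\<integral>\<^sup>+x. ennreal (excess f0 x) \<partial>torus) = \<infinity>")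
  case True
  then show ?thesis by (simp add: ennreal_top_mult)
next
  case False
  have f0: "prob_density f0" using prob[of 0] initial by simp
  have ex0: "0 \<le> excess f0 x" for x by (rule excess_nonneg[of f0, OF prob_density_nonneg[OF f0]])
  have e: "integrable torus (excess f0)"
    using False excess_measurable[OF prob_density_measurable[OF f0]] ex0
    by (intro integrableI_nonneg) (auto simp: less_top)
  define x0 where "x0 = (LINT x|torus. excess f0 x)"
  have x0: "(\<integral>\<^sup>+x. ennreal (excess f0 x) \<partial>torus) = ennreal x0" "0 \<le> x0"
    unfolding x0_def using nn_integral_eq_integral[OF e] ex0 by auto
  let ?X = "\<integral>\<^sup>+x. ennreal (excess (f t) x) \<partial>torus"
  define b where "b \<delta> = exp (- rate \<delta> * t) * (x0 + \<delta>)" for \<delta>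
  have "(rate \<longlongrightarrow> 8 * pi\<^sup>2 / \<Gamma> * (1 / \<beta> - 0) - 8 * K) (at_right 0)"
    unfolding rate_def[abs_def] by (intro tendsto_intros)
  also have "8 * pi\<^sup>2 / \<Gamma> * (1 / \<beta> - 0) - 8 * K = \<eta>"
    using \<beta> \<Gamma>_pos by (simp add: \<eta>_def field_simps)
  finally have "(b \<longlongrightarrow> exp (- \<eta> * t) * (x0 + 0)) (at_right 0)"
    unfolding b_def[abs_def] by (intro tendsto_intros)
  then have "((\<lambda>\<delta>. ennreal (b \<delta>)) \<longlongrightarrow> ennreal (exp (- \<eta> * t) * x0)) (at_right 0)"
    by (intro tendsto_ennrealI) simp
  moreover have "\<forall>\<^sub>F \<delta> in at_right 0. ?X \<le> ennreal (b \<delta>)"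
  proof -
    have "\<forall>\<^sub>F \<delta> in at_right 0. \<delta> \<in> {0<..<1 / \<beta>}"
      using \<beta> by (intro eventually_at_right_real) simp
    then show ?thesis
      by eventually_elim (use mollified_bound[OF _ _ t e] in \<open>auto simp: b_def x0_def\<close>)
  qed
  ultimately have "?X \<le> ennreal (exp (- \<eta> * t) * x0)"
    by (rule tendsto_lowerbound) simp
  then show ?thesis
    using x0 by (simp add: ennreal_mult mult.commute)
qed

end

theorem proposition2p15:
  fixes V W finf f0 :: "real ^ 'd \<Rightarrow> real"
    and f :: "real \<Rightarrow> real ^ 'd \<Rightarrow> real"
    and \<beta> t :: real
  assumes "\<beta> > 0"
    and "C2_torus V" and "C2_torus W"
    and "\<And>x. W (- x) = W x"
    and "H_stable W \<or> Linf_norm W < 1 / \<beta>"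
    and "prob_density f0"
    and "McKean_Vlasov_solution \<beta> V W f0 f"
    and "invariant_density \<beta> V W finf"
    and "t \<ge> 0"
  shows "let \<Gamma> = exp (2 * \<beta> * (Linf_norm V + Linf_norm W));
             \<eta> = 8 * (pi\<^sup>2 / (\<beta> * \<Gamma>) - Linf_norm (laplacian W)
                   - \<beta> * Linf_norm (grad W) * (Linf_norm (grad V) + Linf_norm (grad W)))
         in rel_entropy (f t) finf \<le> rel_entropy f0 finf * ereal (exp (- \<eta> * t))"
proof -
  interpret mean_field_flow \<beta> V W finf f0 f
    using assms by unfold_locales
  have \<eta>_eq: "8 * (pi\<^sup>2 / (\<beta> * exp (2 * \<beta> * (Linf_norm V + Linf_norm W))) - Linf_norm (laplacian W)
                   - \<beta> * Linf_norm (grad W) * (Linf_norm (grad V) + Linf_norm (grad W))) = \<eta>"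
    by (simp add: \<eta>_def \<Gamma>_def osc_def K_def)
  have "rel_entropy (f t) finf \<le> enn2ereal ((\<integral>\<^sup>+x. ennreal (excess f0 x) \<partial>torus) * ennreal (exp (- \<eta> * t)))"
    unfolding rel_entropy_eq[OF prob[OF \<open>t \<ge> 0\<close>]]
    using excess_decay[OF \<open>t \<ge> 0\<close>] by (simp add: less_eq_ennreal.rep_eq)
  also have "\<dots> = rel_entropy f0 finf * ereal (exp (- \<eta> * t))"
    by (simp add: rel_entropy_eq[OF \<open>prob_density f0\<close>] times_ennreal.rep_eq enn2ereal_ennreal)
  finally show ?thesis
    unfolding Let_def \<eta>_eq .
qed

end
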